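(* Let $G$ be a $K_5$-minor free graph with maximum degree $\Delta(G)\geq 7$. Then $\chi'(G)=\Delta(G)$.
   Context: All graphs are finite, undirected and simple. A graph $H$ is a minor of a graph $G$ if $H$ can be obtained from $G$ by deleting edges, deleting vertices and contracting edges (contracting an edge means deleting it, identifying its end-vertices, and deleting multiple edges). $G$ is $K_5$-minor free if it has no minor isomorphic to the complete graph $K_5$. An edge $k$-coloring of $G$ is an assignment of $k$ colors to the edges of $G$ such that no two adjacent edges receive the same color; the chromatic index $\chi'(G)$ is the minimum $k$ for which $G$ admits an edge $k$-coloring. *)

theory Defs
  imports Main
begin

datatype 'a ugraph = UGraph (verts: "'a set") (edges: "'a set set")

definition simple_graph :: "'a ugraph \<Rightarrow> bool" where
  "simple_graph G \<longleftrightarrow> finite (verts G) \<and> (\<forall>e\<in>edges G. e \<subseteq> verts G \<and> card e = 2)"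

definition degree :: "'a ugraph \<Rightarrow> 'a \<Rightarrow> nat" where
  "degree G v = card {e \<in> edges G. v \<in> e}"

text \<open>Inserting 0 only affects the graph without vertices, where the maximum of the
  empty set would be an unspecified number.\<close>

definition max_degree :: "'a ugraph \<Rightarrow> nat" where
  "max_degree G = Max (insert 0 (degree G ` verts G))"

definition graph_isomorphic :: "'a ugraph \<Rightarrow> 'b ugraph \<Rightarrow> bool" where
  "graph_isomorphic G H \<longleftrightarrow>
     (\<exists>f. bij_betw f (verts G) (verts H) \<and> edges H = (\<lambda>e. f ` e) ` edges G)"

definition complete_graph :: "nat \<Rightarrow> nat ugraph" where
  "complete_graph n = UGraph {..<n} {{i, j} | i j. i < n \<and> j < n \<and> i \<noteq> j}"

definition delete_edge :: "'a ugraph \<Rightarrow> 'a set \<Rightarrow> 'a ugraph" where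
  "delete_edge G e = UGraph (verts G) (edges G - {e})"

definition delete_vertex :: "'a ugraph \<Rightarrow> 'a \<Rightarrow> 'a ugraph" where
  "delete_vertex G v = UGraph (verts G - {v}) {e \<in> edges G. v \<notin> e}"

text \<open>Contraction of the edge joining \<open>u\<close> and \<open>v\<close>: the vertex resulting from the
  identification is represented by \<open>u\<close>. The contracted edge itself is mapped to \<open>{u}\<close>, which is
  removed; multiple edges are merged because edges form a set.\<close>

definition contract_edge :: "'a ugraph \<Rightarrow> 'a \<Rightarrow> 'a \<Rightarrow> 'a ugraph" where
  "contract_edge G u v =
     UGraph (verts G - {v}) ((\<lambda>e. (\<lambda>x. if x = v then u else x) ` e) ` edges G - {{u}})"

inductive minor_step :: "'a ugraph \<Rightarrow> 'a ugraph \<Rightarrow> bool" where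
  del_edge: "e \<in> edges G \<Longrightarrow> minor_step G (delete_edge G e)"
| del_vertex: "v \<in> verts G \<Longrightarrow> minor_step G (delete_vertex G v)"
| contract: "{u, v} \<in> edges G \<Longrightarrow> u \<noteq> v \<Longrightarrow> minor_step G (contract_edge G u v)"

definition is_minor :: "'b ugraph \<Rightarrow> 'a ugraph \<Rightarrow> bool" where
  "is_minor H G \<longleftrightarrow> (\<exists>G'. minor_step\<^sup>*\<^sup>* G G' \<and> graph_isomorphic G' H)"

definition K5_minor_free :: "'a ugraph \<Rightarrow> bool" where
  "K5_minor_free G \<longleftrightarrow> \<not> is_minor (complete_graph 5) G"

definition edge_coloring :: "'a ugraph \<Rightarrow> nat \<Rightarrow> ('a set \<Rightarrow> nat) \<Rightarrow> bool" where
  "edge_coloring G k c \<longleftrightarrow>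
     (\<forall>e\<in>edges G. c e < k) \<and>
     (\<forall>e\<in>edges G. \<forall>f\<in>edges G. e \<noteq> f \<and> e \<inter> f \<noteq> {} \<longrightarrow> c e \<noteq> c f)"

definition chromatic_index :: "'a ugraph \<Rightarrow> nat" where
  "chromatic_index G = (LEAST k. \<exists>c. edge_coloring G k c)"

end

theory Submission
  imports Complex_Main Defs "HOL-Combinatorics.Transposition"
begin

text \<open>
  Let \<open>k \<ge> 7\<close> be the maximum degree and suppose that \<open>G\<close> has no proper edge colouring with \<open>k\<close>
  colours; pass to a minimal subgraph \<open>E\<close> with this property. Planarity and Wagner's structure theorem
  are not needed: the only consequence of the excluded minor that is used is Mader's bound
  \<open>|E| \<le> 3 |V| - 6\<close>, applied to minors of \<open>E\<close> obtained by contracting a matching. Hence \<open>\<Sum>(d v - 6)\<close>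
  plus the gains of the contractions is negative, where contracting an edge in \<open>t\<close> triangles gains
  \<open>4 - 2 t\<close>. These gains replace the charge of the faces of length at least four in a planar
  discharging argument.

  For \<open>k \<ge> 8\<close> Vizing's adjacency lemma alone makes \<open>\<Sum>(d v - 6)\<close> nonnegative. For \<open>k = 7\<close> one uses
  further adjacency lemmas, proved with Kempe chains and Kierstead paths. They say that around a vertex
  of small degree that cannot be satisfied by its neighbours some edge lies in at most one triangle, so
  that a contraction can pay for it.
\<close>

section \<open>Proper edge colourings, missing colours and Kempe chains\<close>

text \<open>The obstacle at \<open>k = 7\<close> is that a vertex of degree 7 has a single unit to
  give. A vertex of degree 2 gets 2 of the 4 units that it lacks, and the other small degrees can
  fall short as well. The density bound holds in every minor, and an edge in
  \<open>t \<le> 1\<close> triangles takes with it only \<open>1 + t\<close> edges for one vertex,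
  so its contraction is worth at least 2. Such gains are not additive: two contracted edges may
  share an end or be opposite edges of a four-cycle. Hence a maximal family of edges without such
  clashes is contracted, and an unsatisfied vertex whose own edge was left out is paid by a chosen
  edge that clashes with it. The amount per vertex is fixed by how many vertices can compete for one
  edge. The adjacency lemmas, in turn, are plays of one abstract game: Kempe changes that leave both
  ends of the uncoloured edge alone permute the colours around a third vertex until a known
  forbidden position appears.\<close>

definition proper :: "nat \<Rightarrow> 'a set set \<Rightarrow> ('a set \<Rightarrow> nat) \<Rightarrow> bool" where
  "proper k F c \<longleftrightarrow> (\<forall>e\<in>F. c e < k) \<and> (\<forall>e\<in>F. \<forall>f\<in>F. e \<noteq> f \<and> e \<inter> f \<noteq> {} \<longrightarrow> c e \<noteq> c f)"

definition mis :: "nat \<Rightarrow> 'a set set \<Rightarrow> ('a set \<Rightarrow> nat) \<Rightarrow> 'a \<Rightarrow> nat set" where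
  "mis k F c v = {a. a < k \<and> (\<forall>e\<in>F. v \<in> e \<longrightarrow> c e \<noteq> a)}"

lemma mis_lt: "a \<in> mis k F c v \<Longrightarrow> a < k"
  by (simp add: mis_def)

lemma finite_mis [simp]: "finite (mis k F c v)"
  by (rule finite_subset[of _ "{..<k}"]) (auto simp: mis_def)

lemma proper_lt: "proper k F c \<Longrightarrow> e \<in> F \<Longrightarrow> c e < k"
  by (simp add: proper_def)

lemma proper_inj:
  "proper k F c \<Longrightarrow> e \<in> F \<Longrightarrow> f \<in> F \<Longrightarrow> v \<in> e \<Longrightarrow> v \<in> f \<Longrightarrow> c e = c f \<Longrightarrow> e = f"
  unfolding proper_def by blast

lemma proper_nbr_inj:
  assumes "proper k F c" "{v, u} \<in> F" "{v, w} \<in> F" "c {v, u} = c {v, w}"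
  shows "u = w"
proof -
  have "{v, u} = {v, w}" using proper_inj[OF assms(1-3), of v] assms(4) by simp
  then show ?thesis by (auto simp: doubleton_eq_iff)
qed

lemma proper_mono: "proper k F c \<Longrightarrow> F' \<subseteq> F \<Longrightarrow> proper k F' c"
  unfolding proper_def by blast

lemma proper_insert:
  assumes "proper k F c" "a \<in> mis k F c u" "a \<in> mis k F c v" "{u, v} \<notin> F"
  shows "proper k (insert {u, v} F) (c({u, v} := a))"
  using assms unfolding proper_def mis_def by (auto split: if_splits)

lemma mis_insert:
  assumes "e \<notin> F"
  shows "mis k (insert e F) (c(e := a)) w = (if w \<in> e then mis k F c w - {a} else mis k F c w)"
  using assms unfolding mis_def by auto

lemma mis_remove:
  assumes "proper k F c" "e \<in> F"
  shows "mis k (F - {e}) c w = (if w \<in> e then insert (c e) (mis k F c w) else mis k F c w)"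
  using assms unfolding mis_def proper_def by auto

lemma card_mis:
  assumes p: "proper k F c" and f: "finite F"
  shows "card (mis k F c v) + card {e\<in>F. v \<in> e} = k"
proof -
  have "inj_on c {e\<in>F. v \<in> e}" using proper_inj[OF p] by (auto intro!: inj_onI)
  then have 1: "card (c ` {e\<in>F. v \<in> e}) = card {e\<in>F. v \<in> e}" by (rule card_image)
  have 2: "mis k F c v = {..<k} - c ` {e\<in>F. v \<in> e}"
    by (auto simp: mis_def)
  have 3: "c ` {e\<in>F. v \<in> e} \<subseteq> {..<k}" using proper_lt[OF p] by auto
  have "card (mis k F c v) = k - card (c ` {e\<in>F. v \<in> e})"
    unfolding 2 using card_Diff_subset[OF _ 3] f by simp
  moreover have "card (c ` {e\<in>F. v \<in> e}) \<le> k" using card_mono[OF _ 3] by simp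
  ultimately show ?thesis using 1 by simp
qed

lemma proper_recolour:
  assumes p: "proper k F c" and e: "{u, v} \<in> F" and a: "a \<in> mis k F c u" "a \<in> mis k F c v"
  shows "proper k F (c({u, v} := a))"
    and "mis k F (c({u, v} := a)) w =
      (if w = u \<or> w = v then insert (c {u, v}) (mis k F c w) - {a} else mis k F c w)"
proof -
  let ?F = "F - {{u, v}}"
  have F: "insert {u, v} ?F = F" using e by blast
  have m: "mis k ?F c w = (if w \<in> {u, v} then insert (c {u, v}) (mis k F c w) else mis k F c w)" for w
    by (rule mis_remove[OF p e])
  have "proper k (insert {u, v} ?F) (c({u, v} := a))"
    by (rule proper_insert) (use proper_mono[OF p, of ?F] a m in auto)
  then show "proper k F (c({u, v} := a))" using F by simp
  have "mis k (insert {u, v} ?F) (c({u, v} := a)) w = (if w \<in> {u, v} then mis k ?F c w - {a} else mis k ?F c w)"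
    by (rule mis_insert) auto
  then show "mis k F (c({u, v} := a)) w =
      (if w = u \<or> w = v then insert (c {u, v}) (mis k F c w) - {a} else mis k F c w)"
    using F m by auto
qed

text \<open>The unit step of a fan rotation: the uncoloured place travels from \<open>{x, y}\<close>
  to \<open>{x, s}\<close>, while the colours missing at \<open>x\<close> stay the same.\<close>

lemma proper_shift:
  assumes p: "proper k F c" and n: "{x, y} \<notin> F" and e: "{x, s} \<in> F" and a: "c {x, s} \<in> mis k F c y"
    and ne: "x \<noteq> y" "x \<noteq> s"
  shows "proper k (insert {x, y} (F - {{x, s}})) (c({x, y} := c {x, s}))"
    and "mis k (insert {x, y} (F - {{x, s}})) (c({x, y} := c {x, s})) w =
      (if w = y then mis k F c y - {c {x, s}} else if w = s then insert (c {x, s}) (mis k F c s) else mis k F c w)"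
proof -
  have sy: "s \<noteq> y" using n e by auto
  let ?F = "F - {{x, s}}"
  have m: "mis k ?F c w = (if w \<in> {x, s} then insert (c {x, s}) (mis k F c w) else mis k F c w)" for w
    by (rule mis_remove[OF p e])
  show "proper k (insert {x, y} ?F) (c({x, y} := c {x, s}))"
    by (rule proper_insert) (use proper_mono[OF p, of ?F] a m n sy in auto)
  have "mis k (insert {x, y} ?F) (c({x, y} := c {x, s})) w = (if w \<in> {x, y} then mis k ?F c w - {c {x, s}} else mis k ?F c w)"
    by (rule mis_insert) (use n in auto)
  moreover have "c {x, s} \<notin> mis k F c x" using e by (auto simp: mis_def)
  ultimately show "mis k (insert {x, y} (F - {{x, s}})) (c({x, y} := c {x, s})) w =
      (if w = y then mis k F c y - {c {x, s}} else if w = s then insert (c {x, s}) (mis k F c s) else mis k F c w)"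
    using m sy ne by auto
qed

section \<open>Kempe changes\<close>

definition kclosed :: "'a set set \<Rightarrow> ('a set \<Rightarrow> nat) \<Rightarrow> nat \<Rightarrow> nat \<Rightarrow> 'a set \<Rightarrow> bool" where
  "kclosed F c a b C \<longleftrightarrow> (\<forall>e\<in>F. c e = a \<or> c e = b \<longrightarrow> e \<inter> C \<noteq> {} \<longrightarrow> e \<subseteq> C)"

text \<open>All edges meeting \<open>C\<close> are transposed, not only those coloured
  \<open>a\<close> or \<open>b\<close>: other colours are fixed by the transposition, and for a
  closed \<open>C\<close> the edges of the two colours that meet \<open>C\<close> lie inside it.
  Closed sets are unions of two-coloured components, so complements are admissible too.\<close>

definition kswap :: "'a set \<Rightarrow> nat \<Rightarrow> nat \<Rightarrow> ('a set \<Rightarrow> nat) \<Rightarrow> 'a set \<Rightarrow> nat" where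
  "kswap C a b c e = (if e \<inter> C = {} then c e else transpose a b (c e))"

lemma kclosed_Compl: "kclosed F c a b C \<Longrightarrow> kclosed F c a b (- C)"
  unfolding kclosed_def by blast

lemma kswap_proper:
  assumes p: "proper k F c" and cl: "kclosed F c a b C" and ab: "a < k" "b < k"
  shows "proper k F (kswap C a b c)"
    and "mis k F (kswap C a b c) v = (if v \<in> C then transpose a b ` mis k F c v else mis k F c v)"
proof -
  have in_C: "kswap C a b c e = transpose a b (c e)" if "e \<in> F" "v \<in> e" "v \<in> C" for e v
    using that by (auto simp: kswap_def)
  have out_C: "kswap C a b c e = c e" if "e \<in> F" "v \<in> e" "v \<notin> C" for e v
    using that cl unfolding kclosed_def kswap_def by (auto simp: transpose_def)
  have lt: "transpose a b i < k \<longleftrightarrow> i < k" for i using ab by (simp add: transpose_def)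
  show "proper k F (kswap C a b c)"
    unfolding proper_def
  proof (intro conjI ballI impI)
    fix e assume "e \<in> F"
    then show "kswap C a b c e < k" using proper_lt[OF p] lt by (auto simp: kswap_def)
  next
    fix e f assume ef: "e \<in> F" "f \<in> F" "e \<noteq> f \<and> e \<inter> f \<noteq> {}"
    then obtain v where v: "v \<in> e" "v \<in> f" by blast
    have "c e \<noteq> c f" using p ef unfolding proper_def by blast
    then show "kswap C a b c e \<noteq> kswap C a b c f"
      using in_C[OF ef(1) v(1)] in_C[OF ef(2) v(2)] out_C[OF ef(1) v(1)] out_C[OF ef(2) v(2)]
      by (cases "v \<in> C") (auto simp: transpose_eq_iff)
  qed
  show "mis k F (kswap C a b c) v = (if v \<in> C then transpose a b ` mis k F c v else mis k F c v)"
  proof (cases "v \<in> C")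
    case True
    have eq: "kswap C a b c e \<noteq> i \<longleftrightarrow> c e \<noteq> transpose a b i" if "e \<in> F" "v \<in> e" for e i
      unfolding in_C[OF that True] by (auto simp: transpose_def)
    have "i \<in> mis k F (kswap C a b c) v \<longleftrightarrow> transpose a b i \<in> mis k F c v" for i
      unfolding mis_def mem_Collect_eq lt using eq by blast
    then have "mis k F (kswap C a b c) v = transpose a b ` mis k F c v"
      by (intro set_eqI) (simp only: in_transpose_image_iff)
    then show ?thesis using True by simp
  next
    case False
    then show ?thesis using out_C by (auto simp: mis_def)
  qed
qed

lemma kswap_edge:
  assumes "kclosed F c a b C" "e \<in> F" "v \<in> e"
  shows "kswap C a b c e = (if v \<in> C then transpose a b (c e) else c e)"
  using assms unfolding kclosed_def kswap_def
  by (auto simp: transpose_def)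

text \<open>The chain is traced as a walk whose state records the vertex, the colour of the edge along
  which it was entered, and the colour along which it is to be left.\<close>

lemma kempe_chain:
  assumes p: "proper k F c" and F2: "\<And>e. e \<in> F \<Longrightarrow> card e = 2" and x: "a \<in> mis k F c x"
  obtains C where "kclosed F c a b C" "x \<in> C"
    "\<And>u v. u \<in> C \<Longrightarrow> v \<in> C \<Longrightarrow> u \<noteq> x \<Longrightarrow> v \<noteq> x \<Longrightarrow> a \<in> mis k F c u \<or> b \<in> mis k F c u \<Longrightarrow>
       a \<in> mis k F c v \<or> b \<in> mis k F c v \<Longrightarrow> u = v"
proof -
  define st where "st = (\<lambda>(v, p, q). if \<exists>u. {v, u} \<in> F \<and> c {v, u} = q
     then (SOME u. {v, u} \<in> F \<and> c {v, u} = q, q, p) else (v, p, q))"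
  define w where "w n = (st ^^ n) (x, a, b)" for n
  define C where "C = range (\<lambda>n. fst (w n))"
  have w0: "w 0 = (x, a, b)" and wS: "w (Suc n) = st (w n)" for n by (auto simp: w_def)
  have inv: "\<exists>v p q. w n = (v, p, q) \<and> {p, q} = {a, b} \<and>
     ((v = x \<and> p = a) \<or> (\<exists>u\<in>C. {v, u} \<in> F \<and> c {v, u} = p))" for n
  proof (induction n)
    case 0 then show ?case by (simp add: w0)
  next
    case (Suc n)
    then obtain v p q where I: "w n = (v, p, q)" "{p, q} = {a, b}"
      "(v = x \<and> p = a) \<or> (\<exists>u\<in>C. {v, u} \<in> F \<and> c {v, u} = p)" by blast
    show ?case
    proof (cases "\<exists>u. {v, u} \<in> F \<and> c {v, u} = q")
      case True
      define u where "u = (SOME u. {v, u} \<in> F \<and> c {v, u} = q)"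
      have u: "{v, u} \<in> F \<and> c {v, u} = q" unfolding u_def using True by (rule someI_ex)
      have "w (Suc n) = (u, q, p)" using True by (simp add: wS I st_def u_def)
      moreover have "v \<in> C" using I(1) unfolding C_def by (metis fst_conv rangeI)
      ultimately show ?thesis using u I(2) by (auto simp: insert_commute)
    next
      case False
      then have "w (Suc n) = w n" unfolding wS I st_def by auto
      then show ?thesis using Suc by simp
    qed
  qed
  have cl: "kclosed F c a b C"
    unfolding kclosed_def
  proof (intro ballI impI)
    fix e assume e: "e \<in> F" "c e = a \<or> c e = b" "e \<inter> C \<noteq> {}"
    then obtain n v where v: "v \<in> e" "v = fst (w n)" unfolding C_def by blast
    obtain u where eu: "e = {v, u}" using F2[OF e(1)] v(1) by (auto simp: card_2_iff)
    obtain v' p q where I': "w n = (v', p, q)" "{p, q} = {a, b}"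
      "(v' = x \<and> p = a) \<or> (\<exists>u\<in>C. {v', u} \<in> F \<and> c {v', u} = p)" using inv[of n] by blast
    have "v' = v" using I'(1) v(2) by simp
    note I = I'[unfolded this]
    have vC: "v \<in> C" using v(2) by (auto simp: C_def)
    have "c e = p \<or> c e = q" using e(2) I(2) by auto
    then have "u \<in> C"
    proof
      assume "c e = p"
      then have "\<exists>u\<in>C. {v, u} \<in> F \<and> c {v, u} = p" using I(3) x e(1) v(1) by (auto simp: mis_def)
      then obtain u' where "u' \<in> C" "{v, u'} \<in> F" "c {v, u'} = p" by blast
      then show ?thesis using proper_nbr_inj[OF p, of v u u'] e(1) eu \<open>c e = p\<close> by auto
    next
      assume q: "c e = q"
      then have ex: "\<exists>u. {v, u} \<in> F \<and> c {v, u} = q" using eu e(1) by blast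
      define u' where "u' = (SOME u. {v, u} \<in> F \<and> c {v, u} = q)"
      have u': "{v, u'} \<in> F \<and> c {v, u'} = q" unfolding u'_def using ex by (rule someI_ex)
      have "u' = fst (w (Suc n))" using ex by (simp add: wS I st_def u'_def)
      then have "u' \<in> C" unfolding C_def by blast
      then show ?thesis using proper_nbr_inj[OF p, of v u u'] u' eu e(1) q by auto
    qed
    then show "e \<subseteq> C" using vC eu by simp
  qed
  \<comment> \<open>Such a vertex was entered along one of the two colours and misses the other, so
    the walk never leaves it. Two vertices of this kind on the walk must therefore be equal.\<close>
  have stuck: "w j = w i" if ij: "i \<le> j" and u: "fst (w i) = u" "u \<noteq> x" "a \<in> mis k F c u \<or> b \<in> mis k F c u" for i j u
  proof -
    obtain u' p q where I': "w i = (u', p, q)" "{p, q} = {a, b}"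
      "(u' = x \<and> p = a) \<or> (\<exists>t\<in>C. {u', t} \<in> F \<and> c {u', t} = p)" using inv[of i] by blast
    have "u' = u" using I'(1) u(1) by simp
    note I = I'[unfolded this]
    have "p \<notin> mis k F c u" using I(3) u(2) by (auto simp: mis_def)
    then have "q \<in> mis k F c u" using u(3) I(2) by (auto simp: doubleton_eq_iff)
    then have "\<not> (\<exists>u'. {u, u'} \<in> F \<and> c {u, u'} = q)" by (auto simp: mis_def)
    then have s: "st (w i) = w i" unfolding I st_def by auto
    show ?thesis using ij by (induction j rule: dec_induct) (simp_all add: wS s)
  qed
  have "x \<in> C" unfolding C_def using w0 by (metis fst_conv rangeI)
  moreover have "u = v" if uv: "u \<in> C" "v \<in> C" "u \<noteq> x" "v \<noteq> x" "a \<in> mis k F c u \<or> b \<in> mis k F c u"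
       "a \<in> mis k F c v \<or> b \<in> mis k F c v" for u v
  proof -
    obtain i j where "u = fst (w i)" "v = fst (w j)" using uv(1,2) unfolding C_def by blast
    then show ?thesis using stuck[of i j u] stuck[of j i v] uv by (metis linear)
  qed
  ultimately show ?thesis using that cl by blast
qed

definition nb :: "'a set set \<Rightarrow> 'a \<Rightarrow> 'a set" where
  "nb E v = {u. {v, u} \<in> E}"

definition dg :: "'a set set \<Rightarrow> 'a \<Rightarrow> nat" where
  "dg E v = card (nb E v)"

lemma card_incident:
  assumes "\<And>e. e \<in> E \<Longrightarrow> card e = 2"
  shows "card {e\<in>E. v \<in> e} = dg E v"
proof -
  have "bij_betw (\<lambda>u. {v, u}) (nb E v) {e\<in>E. v \<in> e}"
    unfolding bij_betw_def
  proof
    show "inj_on (\<lambda>u. {v, u}) (nb E v)" by (auto intro!: inj_onI simp: doubleton_eq_iff)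
    show "(\<lambda>u. {v, u}) ` nb E v = {e\<in>E. v \<in> e}"
    proof (intro equalityI subsetI)
      fix e assume e: "e \<in> {e\<in>E. v \<in> e}"
      then have "card e = 2" using assms by blast
      then obtain a b where "e = {a, b}" by (auto simp: card_2_iff)
      then have "e = {v, a} \<or> e = {v, b}" using e by (auto simp: insert_commute)
      then show "e \<in> (\<lambda>u. {v, u}) ` nb E v" using e by (auto simp: nb_def)
    qed (auto simp: nb_def)
  qed
  then show ?thesis unfolding dg_def by (simp add: bij_betw_same_card)
qed

text \<open>\<open>j\<close> is the colour of a tracked edge at a
  vertex missing \<open>d1\<close> and \<open>d2\<close>, and a Kempe change for \<open>a \<in> A\<close>, \<open>b \<in> B\<close> transposes all three
  whenever that vertex misses \<open>a\<close> or \<open>b\<close>.\<close>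

lemma colour_game:
  assumes mv: "\<And>j d1 d2 a b. P j d1 d2 \<Longrightarrow> a \<in> A \<Longrightarrow> b \<in> B \<Longrightarrow> a = d1 \<or> a = d2 \<or> b = d1 \<or> b = d2 \<Longrightarrow>
      P (transpose a b j) (transpose a b d1) (transpose a b d2)"
    and fin: "\<And>j d. j \<in> A \<Longrightarrow> P j i d \<Longrightarrow> False"
    and sym: "\<And>j d1 d2. P j d1 d2 \<Longrightarrow> P j d2 d1"
    and iB: "i \<in> B" and AB: "A \<inter> B = {}"
    and two: "\<And>j d1 d2. P j d1 d2 \<Longrightarrow> d1 \<noteq> d2 \<or> (\<exists>a\<in>A. \<exists>a'\<in>A. a \<noteq> a')" and A0: "A \<noteq> {}"
    and P: "P j d1 d2" "j \<in> A \<union> B" "d1 \<in> A \<union> B" "d2 \<in> A \<union> B" "j \<noteq> d1" "j \<noteq> d2"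
  shows False
proof -
  have G1: False if "P j d1 d2" "j \<in> A" "d1 \<in> A" "j \<noteq> d1" for j d1 d2
  proof -
    have "P (transpose d1 i j) (transpose d1 i d1) (transpose d1 i d2)"
      by (rule mv) (use that iB in auto)
    moreover have "transpose d1 i j = j" using that iB AB by (auto simp: transpose_def)
    ultimately show False using fin that by simp
  qed
  have G2: False if P: "P j d1 d2" and j: "j \<in> A" and d: "d1 \<in> B" "d2 \<in> B" "d1 \<noteq> d2" for j d1 d2
  proof (cases "d1 = i \<or> d2 = i")
    case True
    then show ?thesis using fin[OF j] P sym by blast
  next
    case False
    have ne: "j \<noteq> d1" "j \<noteq> d2" "j \<noteq> i" using AB j d iB by auto
    \<comment> \<open>The colour \<open>j\<close> is the \<open>A\<close>-colour of all four
      changes: it goes from the edge to the first missing colour, is replaced there by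
      \<open>i\<close>, takes the place of the second missing colour and from there returns to the
      edge. This is why two different missing colours are wanted.\<close>
    have "P d1 j d2" using mv[OF P j d(1)] ne d(3) by (simp add: transpose_def)
    from mv[OF this j iB] have "P d1 i d2" using ne False by (simp add: transpose_def)
    from mv[OF this j d(2)] have "P d1 i j" using ne False d(3) by (auto simp: transpose_def)
    from mv[OF this j d(1)] have "P j i d1" using ne False d(3) by (auto simp: transpose_def)
    then show False using fin[OF j] by blast
  qed
  have G3: False if P: "P j d1 d2" and j: "j \<in> A" and d: "d1 \<in> A \<union> B" "d2 \<in> A \<union> B" "j \<noteq> d1" "j \<noteq> d2" for j d1 d2
  proof (cases "d1 \<in> A \<or> d2 \<in> A")
    case True
    then show ?thesis using G1[OF P j] G1[OF sym[OF P] j] d by blast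
  next
    case False
    then have dB: "d1 \<in> B" "d2 \<in> B" using d by auto
    show ?thesis
    proof (cases "d1 = d2")
      case True
      then obtain a where a: "a \<in> A" "a \<noteq> j" using two[OF P] by blast
      show ?thesis
      proof (cases "d1 = i")
        case True then show ?thesis using fin[OF j] P by blast
      next
        case False
        have "P (transpose a d1 j) (transpose a d1 d1) (transpose a d1 d2)"
          by (rule mv[OF P a(1) dB(1)]) simp
        then have "P j a a" using a d True by (simp add: transpose_def)
        then show ?thesis using G1 j a by blast
      qed
    next
      case False
      then show ?thesis using G2[OF P j dB] by blast
    qed
  qed
  have G4: False if P: "P j d1 d2" and j: "j \<in> B" and d: "d1 \<in> A" "d2 \<in> A \<union> B" "j \<noteq> d2" for j d1 d2
  proof -
    have ne: "j \<noteq> d1" using AB j d by auto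
    have "P (transpose d1 j j) (transpose d1 j d1) (transpose d1 j d2)"
      by (rule mv[OF P d(1) j]) simp
    then have "P d1 j (transpose d1 j d2)" by simp
    then show False
      by (rule G3) (use d ne j in \<open>auto simp: transpose_def\<close>)
  qed
  show False
  proof (cases "j \<in> A")
    case True
    then show ?thesis using G3[OF P(1)] P by blast
  next
    case jB: False
    then have j: "j \<in> B" using P by blast
    show ?thesis
    proof (cases "d1 \<in> A \<or> d2 \<in> A")
      case True
      then show ?thesis using G4[OF P(1) j] G4[OF sym[OF P(1)] j] P by blast
    next
      case False
      obtain a where a: "a \<in> A" using A0 by blast
      have "P (transpose a d1 j) (transpose a d1 d1) (transpose a d1 d2)"
        by (rule mv[OF P(1) a]) (use False P in auto)
      moreover have "transpose a d1 j = j" using P a jB by (auto simp: transpose_def)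
      ultimately have "P j a (transpose a d1 d2)" by simp
      then show ?thesis
        by (rule G4) (use a j P False AB in \<open>auto simp: transpose_def\<close>)
    qed
  qed
qed

section \<open>Adjacency lemmas for edge-critical graphs\<close>

locale critical =
  fixes E :: "'a set set" and k :: nat
  assumes finE: "finite E" and card2: "\<And>e. e \<in> E \<Longrightarrow> card e = 2"
    and deg_le: "\<And>v. dg E v \<le> k"
    and uncol: "\<And>c. \<not> proper k E c"
    and crit: "\<And>e. e \<in> E \<Longrightarrow> \<exists>c. proper k (E - {e}) c"
begin

abbreviation N :: "'a \<Rightarrow> 'a set" where "N \<equiv> nb E"
abbreviation d :: "'a \<Rightarrow> nat" where "d \<equiv> dg E"

section \<open>Colourings of all edges but one, and Kierstead paths\<close>

definition pc :: "'a \<Rightarrow> 'a \<Rightarrow> ('a set \<Rightarrow> nat) \<Rightarrow> bool" where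
  "pc x y c \<longleftrightarrow> {x, y} \<in> E \<and> proper k (E - {{x, y}}) c"

abbreviation ms :: "'a \<Rightarrow> 'a \<Rightarrow> ('a set \<Rightarrow> nat) \<Rightarrow> 'a \<Rightarrow> nat set" where
  "ms x y c \<equiv> mis k (E - {{x, y}}) c"

lemma edge_neq: "{x, y} \<in> E \<Longrightarrow> x \<noteq> y"
  using card2[of "{x, y}"] by auto

lemma nb_irrefl: "x \<notin> N x"
  using edge_neq[of x x] by (auto simp: nb_def)

lemma finite_N [simp]: "finite (N v)"
proof -
  have "N v \<subseteq> \<Union>E" by (auto simp: nb_def)
  moreover have "finite (\<Union>E)" using finE card2 by (metis card.infinite finite_Union zero_neq_numeral)
  ultimately show ?thesis by (rule finite_subset)
qed

lemma pc_ex: "{x, y} \<in> E \<Longrightarrow> \<exists>c. pc x y c"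
  using crit by (auto simp: pc_def)

lemma pc_edge: "pc x y c \<Longrightarrow> {x, y} \<in> E" and pc_neq: "pc x y c \<Longrightarrow> x \<noteq> y"
  and pc_proper: "pc x y c \<Longrightarrow> proper k (E - {{x, y}}) c"
  using edge_neq by (auto simp: pc_def)

lemma pc_disj: "pc x y c \<Longrightarrow> a \<in> ms x y c x \<Longrightarrow> a \<in> ms x y c y \<Longrightarrow> False"
  using proper_insert[of k "E - {{x, y}}" c a x y] uncol
  by (simp add: pc_def insert_absorb)

lemma card_ms:
  assumes pc: "pc x y c"
  shows "card (ms x y c v) + d v = (if v = x \<or> v = y then k + 1 else k)"
proof -
  have 1: "card (ms x y c v) + card {e \<in> E - {{x, y}}. v \<in> e} = k"
    by (rule card_mis[OF pc_proper[OF pc]]) (simp add: finE)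
  have 2: "card {e\<in>E. v \<in> e} = d v" by (rule card_incident[OF card2])
  show ?thesis
  proof (cases "v \<in> {x, y}")
    case True
    have "{e \<in> E - {{x, y}}. v \<in> e} = {e\<in>E. v \<in> e} - {{x, y}}" by blast
    moreover have "{x, y} \<in> {e\<in>E. v \<in> e}" using pc_edge[OF pc] True by simp
    ultimately have "card {e \<in> E - {{x, y}}. v \<in> e} = d v - 1" "d v > 0"
      using finE 2 by (auto simp: card_gt_0_iff simp flip: 2)
    then show ?thesis using 1 True by auto
  next
    case False
    then have "{e \<in> E - {{x, y}}. v \<in> e} = {e\<in>E. v \<in> e}" by blast
    then show ?thesis using 1 2 False by auto
  qed
qed

lemma ms_nonempty: "pc x y c \<Longrightarrow> ms x y c x \<noteq> {}" "pc x y c \<Longrightarrow> ms x y c y \<noteq> {}"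
  using card_ms[of x y c x] card_ms[of x y c y] deg_le[of x] deg_le[of y] by auto

lemma card_ms_Un:
  assumes "pc x y c"
  shows "card (ms x y c x \<union> ms x y c y) + d x + d y = 2 * k + 2"
proof -
  have "card (ms x y c x \<union> ms x y c y) = card (ms x y c x) + card (ms x y c y)"
    by (rule card_Un_disjoint) (use pc_disj[OF assms] in auto)
  then show ?thesis using card_ms[OF assms, of x] card_ms[OF assms, of y] by simp
qed

text \<open>If \<open>y\<close> were not on the chain from \<open>x\<close>, exchanging the two
  colours on that chain would make \<open>b\<close> missing at both ends of the uncoloured edge. A
  chain has two ends only, so no third vertex on it misses \<open>a\<close> or
  \<open>b\<close>.\<close>

lemma link:
  assumes pc: "pc x y c" and a: "a \<in> ms x y c x" and b: "b \<in> ms x y c y"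
  obtains C where "kclosed (E - {{x, y}}) c a b C" "x \<in> C" "y \<in> C"
    "\<And>z. z \<in> C \<Longrightarrow> z \<noteq> x \<Longrightarrow> z \<noteq> y \<Longrightarrow> a \<notin> ms x y c z \<and> b \<notin> ms x y c z"
proof -
  let ?F = "E - {{x, y}}"
  obtain C where C: "kclosed ?F c a b C" "x \<in> C"
    "\<And>u v. u \<in> C \<Longrightarrow> v \<in> C \<Longrightarrow> u \<noteq> x \<Longrightarrow> v \<noteq> x \<Longrightarrow> a \<in> ms x y c u \<or> b \<in> ms x y c u \<Longrightarrow>
       a \<in> ms x y c v \<or> b \<in> ms x y c v \<Longrightarrow> u = v"
    by (rule kempe_chain[OF pc_proper[OF pc] _ a, where b = b]) (use card2 in auto)
  have "y \<in> C"
  proof (rule ccontr)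
    assume y: "y \<notin> C"
    note sw = kswap_proper[OF pc_proper[OF pc] C(1) mis_lt[OF a] mis_lt[OF b]]
    have "pc x y (kswap C a b c)" using sw(1) pc_edge[OF pc] by (simp add: pc_def)
    moreover have "b \<in> ms x y (kswap C a b c) x" using sw(2)[of x] C(2) a by (simp add: in_transpose_image_iff)
    moreover have "b \<in> ms x y (kswap C a b c) y" using sw(2)[of y] y b by simp
    ultimately show False by (rule pc_disj)
  qed
  then show ?thesis using that[OF C(1,2)] C(3) b pc_neq[OF pc] by metis
qed

definition moved :: "'a \<Rightarrow> 'a \<Rightarrow> nat \<Rightarrow> nat \<Rightarrow> ('a set \<Rightarrow> nat) \<Rightarrow> ('a set \<Rightarrow> nat) \<Rightarrow> 'a \<Rightarrow> bool" where
  "moved x y a b c c' z \<longleftrightarrow> ms x y c' z = transpose a b ` ms x y c z \<and>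
     (\<forall>u. {z, u} \<in> E - {{x, y}} \<longrightarrow> c' {z, u} = transpose a b (c {z, u}))"

definition kept :: "'a \<Rightarrow> 'a \<Rightarrow> ('a set \<Rightarrow> nat) \<Rightarrow> ('a set \<Rightarrow> nat) \<Rightarrow> 'a \<Rightarrow> bool" where
  "kept x y c c' z \<longleftrightarrow> ms x y c' z = ms x y c z \<and>
     (\<forall>u. {z, u} \<in> E - {{x, y}} \<longrightarrow> c' {z, u} = c {z, u})"

text \<open>Everything is exchanged except the chain that joins \<open>x\<close> and
  \<open>y\<close>. So the colours at \<open>x\<close> and \<open>y\<close> are preserved, whereas
  any further vertex missing \<open>a\<close> or \<open>b\<close> is off that chain and changes.
  These are the moves of \<open>colour_game\<close>.\<close>

lemma move:
  assumes pc: "pc x y c" and a: "a \<in> ms x y c x" and b: "b \<in> ms x y c y"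
  obtains c' where "pc x y c'" "kept x y c c' x" "kept x y c c' y"
    "\<And>z. z \<noteq> x \<Longrightarrow> z \<noteq> y \<Longrightarrow> a \<in> ms x y c z \<or> b \<in> ms x y c z \<Longrightarrow> moved x y a b c c' z"
    "\<And>z. moved x y a b c c' z \<or> kept x y c c' z"
proof -
  obtain C where C: "kclosed (E - {{x, y}}) c a b C" "x \<in> C" "y \<in> C"
    "\<And>z. z \<in> C \<Longrightarrow> z \<noteq> x \<Longrightarrow> z \<noteq> y \<Longrightarrow> a \<notin> ms x y c z \<and> b \<notin> ms x y c z"
    using link[OF assms] by blast
  define c' where "c' = kswap (- C) a b c"
  note cl = kclosed_Compl[OF C(1)]
  note sw = kswap_proper[OF pc_proper[OF pc] cl mis_lt[OF a] mis_lt[OF b], folded c'_def]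
  have ed: "c' {z, u} = (if z \<notin> C then transpose a b (c {z, u}) else c {z, u})"
    if "{z, u} \<in> E - {{x, y}}" for z u
    using kswap_edge[OF cl that, of z] unfolding c'_def by simp
  have st: "kept x y c c' z" if "z \<in> C" for z using sw(2)[of z] ed that by (auto simp: kept_def)
  have mv: "moved x y a b c c' z" if "z \<notin> C" for z using sw(2)[of z] ed that by (auto simp: moved_def)
  show ?thesis
  proof (rule that)
    show "pc x y c'" using sw(1) pc_edge[OF pc] by (simp add: pc_def)
    show "kept x y c c' x" "kept x y c c' y" using st C by auto
    show "moved x y a b c c' z" if "z \<noteq> x" "z \<noteq> y" "a \<in> ms x y c z \<or> b \<in> ms x y c z" for z
      using mv C(4) that by blast
    show "moved x y a b c c' z \<or> kept x y c c' z" for z using st mv by blast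
  qed
qed

lemma movedD:
  assumes "moved x y a b c c' z"
  shows "i \<in> ms x y c z \<Longrightarrow> transpose a b i \<in> ms x y c' z"
    and "{z, u} \<in> E - {{x, y}} \<Longrightarrow> c' {z, u} = transpose a b (c {z, u})"
    and "{u, z} \<in> E - {{x, y}} \<Longrightarrow> c' {u, z} = transpose a b (c {u, z})"
  using assms unfolding moved_def by (auto simp: insert_commute)

lemma keptD:
  assumes "kept x y c c' z"
  shows "ms x y c' z = ms x y c z"
    and "{z, u} \<in> E - {{x, y}} \<Longrightarrow> c' {z, u} = c {z, u}"
    and "{u, z} \<in> E - {{x, y}} \<Longrightarrow> c' {u, z} = c {u, z}"
  using assms unfolding kept_def by (auto simp: insert_commute)

lemma shift:
  assumes pc: "pc x y c" and e: "{x, s} \<in> E - {{x, y}}" and a: "c {x, s} \<in> ms x y c y"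
  shows "pc x s (c({x, y} := c {x, s}))"
    and "ms x s (c({x, y} := c {x, s})) w =
      (if w = y then ms x y c y - {c {x, s}} else if w = s then insert (c {x, s}) (ms x y c s) else ms x y c w)"
proof -
  have eq: "insert {x, y} (E - {{x, y}} - {{x, s}}) = E - {{x, s}}" using pc_edge[OF pc] e by auto
  have "x \<noteq> s" using e edge_neq by blast
  note sh = proper_shift[OF pc_proper[OF pc] _ e a pc_neq[OF pc] this, unfolded eq]
  show "pc x s (c({x, y} := c {x, s}))" using sh(1) e by (simp add: pc_def)
  show "ms x s (c({x, y} := c {x, s})) w =
      (if w = y then ms x y c y - {c {x, s}} else if w = s then insert (c {x, s}) (ms x y c s) else ms x y c w)"
    using sh(2) by simp
qed

text \<open>Shifting the uncoloured place to \<open>{x, z}\<close> rules out a colour missing at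
  both \<open>x\<close> and \<open>z\<close>. A colour missing at \<open>y\<close> and
  \<open>z\<close> is first exchanged at \<open>z\<close>, by a Kempe change that spares
  \<open>x\<close> and \<open>y\<close>, for one missing at \<open>x\<close>.\<close>

lemma fan_missing:
  assumes pc: "pc x y c" and e: "{x, z} \<in> E - {{x, y}}" and i: "c {x, z} \<in> ms x y c y"
    and a: "a \<in> ms x y c z" "a \<in> ms x y c x \<union> ms x y c y"
  shows False
proof -
  have zx: "z \<noteq> x" "z \<noteq> y" using e edge_neq by auto
  have *: False if pc: "pc x y c" and i: "c {x, z} \<in> ms x y c y"
    and a: "a \<in> ms x y c z" "a \<in> ms x y c x" for c a
  proof -
    note sh = shift[OF pc e i]
    show False using pc_disj[OF sh(1), of a] sh(2)[of x] sh(2)[of z] a zx pc_neq[OF pc] by auto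
  qed
  show False
  proof (cases "a \<in> ms x y c x")
    case True then show ?thesis using * assms by blast
  next
    case False
    then have ay: "a \<in> ms x y c y" using a by blast
    obtain a0 where a0: "a0 \<in> ms x y c x" using ms_nonempty[OF pc] by blast
    obtain c' where c': "pc x y c'" "kept x y c c' x" "kept x y c c' y" "moved x y a0 a c c' z"
      using move[OF pc a0 ay] zx a(1) by metis
    have "a0 \<in> ms x y c' z" using movedD(1)[OF c'(4) a(1)] by simp
    then show False using *[OF c'(1), of a0] keptD[OF c'(2)] keptD[OF c'(3)] a0 i e by auto
  qed
qed

lemma recolour:
  assumes pc: "pc x y c" and e: "{u, v} \<in> E - {{x, y}}" and a: "a \<in> ms x y c u" "a \<in> ms x y c v"
  shows "pc x y (c({u, v} := a))"
    and "ms x y (c({u, v} := a)) w =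
      (if w = u \<or> w = v then insert (c {u, v}) (ms x y c w) - {a} else ms x y c w)"
  using proper_recolour[OF pc_proper[OF pc] e a] pc_edge[OF pc] by (simp_all add: pc_def)

text \<open>The path \<open>y x s z\<close> is resolved by three recolourings: \<open>{x, y}\<close>
  takes the colour of \<open>{x, s}\<close>; that colour, now free at \<open>s\<close> and
  \<open>z\<close>, goes to \<open>{s, z}\<close>; the old colour of \<open>{s, z}\<close> becomes
  free at both ends of \<open>{x, s}\<close>.\<close>

lemma kierstead_end:
  assumes pc: "pc x y c" and xs: "{x, s} \<in> E - {{x, y}}" and sz: "{s, z} \<in> E - {{x, y}}"
    and z: "z \<noteq> x" "z \<noteq> y"
    and i: "c {x, s} \<in> ms x y c y" "c {x, s} \<in> ms x y c z" and j: "c {s, z} \<in> ms x y c x"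
  shows False
proof -
  have sx: "s \<noteq> x" "s \<noteq> y" "s \<noteq> z" using xs sz edge_neq by auto
  note sh = shift[OF pc xs i(1)]
  let ?c1 = "c({x, y} := c {x, s})"
  have sz': "{s, z} \<in> E - {{x, s}}" "{s, z} \<noteq> {x, y}" using sz z sx by (auto simp: doubleton_eq_iff)
  have "c {x, s} \<in> ms x s ?c1 s" "c {x, s} \<in> ms x s ?c1 z" using sh(2) i sx z by auto
  note rc = recolour[OF sh(1) sz'(1) this]
  have "c {s, z} \<in> ms x s (?c1({s, z} := c {x, s})) x" using rc(2)[of x] sh(2)[of x] j sx z pc_neq[OF pc] by auto
  moreover have "c {s, z} \<noteq> c {x, s}" using j i pc_disj[OF pc] by auto
  then have "c {s, z} \<in> ms x s (?c1({s, z} := c {x, s})) s" using rc(2)[of s] sz' by auto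
  ultimately show False by (rule pc_disj[OF rc(1)])
qed

text \<open>A play of \<open>colour_game\<close> at \<open>z\<close> for the edge
  \<open>{s, z}\<close>, with \<open>kierstead_end\<close> as the final position. One missing colour
  of \<open>z\<close> suffices if \<open>x\<close> misses two colours, as it does when
  \<open>d x < k\<close>.\<close>

lemma kierstead:
  assumes pc: "pc x y c" and xs: "{x, s} \<in> E - {{x, y}}" and sz: "{s, z} \<in> E - {{x, y}}"
    and z: "z \<noteq> x" "z \<noteq> y"
    and i: "c {x, s} \<in> ms x y c y" and j: "c {s, z} \<in> ms x y c x \<union> ms x y c y"
    and d1: "d1 \<in> ms x y c z" "d1 \<in> ms x y c x \<union> ms x y c y"
    and d2: "d2 \<in> ms x y c z" "d2 \<in> ms x y c x \<union> ms x y c y"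
    and two: "d1 \<noteq> d2 \<or> 2 \<le> card (ms x y c x)"
  shows False
proof -
  define A B i where "A = ms x y c x" and "B = ms x y c y" and "i = c {x, s}"
  define P where "P j d1 d2 \<longleftrightarrow> (\<exists>c. pc x y c \<and> ms x y c x = A \<and> ms x y c y = B \<and> c {x, s} = i \<and> c {s, z} = j \<and>
     d1 \<in> ms x y c z \<and> d2 \<in> ms x y c z \<and> (d1 \<noteq> d2 \<or> 2 \<le> card A))" for j d1 d2
  show False
  proof (rule colour_game[of P A B i "c {s, z}" d1 d2])
    fix j d1 d2 a b
    assume "P j d1 d2" and ab: "a \<in> A" "b \<in> B" and h: "a = d1 \<or> a = d2 \<or> b = d1 \<or> b = d2"
    then obtain c where c: "pc x y c" "ms x y c x = A" "ms x y c y = B" "c {x, s} = i" "c {s, z} = j"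
      "d1 \<in> ms x y c z" "d2 \<in> ms x y c z" "d1 \<noteq> d2 \<or> 2 \<le> card A" unfolding P_def by blast
    have "a \<in> ms x y c z \<or> b \<in> ms x y c z" using h c by auto
    then obtain c' where c': "pc x y c'" "kept x y c c' x" "kept x y c c' y" "moved x y a b c c' z"
      using move[OF c(1), of a b] ab c(2,3) z by metis
    show "P (transpose a b j) (transpose a b d1) (transpose a b d2)"
      unfolding P_def using c' c keptD[OF c'(2)] keptD[OF c'(3)] movedD[OF c'(4)] xs sz
      by (intro exI[of _ c']) (auto simp: inj_eq[OF inj_transpose])
  next
    fix j d assume j: "j \<in> A" and "P j i d"
    then obtain c where c: "pc x y c" "ms x y c x = A" "ms x y c y = B" "c {x, s} = i" "c {s, z} = j"
      "i \<in> ms x y c z" unfolding P_def by blast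
    have "c {x, s} \<in> ms x y c y" using i c by (simp add: B_def i_def)
    then show False using kierstead_end[OF c(1) xs sz z] c j by simp
  next
    show "P j d1 d2 \<Longrightarrow> P j d2 d1" for j d1 d2 unfolding P_def by metis
    show "i \<in> B" using i by (simp add: i_def B_def)
    show "A \<inter> B = {}" using pc_disj[OF pc] by (auto simp: A_def B_def)
    show "d1 \<noteq> d2 \<or> (\<exists>a\<in>A. \<exists>a'\<in>A. a \<noteq> a')" if "P j d1 d2" for j d1 d2
    proof -
      have "d1 \<noteq> d2 \<or> 2 \<le> card A" using that unfolding P_def by blast
      moreover have "\<exists>a\<in>A. \<exists>a'\<in>A. a \<noteq> a'" if "2 \<le> card A"
        using that card_le_Suc0_iff_eq[of A] by (fastforce simp: A_def)
      ultimately show ?thesis by blast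
    qed
    show "A \<noteq> {}" using ms_nonempty[OF pc] by (simp add: A_def)
    show "P (c {s, z}) d1 d2" unfolding P_def using assms by (auto simp: A_def B_def i_def)
    show "c {s, z} \<noteq> d1" "c {s, z} \<noteq> d2" using d1 d2 sz by (auto simp: mis_def)
  qed (use j d1 d2 in \<open>auto simp: A_def B_def\<close>)
qed


section \<open>Vizing fans and Vizing's adjacency lemma\<close>

fun fan :: "'a set set \<Rightarrow> ('a set \<Rightarrow> nat) \<Rightarrow> 'a \<Rightarrow> 'a \<Rightarrow> 'a list \<Rightarrow> bool" where
  "fan F c x y [] \<longleftrightarrow> True"
| "fan F c x y (z # zs) \<longleftrightarrow> {x, z} \<in> F \<and> c {x, z} \<in> mis k F c y \<and> fan F c x z zs"

lemma fan_append:
  "fan F c x y (as @ bs) \<longleftrightarrow> fan F c x y as \<and> fan F c x (last (y # as)) bs"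
  by (induction as arbitrary: y) auto

lemma fan_nbrs: "fan F c x y zs \<Longrightarrow> z \<in> set zs \<Longrightarrow> {x, z} \<in> F"
  by (induction zs arbitrary: y) auto

lemma fan_transfer:
  "fan F c x y zs \<Longrightarrow> (\<And>u. u \<in> set zs \<Longrightarrow> {x, u} \<in> F' \<and> c' {x, u} = c {x, u}) \<Longrightarrow>
    (\<And>u. u \<in> set (y # butlast zs) \<Longrightarrow> mis k F c u \<subseteq> mis k F' c' u) \<Longrightarrow> fan F' c' x y zs"
proof (induction zs arbitrary: y)
  case Nil then show ?case by simp
next
  case (Cons z zs)
  have "fan F' c' x z zs"
    by (cases zs, simp, rule Cons.IH) (use Cons.prems in auto)
  then show ?case using Cons.prems by auto
qed

text \<open>Rotating the fan shift by shift leaves the spoke to its last vertex uncoloured, and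
  \<open>a\<close> would colour it. Each shift takes a missing colour only from the vertex that
  drops out, so the rest remains a fan.\<close>

lemma fan_last:
  "pc x y c \<Longrightarrow> fan (E - {{x, y}}) c x y zs \<Longrightarrow> distinct (y # zs) \<Longrightarrow> a \<in> ms x y c x \<Longrightarrow>
    a \<in> ms x y c (last (y # zs)) \<Longrightarrow> False"
proof (induction zs arbitrary: y c)
  case Nil
  then show ?case using pc_disj by auto
next
  case (Cons z zs)
  have e: "{x, z} \<in> E - {{x, y}}" and i: "c {x, z} \<in> ms x y c y" using Cons.prems(2) by auto
  note sh = shift[OF Cons.prems(1) e i]
  let ?c = "c({x, y} := c {x, z})"
  have sub: "ms x y c u \<subseteq> ms x z ?c u" if "u \<noteq> y" for u using sh(2)[of u] that by auto
  have zs: "y \<notin> set (z # zs)" "z \<notin> set zs" using Cons.prems(3) by auto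
  have "fan (E - {{x, z}}) ?c x z zs"
  proof (rule fan_transfer)
    show f: "fan (E - {{x, y}}) c x z zs" using Cons.prems(2) by simp
    show "{x, u} \<in> E - {{x, z}} \<and> ?c {x, u} = c {x, u}" if "u \<in> set zs" for u
      using fan_nbrs[OF f that] that zs by (auto simp: doubleton_eq_iff)
    show "ms x y c u \<subseteq> ms x z ?c u" if "u \<in> set (z # butlast zs)" for u
      by (rule sub) (use that zs in \<open>auto dest: in_set_butlastD\<close>)
  qed
  moreover have "a \<in> ms x z ?c x" using sub[of x] Cons.prems(4) pc_neq[OF Cons.prems(1)] by auto
  moreover have "last (z # zs) \<noteq> y" using zs by (metis last_in_set list.distinct(1))
  then have "a \<in> ms x z ?c (last (z # zs))" using sub[of "last (z # zs)"] Cons.prems(5) by auto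
  moreover have "distinct (z # zs)" using Cons.prems(3) by simp
  ultimately show ?case using Cons.IH[OF sh(1)] by blast
qed

text \<open>Otherwise let \<open>u\<close> be the first fan vertex outside \<open>C\<close> that
  misses \<open>g\<close>. Exchanging \<open>a\<close> and \<open>g\<close> outside \<open>C\<close>
  keeps the fan up to \<open>u\<close> intact and makes \<open>a\<close> missing at \<open>u\<close>
  as well as at \<open>x\<close>, against \<open>fan_last\<close>.\<close>

lemma fan_linked:
  assumes pc: "pc x y c" and f: "fan (E - {{x, y}}) c x y zs" and ds: "distinct (y # zs)"
    and a: "a \<in> ms x y c x" and g: "g \<in> ms x y c (last (y # zs))"
    and cl: "kclosed (E - {{x, y}}) c a g C" and x: "x \<in> C"
  shows "last (y # zs) \<in> C"
proof (rule ccontr)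
  let ?P = "\<lambda>u. u \<notin> C \<and> g \<in> ms x y c u"
  assume "last (y # zs) \<notin> C"
  then have "\<exists>u\<in>set (y # zs). ?P u" using g by (intro bexI[of _ "last (y # zs)"]) auto
  then obtain as u bs where sp: "y # zs = as @ u # bs" "?P u" "\<forall>v\<in>set as. \<not> ?P v"
    using split_list_first_prop[of "y # zs" ?P] by blast
  define zs' where "zs' = tl (as @ [u])"
  have yz: "y # zs' = as @ [u]" using sp(1) unfolding zs'_def by (cases as) auto
  have z: "zs = zs' @ bs" using sp(1) yz by (metis append.assoc append_Cons append_Nil list.inject)
  have f': "fan (E - {{x, y}}) c x y zs'" using f unfolding z fan_append by simp
  have ds': "distinct (y # zs')" using ds unfolding z by auto
  have l: "last (y # zs') = u" unfolding yz by simp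
  have bl: "set (y # butlast zs') \<subseteq> set as \<union> {y}"
    using yz by (cases as) (auto simp: zs'_def)
  define c' where "c' = kswap (- C) a g c"
  note cl' = kclosed_Compl[OF cl]
  note sw = kswap_proper[OF pc_proper[OF pc] cl' mis_lt[OF a] mis_lt[OF g], folded c'_def]
  have pc': "pc x y c'" using sw(1) pc_edge[OF pc] by (simp add: pc_def)
  have nm: "a \<notin> ms x y c v" if "v \<in> set (y # zs')" for v
  proof
    assume av: "a \<in> ms x y c v"
    obtain ps qs where pq: "y # zs' = ps @ v # qs" using \<open>v \<in> set (y # zs')\<close> split_list by metis
    define ws where "ws = tl (ps @ [v])"
    have yw: "y # ws = ps @ [v]" using pq unfolding ws_def by (cases ps) auto
    have zw: "zs' = ws @ qs" using pq yw by (metis append.assoc append_Cons append_Nil list.inject)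
    have "last (y # ws) = v" unfolding yw by simp
    then show False using fan_last[OF pc, of ws a] f' ds' av a unfolding zw fan_append by auto
  qed
  have keep: "mis k (E - {{x, y}}) c v \<subseteq> mis k (E - {{x, y}}) c' v" if "v \<in> set (y # butlast zs')" "v \<noteq> u" for v
  proof (cases "v \<in> C")
    case True then show ?thesis using sw(2)[of v] by simp
  next
    case False
    have va: "v \<in> set as" using that bl yz by (cases as) auto
    then have "g \<notin> ms x y c v" using sp(3) False by blast
    moreover have "a \<notin> ms x y c v" using nm that va yz by auto
    ultimately have "transpose a g i = i" if "i \<in> ms x y c v" for i
      using that by (auto simp: transpose_def)
    then have "transpose a g ` ms x y c v = ms x y c v" by (simp cong: image_cong)
    then show ?thesis using sw(2)[of v] False by simp
  qed
  have "fan (E - {{x, y}}) c' x y zs'"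
  proof (cases "zs' = []")
    case False
    show ?thesis
    proof (rule fan_transfer[OF f'])
      show "{x, v} \<in> E - {{x, y}} \<and> c' {x, v} = c {x, v}" if "v \<in> set zs'" for v
        using fan_nbrs[OF f' that] kswap_edge[OF cl', of "{x, v}" x] x by (simp add: c'_def)
      show "mis k (E - {{x, y}}) c v \<subseteq> mis k (E - {{x, y}}) c' v" if "v \<in> set (y # butlast zs')" for v
      proof (rule keep[OF that])
        have "butlast (y # zs') = as" unfolding yz by simp
        then have "v \<in> set as" using that False by auto
        moreover have "u \<notin> set as" using ds' unfolding yz by auto
        ultimately show "v \<noteq> u" by blast
      qed
    qed
  qed simp
  moreover have "a \<in> ms x y c' x" using sw(2)[of x] x a by simp
  moreover have "a \<in> ms x y c' (last (y # zs'))"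
    unfolding l using sw(2)[of u] sp(2) by (simp add: in_transpose_image_iff)
  ultimately show False using fan_last[OF pc'] ds' by blast
qed

text \<open>Fan vertices miss pairwise disjoint sets of colours, and each of these colours leads
  along a spoke to a fan vertex other than \<open>y\<close>. So the sets have total size at most the
  number of those vertices. As \<open>y\<close> misses \<open>k + 1 - d y\<close> colours and each
  fan vertex of degree below \<open>k\<close> at least one, at least \<open>k + 1 - d y\<close> fan
  vertices have degree \<open>k\<close>.\<close>

theorem vizing_adjacency:
  assumes xy: "{x, y} \<in> E"
  shows "k + 1 \<le> card {z \<in> N x. z \<noteq> y \<and> d z = k} + d y"
proof -
  obtain c where pc: "pc x y c" using pc_ex[OF xy] by blast
  let ?F = "E - {{x, y}}"
  \<comment> \<open>The ends of all fans from \<open>y\<close>, not the vertices of one maximal fan: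
    this makes \<open>Z\<close> closed under following any missing colour along a spoke.\<close>
  define Z where "Z = {z. \<exists>zs. fan ?F c x y zs \<and> distinct (y # zs) \<and> last (y # zs) = z}"
  obtain a where a: "a \<in> ms x y c x" using ms_nonempty[OF pc] by blast
  have yZ: "y \<in> Z" unfolding Z_def by (auto intro!: exI[of _ "[]"])
  have ZN: "z \<in> N x" "{x, z} \<in> ?F" if z: "z \<in> Z" "z \<noteq> y" for z
  proof -
    obtain zs where zs: "fan ?F c x y zs" "last (y # zs) = z" using z unfolding Z_def by blast
    then have "z \<in> set zs" using z(2) by (auto split: if_splits)
    then show "{x, z} \<in> ?F" using fan_nbrs[OF zs(1)] by blast
    then show "z \<in> N x" by (simp add: nb_def)
  qed
  have fZ: "finite Z" by (rule finite_subset[of _ "insert y (N x)"]) (use ZN in auto)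
  have zx: "z \<noteq> x" if "z \<in> Z" for z using ZN[OF that] nb_irrefl[of x] pc_neq[OF pc] by (cases "z = y") auto
  have next_Z: "z' \<in> Z" if z: "z \<in> Z" and g: "c {x, z'} \<in> ms x y c z" and e: "{x, z'} \<in> ?F" for z z'
  proof -
    obtain zs where zs: "fan ?F c x y zs" "distinct (y # zs)" "last (y # zs) = z" using z unfolding Z_def by blast
    have "z' \<noteq> y" using e by auto
    show ?thesis
    proof (cases "z' \<in> set zs")
      case True
      then obtain ps qs where sp: "zs = ps @ z' # qs" by (meson split_list)
      have "fan ?F c x y (ps @ [z'])" "distinct (y # (ps @ [z']))" "last (y # (ps @ [z'])) = z'"
        using zs(1,2) unfolding sp by (simp_all add: fan_append)
      then show ?thesis unfolding Z_def by blast
    next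
      case False
      have "fan ?F c x y (zs @ [z'])" "distinct (y # (zs @ [z']))" "last (y # (zs @ [z'])) = z'"
        using zs False e g \<open>z' \<noteq> y\<close> by (simp_all add: fan_append)
      then show ?thesis unfolding Z_def by blast
    qed
  qed
  \<comment> \<open>By \<open>fan_linked\<close> both vertices would lie on the same chain from
    \<open>x\<close>, which has only one end besides \<open>x\<close>.\<close>
  have disj: "ms x y c z \<inter> ms x y c z' = {}" if z: "z \<in> Z" "z' \<in> Z" "z \<noteq> z'" for z z'
  proof (rule ccontr)
    assume "ms x y c z \<inter> ms x y c z' \<noteq> {}"
    then obtain g where g: "g \<in> ms x y c z" "g \<in> ms x y c z'" by blast
    obtain C where C: "kclosed ?F c a g C" "x \<in> C"
      "\<And>u v. u \<in> C \<Longrightarrow> v \<in> C \<Longrightarrow> u \<noteq> x \<Longrightarrow> v \<noteq> x \<Longrightarrow> a \<in> ms x y c u \<or> g \<in> ms x y c u \<Longrightarrow>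
         a \<in> ms x y c v \<or> g \<in> ms x y c v \<Longrightarrow> u = v"
      by (rule kempe_chain[OF pc_proper[OF pc] _ a, where b = g]) (use card2 in auto)
    have "u \<in> C" if u: "u \<in> Z" "g \<in> ms x y c u" for u
    proof -
      obtain zs where zs: "fan ?F c x y zs" "distinct (y # zs)" "last (y # zs) = u" using u(1) unfolding Z_def by blast
      show ?thesis using fan_linked[OF pc zs(1,2) a _ C(1,2)] zs(3) u(2) by simp
    qed
    then have "z = z'" using C(3) z g zx by blast
    then show False using z by simp
  qed
  define g where "g i = (THE u. {x, u} \<in> ?F \<and> c {x, u} = i)" for i
  have ex: "\<exists>u. {x, u} \<in> ?F \<and> c {x, u} = i" if z: "z \<in> Z" "i \<in> ms x y c z" for z i
  proof (rule ccontr)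
    assume n: "\<nexists>u. {x, u} \<in> ?F \<and> c {x, u} = i"
    have "i \<in> ms x y c x"
      unfolding mis_def
    proof (intro CollectI conjI ballI impI)
      show "i < k" using z(2) by (rule mis_lt)
      fix e assume e: "e \<in> ?F" "x \<in> e"
      then have "card e = 2" using card2 by auto
      then obtain p q where "e = {p, q}" by (auto simp: card_2_iff)
      then have "\<exists>u. e = {x, u}" using e(2) by auto
      then show "c e \<noteq> i" using n e(1) by blast
    qed
    moreover obtain zs where zs: "fan ?F c x y zs" "distinct (y # zs)" "last (y # zs) = z" using z(1) unfolding Z_def by blast
    ultimately show False using fan_last[OF pc zs(1,2)] zs(3) z(2) by simp
  qed
  have gz: "{x, g i} \<in> ?F \<and> c {x, g i} = i" if z: "z \<in> Z" "i \<in> ms x y c z" for z i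
    unfolding g_def
  proof (rule theI')
    show "\<exists>!u. {x, u} \<in> ?F \<and> c {x, u} = i"
    proof (rule ex_ex1I[OF ex[OF z]])
      fix u v assume "{x, u} \<in> ?F \<and> c {x, u} = i" "{x, v} \<in> ?F \<and> c {x, v} = i"
      then show "u = v" using proper_nbr_inj[OF pc_proper[OF pc], of x u v] by simp
    qed
  qed
  define U where "U = (\<Union>z\<in>Z. ms x y c z)"
  have gU: "{x, g i} \<in> ?F" "c {x, g i} = i" "g i \<in> Z - {y}" if iU: "i \<in> U" for i
  proof -
    obtain z where z: "z \<in> Z" "i \<in> ms x y c z" using iU unfolding U_def by blast
    show e: "{x, g i} \<in> ?F" and c: "c {x, g i} = i" by (rule conjunct1[OF gz[OF z]], rule conjunct2[OF gz[OF z]])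
    have "g i \<in> Z" by (rule next_Z[OF z(1) _ e]) (simp only: c z(2))
    moreover have "g i \<noteq> y" using e by auto
    ultimately show "g i \<in> Z - {y}" by simp
  qed
  have "card U \<le> card (Z - {y})"
  proof (rule card_inj_on_le[of g])
    show "inj_on g U" by (rule inj_onI) (use gU(2) in metis)
    show "g ` U \<subseteq> Z - {y}" using gU(3) by blast
    show "finite (Z - {y})" using fZ by simp
  qed
  moreover have "card U = (\<Sum>z\<in>Z. card (ms x y c z))"
    unfolding U_def
  proof (rule card_UN_disjoint[OF fZ])
    show "\<forall>z\<in>Z. \<forall>z'\<in>Z. z \<noteq> z' \<longrightarrow> ms x y c z \<inter> ms x y c z' = {}" using disj by blast
  qed simp
  moreover have "(\<Sum>z\<in>Z. card (ms x y c z)) = card (ms x y c y) + (\<Sum>z\<in>Z - {y}. card (ms x y c z))"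
    using fZ yZ by (simp add: sum.remove)
  moreover have "card {z\<in>Z - {y}. d z < k} \<le> (\<Sum>z\<in>Z - {y}. card (ms x y c z))"
  proof -
    have "card {z\<in>Z - {y}. d z < k} = (\<Sum>z\<in>Z - {y}. if d z < k then 1 else 0)"
      using fZ by (simp add: sum.If_cases Int_def)
    also have "\<dots> \<le> (\<Sum>z\<in>Z - {y}. card (ms x y c z))"
    proof (rule sum_mono)
      fix z assume "z \<in> Z - {y}"
      then show "(if d z < k then 1 else 0) \<le> card (ms x y c z)"
        using card_ms[OF pc, of z] zx[of z] by auto
    qed
    finally show ?thesis .
  qed
  moreover have "card (Z - {y}) = card {z\<in>Z - {y}. d z < k} + card {z\<in>Z - {y}. d z = k}"
  proof -
    have "Z - {y} = {z\<in>Z - {y}. d z < k} \<union> {z\<in>Z - {y}. d z = k}"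
      using deg_le by (auto simp: le_less)
    also have "card \<dots> = card {z\<in>Z - {y}. d z < k} + card {z\<in>Z - {y}. d z = k}"
      by (rule card_Un_disjoint) (use fZ in auto)
    finally show ?thesis .
  qed
  moreover have "card {z\<in>Z - {y}. d z = k} \<le> card {z \<in> N x. z \<noteq> y \<and> d z = k}"
    by (rule card_mono) (use ZN in auto)
  ultimately show ?thesis using card_ms[OF pc, of y] by simp
qed

end

section \<open>Degrees around edges whose ends miss almost all colours\<close>

context critical
begin

lemma edgeN: "z \<in> N x \<longleftrightarrow> {x, z} \<in> E"
  by (simp add: nb_def)

lemma not_nb_self [simp]: "x \<notin> N x"
  by (rule nb_irrefl)

lemma two_elements:
  assumes "2 \<le> card S"
  obtains a b where "a \<in> S" "b \<in> S" "a \<noteq> b"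
proof -
  have "finite S" using assms card.infinite by fastforce
  then have "\<not> (\<forall>a\<in>S. \<forall>b\<in>S. a = b)" using assms card_le_Suc0_iff_eq[of S] by auto
  then show ?thesis using that by blast
qed

lemma ms_Un_subset: "ms x y c u \<union> ms x y c v \<subseteq> {..<k}"
  by (auto simp: mis_def)

text \<open>The ends miss disjoint sets of colours, so \<open>d x + d y - k - 2\<close> colours are
  missing at neither. Degree sums \<open>k + 2\<close>, \<open>k + 3\<close> and
  \<open>k + 4\<close> leave no, one or two such exceptional colours; on all others the fan and path
  lemmas act.\<close>

lemma card_not_ms:
  assumes pc: "pc x y c"
  shows "card ({..<k} - (ms x y c x \<union> ms x y c y)) + k + 2 = d x + d y"
proof -
  have "card ({..<k} - (ms x y c x \<union> ms x y c y)) = k - card (ms x y c x \<union> ms x y c y)"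
    by (subst card_Diff_subset) (use ms_Un_subset[of x y c x y] in auto)
  moreover have "card (ms x y c x \<union> ms x y c y) \<le> k" using card_mono[OF _ ms_Un_subset[of x y c x y]] by simp
  ultimately show ?thesis using card_ms_Un[OF pc] by simp
qed

lemma one_common_colour:
  assumes pc: "pc x y c" and dd: "d x + d y = k + 3"
  obtains p where "p < k" "\<And>a. a < k \<Longrightarrow> a \<in> ms x y c x \<union> ms x y c y \<longleftrightarrow> a \<noteq> p"
proof -
  have "card ({..<k} - (ms x y c x \<union> ms x y c y)) = 1" using card_not_ms[OF pc] dd by simp
  then obtain p where p: "{..<k} - (ms x y c x \<union> ms x y c y) = {p}" by (auto simp: card_1_singleton_iff)
  have *: "a < k \<and> a \<notin> ms x y c x \<union> ms x y c y \<longleftrightarrow> a = p" for a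
    using p unfolding set_eq_iff by auto
  show ?thesis
    by (rule that[of p]) (use * in blast)+
qed

lemma colour_lt: "pc x y c \<Longrightarrow> e \<in> E - {{x, y}} \<Longrightarrow> c e < k"
  using proper_lt pc_proper by blast

lemma colour_not_ms: "{x, z} \<in> E - {{x, y}} \<Longrightarrow> c {x, z} \<notin> ms x y c x"
   "{u, z} \<in> E - {{x, y}} \<Longrightarrow> c {u, z} \<notin> ms x y c u" "{u, z} \<in> E - {{x, y}} \<Longrightarrow> c {u, z} \<notin> ms x y c z"
  by (auto simp: mis_def)

lemma colour_neq:
  assumes pc: "pc x y c"
  shows "{u, v} \<in> E - {{x, y}} \<Longrightarrow> {u, w} \<in> E - {{x, y}} \<Longrightarrow> v \<noteq> w \<Longrightarrow> c {u, v} \<noteq> c {u, w}"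
    and "{v, u} \<in> E - {{x, y}} \<Longrightarrow> {w, u} \<in> E - {{x, y}} \<Longrightarrow> v \<noteq> w \<Longrightarrow> c {v, u} \<noteq> c {w, u}"
    and "{v, u} \<in> E - {{x, y}} \<Longrightarrow> {u, w} \<in> E - {{x, y}} \<Longrightarrow> v \<noteq> w \<Longrightarrow> c {v, u} \<noteq> c {u, w}"
  using proper_nbr_inj[OF pc_proper[OF pc], of u v w] by (metis insert_commute)+

text \<open>Without exceptional colours every other edge at \<open>u\<close> has a colour missing at
  \<open>v\<close>, so \<open>fan_missing\<close> forbids a missing colour at \<open>w\<close>. As
  \<open>d u < k\<close>, two colours are missing at \<open>u\<close>, and \<open>kierstead\<close>
  along \<open>v u w r\<close> does the same for \<open>r\<close>.\<close>

lemma tight_edge_nbrs: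
  assumes uv: "{u, v} \<in> E" and dd: "d u + d v = k + 2" and du: "d u < k"
    and w: "w \<in> N u" "w \<noteq> v"
  shows "d w = k" and "r \<in> N w \<Longrightarrow> r \<noteq> u \<Longrightarrow> r \<noteq> v \<Longrightarrow> d r = k"
proof -
  obtain c where pc: "pc u v c" using pc_ex[OF uv] by blast
  have "{..<k} - (ms u v c u \<union> ms u v c v) = {}" using card_not_ms[OF pc] dd by (simp add: card_eq_0_iff)
  then have all: "a \<in> ms u v c u \<union> ms u v c v" if "a < k" for a using that by auto
  have uw: "{u, w} \<in> E - {{u, v}}" using w edge_neq[OF uv] by (auto simp: edgeN insert_commute doubleton_eq_iff)
  have wu: "w \<noteq> u" using w by auto
  have cw: "c {u, w} \<in> ms u v c v" using all[OF colour_lt[OF pc uw]] colour_not_ms(1)[OF uw] by blast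
  have "a \<notin> ms u v c w" for a using fan_missing[OF pc uw cw, of a] all[of a] mis_lt[of a k "E - {{u, v}}" c w] by blast
  then have "ms u v c w = {}" by blast
  then show "d w = k" using card_ms[OF pc, of w] wu w by simp
  assume r: "r \<in> N w" "r \<noteq> u" "r \<noteq> v"
  have wr: "{w, r} \<in> E - {{u, v}}" using r w by (auto simp: edgeN insert_commute doubleton_eq_iff)
  have "2 \<le> card (ms u v c u)" using card_ms[OF pc, of u] du by simp
  then have "a \<notin> ms u v c r" for a
    using kierstead[OF pc uw wr r(2,3) cw all[OF colour_lt[OF pc wr]], of a a] all[of a] mis_lt[of a k "E - {{u, v}}" c r] by blast
  then have "ms u v c r = {}" by blast
  then show "d r = k" using card_ms[OF pc, of r] r by simp
qed

text \<open>As \<open>z\<close> misses two colours, \<open>fan_missing\<close> forces the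
  exceptional colour \<open>p\<close> onto \<open>{x, z}\<close>. Then the other edges of the
  triangle avoid \<open>p\<close>, and so do the colours missing at \<open>z\<close>, so the path
  \<open>y x s z\<close> contradicts \<open>kierstead\<close>.\<close>

lemma no_triangle_at_small:
  assumes xy: "{x, y} \<in> E" and dd: "d x + d y = k + 3"
    and z: "z \<in> N x" "z \<noteq> y" "d z + 2 \<le> k" and s: "s \<in> N x" "s \<in> N z" "s \<noteq> y"
  shows False
proof -
  obtain c where pc: "pc x y c" using pc_ex[OF xy] by blast
  obtain p where p: "\<And>a. a < k \<Longrightarrow> a \<in> ms x y c x \<union> ms x y c y \<longleftrightarrow> a \<noteq> p"
    using one_common_colour[OF pc dd] by metis
  have ne: "z \<noteq> x" "s \<noteq> x" "s \<noteq> z" using z s by auto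
  have xz: "{x, z} \<in> E - {{x, y}}" and xs: "{x, s} \<in> E - {{x, y}}" and sz: "{s, z} \<in> E - {{x, y}}"
    using z s ne by (auto simp: edgeN insert_commute doubleton_eq_iff)
  have "2 \<le> card (ms x y c z)" using card_ms[OF pc, of z] z ne by simp
  then obtain d1 d2 where d12: "d1 \<in> ms x y c z" "d2 \<in> ms x y c z" "d1 \<noteq> d2" by (rule two_elements)
  have "c {x, z} = p"
  proof (rule ccontr)
    assume "c {x, z} \<noteq> p"
    then have "c {x, z} \<in> ms x y c y" using p[OF colour_lt[OF pc xz]] colour_not_ms(1)[OF xz] by blast
    then have "d1 = p" "d2 = p"
      using fan_missing[OF pc xz, of d1] fan_missing[OF pc xz, of d2] d12 p[OF mis_lt[OF d12(1)]] p[OF mis_lt[OF d12(2)]] by blast+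
    then show False using d12 by simp
  qed
  then have "c {x, s} \<noteq> p" "c {s, z} \<noteq> p" "d1 \<noteq> p" "d2 \<noteq> p"
    using colour_neq(1)[OF pc xs xz] colour_neq(2)[OF pc sz xz] ne d12 colour_not_ms(3)[OF xz, of c] by auto
  then show False
    using kierstead[OF pc xs sz ne(1) z(2), of d1 d2] p[OF colour_lt[OF pc xs]] p[OF colour_lt[OF pc sz]]
      colour_not_ms(1)[OF xs, of c] p[OF mis_lt[OF d12(1)]] p[OF mis_lt[OF d12(2)]] d12 by blast
qed

text \<open>After a shift to \<open>{x, s2}\<close> and a recolouring of \<open>{s2, z}\<close>, the
  common colour of \<open>{x, s1}\<close> and \<open>{s2, z}\<close> is missing at \<open>s2\<close>
  and \<open>z\<close>. So \<open>kierstead_end\<close> applies to the path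
  \<open>s2 x s1 z\<close>, which starts with the new uncoloured edge.\<close>

lemma two_triangles_end:
  assumes pc: "pc x y c" and e: "{x, s1} \<in> E - {{x, y}}" "{x, s2} \<in> E - {{x, y}}"
    "{s1, z} \<in> E - {{x, y}}" "{s2, z} \<in> E - {{x, y}}" and ne: "z \<noteq> x" "z \<noteq> y" "s1 \<noteq> s2"
    and r: "c {x, s1} = c {s2, z}" and i: "c {x, s2} \<in> ms x y c y" "c {x, s2} \<in> ms x y c z"
    and j: "c {s1, z} \<in> ms x y c x"
  shows False
proof -
  have sx: "s1 \<noteq> x" "s1 \<noteq> y" "s1 \<noteq> z" "s2 \<noteq> x" "s2 \<noteq> y" "s2 \<noteq> z" using e edge_neq by auto
  note sh = shift[OF pc e(2) i(1)]
  let ?c1 = "c({x, y} := c {x, s2})"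
  have e2: "{s2, z} \<in> E - {{x, s2}}" "{s2, z} \<noteq> {x, y}" using e ne sx by (auto simp: doubleton_eq_iff)
  have "c {x, s2} \<in> ms x s2 ?c1 s2" "c {x, s2} \<in> ms x s2 ?c1 z" using sh(2) i sx ne by auto
  note rc = recolour[OF sh(1) e2(1) this]
  let ?c2 = "?c1({s2, z} := c {x, s2})"
  have c1: "?c1 {s2, z} = c {s2, z}" using e2 by simp
  have c2: "?c2 {x, s1} = c {x, s1}" "?c2 {s1, z} = c {s1, z}"
    using sx ne by (auto simp: doubleton_eq_iff)
  have rne: "c {s2, z} \<noteq> c {x, s2}" using colour_neq(3)[OF pc e(2) e(4)] ne by auto
  have e1: "{x, s1} \<in> E - {{x, s2}}" "{s1, z} \<in> E - {{x, s2}}" using e ne sx by (auto simp: doubleton_eq_iff)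
  have "c {s2, z} \<in> ms x s2 ?c2 s2" using rc(2)[of s2] c1 rne by simp
  then have r2: "?c2 {x, s1} \<in> ms x s2 ?c2 s2" using c2 r by simp
  have z2: "?c2 {x, s1} \<in> ms x s2 ?c2 z" using rc(2)[of z] c1 rne c2 r by simp
  have j2: "?c2 {s1, z} \<in> ms x s2 ?c2 x"
    using rc(2)[of x] sh(2)[of x] j c2 sx ne pc_neq[OF pc] by auto
  show False
    by (rule kierstead_end[OF rc(1) e1(1) e1(2) _ _ r2 z2 j2]) (use ne sx in auto)
qed

text \<open>One exceptional colour \<open>p\<close> lies on \<open>{x, z}\<close>. A triangle whose
  other edges also avoid the second one, \<open>r\<close>, falls to \<open>kierstead\<close>. Two
  triangles escape only crosswise, with \<open>r\<close> on \<open>{x, t1}\<close> and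
  \<open>{t2, z}\<close>, and then a colour game ends in \<open>two_triangles_end\<close>.\<close>

lemma two_triangles_at_small:
  assumes xy: "{x, y} \<in> E" and dd: "d x + d y = k + 4"
    and z: "z \<in> N x" "z \<noteq> y" "d z + 3 \<le> k" and s1: "s1 \<in> N x" "s1 \<in> N z" "s1 \<noteq> y"
    and s2: "s2 \<in> N x" "s2 \<in> N z" "s2 \<noteq> y" and s12: "s1 \<noteq> s2"
  shows False
proof -
  obtain c where pc: "pc x y c" using pc_ex[OF xy] by blast
  let ?U = "ms x y c x \<union> ms x y c y"
  have ne: "z \<noteq> x" "s1 \<noteq> x" "s1 \<noteq> z" "s2 \<noteq> x" "s2 \<noteq> z" using z s1 s2 by auto
  have xz: "{x, z} \<in> E - {{x, y}}" and xs1: "{x, s1} \<in> E - {{x, y}}" and s1z: "{s1, z} \<in> E - {{x, y}}"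
    and xs2: "{x, s2} \<in> E - {{x, y}}" and s2z: "{s2, z} \<in> E - {{x, y}}"
    using z s1 s2 ne by (auto simp: edgeN insert_commute doubleton_eq_iff)
  have c3: "3 \<le> card (ms x y c z)" using card_ms[OF pc, of z] z ne by simp
  let ?W = "{..<k} - ?U"
  have cW: "card ?W = 2" using card_not_ms[OF pc] dd by simp
  have ms_sub: "ms x y c z \<subseteq> (ms x y c z \<inter> ?U) \<union> ?W" by (auto simp: mis_def)
  have pW: "c {x, z} \<in> ?W"
  proof (rule ccontr)
    assume "c {x, z} \<notin> ?W"
    then have "c {x, z} \<in> ms x y c y" using colour_lt[OF pc xz] colour_not_ms(1)[OF xz] by blast
    then have "ms x y c z \<inter> ?U = {}" using fan_missing[OF pc xz] by blast
    then have "ms x y c z \<subseteq> ?W" using ms_sub by blast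
    then have "card (ms x y c z) \<le> 2" using card_mono[of ?W "ms x y c z"] cW by simp
    then show False using c3 by simp
  qed
  define p where "p = c {x, z}"
  obtain r where W: "?W = {p, r}" "p \<noteq> r"
  proof -
    have "card (?W - {p}) = 1" using cW pW by (simp add: p_def)
    then obtain r where "?W - {p} = {r}" by (auto simp: card_1_singleton_iff)
    then have "?W = {p, r}" "p \<noteq> r" using pW by (auto simp: p_def)
    then show ?thesis by (rule that)
  qed
  have U: "a \<in> ?U \<longleftrightarrow> a \<noteq> p \<and> a \<noteq> r" if "a < k" for a
    using W(1) that unfolding set_eq_iff by auto
  have "ms x y c z \<subseteq> (ms x y c z \<inter> ?U) \<union> {r}" using ms_sub W colour_not_ms(3)[OF xz, of c] by (auto simp: p_def)
  then have "card (ms x y c z) \<le> card (ms x y c z \<inter> ?U) + 1"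
    using card_mono[of "(ms x y c z \<inter> ?U) \<union> {r}" "ms x y c z"] card_Un_le[of "ms x y c z \<inter> ?U" "{r}"] by simp
  then have "2 \<le> card (ms x y c z \<inter> ?U)" using c3 by simp
  then obtain d1 d2 where d12: "d1 \<in> ms x y c z \<inter> ?U" "d2 \<in> ms x y c z \<inter> ?U" "d1 \<noteq> d2" by (rule two_elements)
  have np: "c {x, s1} \<noteq> p" "c {s1, z} \<noteq> p" "c {x, s2} \<noteq> p" "c {s2, z} \<noteq> p"
    using colour_neq(1)[OF pc xs1 xz] colour_neq(2)[OF pc s1z xz] colour_neq(1)[OF pc xs2 xz] colour_neq(2)[OF pc s2z xz] ne
    by (auto simp: p_def)
  have rx: "\<not> (c {x, s1} = r \<and> c {x, s2} = r)" "\<not> (c {s1, z} = r \<and> c {s2, z} = r)"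
    using colour_neq(1)[OF pc xs1 xs2 s12] colour_neq(2)[OF pc s1z s2z s12] by auto
  have easy: "c {s, z} = r" if s: "{x, s} \<in> E - {{x, y}}" "{s, z} \<in> E - {{x, y}}" "c {x, s} \<noteq> p" "c {s, z} \<noteq> p" "c {x, s} \<noteq> r" for s
  proof (rule ccontr)
    assume "c {s, z} \<noteq> r"
    then have "c {s, z} \<in> ?U" using U colour_lt[OF pc s(2)] s by blast
    moreover have "c {x, s} \<in> ms x y c y" using U[OF colour_lt[OF pc s(1)]] s colour_not_ms(1)[OF s(1)] by blast
    ultimately show False using kierstead[OF pc s(1,2) ne(1) z(2), of d1 d2] d12 by blast
  qed
  have hard: False if t: "{x, t1} \<in> E - {{x, y}}" "{t1, z} \<in> E - {{x, y}}" "{x, t2} \<in> E - {{x, y}}" "{t2, z} \<in> E - {{x, y}}"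
      "t1 \<noteq> t2" and col: "c {x, t1} = r" "c {t2, z} = r" "c {x, t2} \<in> ms x y c y" "c {t1, z} \<in> ?U" for t1 t2
  proof -
    define A B i where "A = ms x y c x" and "B = ms x y c y" and "i = c {x, t2}"
    \<comment> \<open>Hence \<open>r\<close> takes part in no change of the game, and both edges
      coloured \<open>r\<close> keep it.\<close>
    have rU: "r \<notin> A \<union> B" using U[of r] W by (auto simp: A_def B_def)
    define P where "P j d1 d2 \<longleftrightarrow> (\<exists>c. pc x y c \<and> ms x y c x = A \<and> ms x y c y = B \<and> c {x, t1} = r \<and> c {x, t2} = i \<and>
       c {t2, z} = r \<and> c {t1, z} = j \<and> d1 \<in> ms x y c z \<and> d2 \<in> ms x y c z \<and> d1 \<noteq> d2)" for j d1 d2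
    show False
    proof (rule colour_game[of P A B i "c {t1, z}" d1 d2])
      fix j d1 d2 a b
      assume "P j d1 d2" and ab: "a \<in> A" "b \<in> B" and h: "a = d1 \<or> a = d2 \<or> b = d1 \<or> b = d2"
      then obtain c where c: "pc x y c" "ms x y c x = A" "ms x y c y = B" "c {x, t1} = r" "c {x, t2} = i" "c {t2, z} = r"
        "c {t1, z} = j" "d1 \<in> ms x y c z" "d2 \<in> ms x y c z" "d1 \<noteq> d2" unfolding P_def by blast
      have "a \<in> ms x y c z \<or> b \<in> ms x y c z" using h c by auto
      then obtain c' where c': "pc x y c'" "kept x y c c' x" "kept x y c c' y" "moved x y a b c c' z"
        using move[OF c(1), of a b] ab c(2,3) z(2) ne(1) by metis
      have "transpose a b r = r" using rU ab by (auto simp: transpose_def)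
      then show "P (transpose a b j) (transpose a b d1) (transpose a b d2)"
        unfolding P_def using c' c keptD[OF c'(2)] keptD[OF c'(3)] movedD[OF c'(4)] t
        by (intro exI[of _ c']) (auto simp: inj_eq[OF inj_transpose])
    next
      fix j d assume j: "j \<in> A" and "P j i d"
      then obtain c where c: "pc x y c" "ms x y c x = A" "ms x y c y = B" "c {x, t1} = r" "c {x, t2} = i" "c {t2, z} = r"
        "c {t1, z} = j" "i \<in> ms x y c z" unfolding P_def by blast
      show False
        by (rule two_triangles_end[OF c(1) t(1,3,2,4) ne(1) z(2) t(5)]) (use c j col in \<open>auto simp: i_def B_def\<close>)
    next
      show "P j d1 d2 \<Longrightarrow> P j d2 d1" for j d1 d2 unfolding P_def by metis
      show "A \<inter> B = {}" using pc_disj[OF pc] by (auto simp: A_def B_def)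
      show "d1 \<noteq> d2 \<or> (\<exists>a\<in>A. \<exists>a'\<in>A. a \<noteq> a')" if "P j d1 d2" for j d1 d2 using that unfolding P_def by blast
      show "A \<noteq> {}" using ms_nonempty[OF pc] by (simp add: A_def)
      show "P (c {t1, z}) d1 d2" unfolding P_def using pc col d12 by (intro exI[of _ c]) (auto simp: A_def B_def i_def)
      show "c {t1, z} \<noteq> d1" "c {t1, z} \<noteq> d2" using d12 t by (auto simp: mis_def)
    qed (use col d12 in \<open>auto simp: A_def B_def i_def\<close>)
  qed
  have mem: "c {x, s} \<in> ms x y c y" if "{x, s} \<in> E - {{x, y}}" "c {x, s} \<noteq> p" "c {x, s} \<noteq> r" for s
    using U[OF colour_lt[OF pc that(1)]] that colour_not_ms(1)[OF that(1)] by blast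
  have memU: "c {s, z} \<in> ?U" if "{s, z} \<in> E - {{x, y}}" "c {s, z} \<noteq> p" "c {s, z} \<noteq> r" for s
    using U[OF colour_lt[OF pc that(1)]] that by blast
  show False
  proof (cases "c {x, s1} = r")
    case True
    then have 2: "c {x, s2} \<noteq> r" using rx by blast
    then have 3: "c {s2, z} = r" using easy[OF xs2 s2z] np by blast
    then show False using hard[OF xs1 s1z xs2 s2z s12 True] mem[OF xs2] memU[OF s1z] 2 np rx by blast
  next
    case False
    then have 3: "c {s1, z} = r" using easy[OF xs1 s1z] np by blast
    then have "c {x, s2} = r" using easy[OF xs2 s2z] np rx by blast
    then show False using hard[OF xs2 s2z xs1 s1z s12[symmetric]] mem[OF xs1] memU[OF s2z] 3 False np rx by blast
  qed
qed

text \<open>If the exceptional colour \<open>p\<close> lies on \<open>{z, w}\<close>, the path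
  \<open>u z s w\<close> avoids it, and one colour missing at \<open>w\<close> suffices because
  \<open>z\<close> misses two. Otherwise \<open>p\<close> is the only colour missing at
  \<open>w\<close> by \<open>fan_missing\<close>, so \<open>{w, t}\<close> avoids \<open>p\<close>
  and the path \<open>u z w t\<close> is forbidden.\<close>

lemma small_nbrs_of_triangle:
  assumes zu: "{z, u} \<in> E" and dd: "d z + d u = k + 3" and dz: "d z < k"
    and w: "w \<in> N z" "w \<noteq> u" "d w + 1 = k" and s: "s \<in> N z" "s \<in> N w" "s \<noteq> u"
    and t: "t \<in> N w" "t \<noteq> z" "t \<noteq> u" "d t + 2 \<le> k"
  shows False
proof -
  obtain c where pc: "pc z u c" using pc_ex[OF zu] by blast
  obtain p where p: "\<And>a. a < k \<Longrightarrow> a \<in> ms z u c z \<union> ms z u c u \<longleftrightarrow> a \<noteq> p"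
    using one_common_colour[OF pc dd] by metis
  have ne: "w \<noteq> z" "s \<noteq> z" "s \<noteq> w" "t \<noteq> w" using w s t by auto
  have zw: "{z, w} \<in> E - {{z, u}}" and zs: "{z, s} \<in> E - {{z, u}}" and sw: "{s, w} \<in> E - {{z, u}}" and wt: "{w, t} \<in> E - {{z, u}}"
    using w s t ne by (auto simp: edgeN insert_commute doubleton_eq_iff)
  have two: "2 \<le> card (ms z u c z)" using card_ms[OF pc, of z] dz by simp
  have "card (ms z u c w) = 1" using card_ms[OF pc, of w] w ne by simp
  then obtain e where e: "ms z u c w = {e}" by (auto simp: card_1_singleton_iff)
  have ek: "e < k" using e mis_lt[of e k "E - {{z, u}}" c w] by simp
  have "2 \<le> card (ms z u c t)" using card_ms[OF pc, of t] t by simp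
  then obtain d1 d2 where d12: "d1 \<in> ms z u c t" "d2 \<in> ms z u c t" "d1 \<noteq> d2" by (rule two_elements)
  show False
  proof (cases "c {z, w} = p")
    case True
    then have "c {z, s} \<noteq> p" "c {s, w} \<noteq> p" "e \<noteq> p"
      using colour_neq(1)[OF pc zs zw] colour_neq(2)[OF pc sw zw] ne e colour_not_ms(3)[OF zw, of c] by auto
    then show False
      using kierstead[OF pc zs sw ne(1) w(2), of e e] two p[OF colour_lt[OF pc zs]] p[OF colour_lt[OF pc sw]]
        colour_not_ms(1)[OF zs, of c] p[OF ek] e by blast
  next
    case False
    then have cw: "c {z, w} \<in> ms z u c u" using p[OF colour_lt[OF pc zw]] colour_not_ms(1)[OF zw] by blast
    then have "e = p" using fan_missing[OF pc zw] e p[OF ek] by blast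
    then have "c {w, t} \<noteq> p" using colour_not_ms(2)[OF wt, of c] e by auto
    then have wU: "c {w, t} \<in> ms z u c z \<union> ms z u c u" using p[OF colour_lt[OF pc wt]] by blast
    obtain b where b: "b \<in> ms z u c t" "b \<noteq> p" using d12 by metis
    then show False using kierstead[OF pc zw wt t(2,3) cw wU, of b b] two p[OF mis_lt[OF b(1)]] by blast
  qed
qed


text \<open>A path \<open>y x w v\<close> whose middle edge lies in a triangle \<open>x w s\<close> cannot have degrees 3,
  \<open>k\<close>, \<open>k - 1\<close> and at most \<open>k - 2\<close>. Here the ordinary Kierstead argument just fails, because
  \<open>w\<close> misses a single colour; the second colour needed is borrowed from \<open>v\<close>.\<close>

context
  fixes x y w s v :: 'a
  assumes xy: "{x, y} \<in> E" and dx: "d x = k" and dy: "d y = 3" and xw: "{x, w} \<in> E" and dw: "d w + 1 = k"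
    and wv: "{w, v} \<in> E" and dv: "d v + 2 \<le> k" and xs: "{x, s} \<in> E" and sw: "{s, w} \<in> E"
    and ney: "w \<noteq> y" "v \<noteq> y" "s \<noteq> y" and nev: "v \<noteq> x" "v \<noteq> s"
begin

lemma path_neq: "w \<noteq> x" "s \<noteq> x" "s \<noteq> w" "v \<noteq> w" "x \<noteq> y"
  using edge_neq xy xw wv xs sw by auto

lemma path_edges: "{x, w} \<in> E - {{x, y}}" "{w, v} \<in> E - {{x, y}}" "{x, s} \<in> E - {{x, y}}" "{s, w} \<in> E - {{x, y}}"
  using xw wv xs sw ney nev path_neq by (auto simp: doubleton_eq_iff)

lemma path_degree_sum: "d x + d y = k + 3" using dx dy by simp

text \<open>Otherwise the single colour missing at \<open>w\<close> is the exceptional colour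
  \<open>p\<close>. If \<open>v\<close> misses \<open>p\<close> too, giving \<open>p\<close> to
  \<open>{w, v}\<close> frees at \<open>w\<close> a colour that \<open>fan_missing\<close> forbids;
  if not, \<open>v\<close> misses two ordinary colours and \<open>y x w v\<close> contradicts
  \<open>kierstead\<close>.\<close>

lemma path_common:
  assumes pc: "pc x y c"
  shows "c {x, w} \<notin> ms x y c x \<union> ms x y c y"
proof
  assume xwU: "c {x, w} \<in> ms x y c x \<union> ms x y c y"
  obtain p where p: "\<And>a. a < k \<Longrightarrow> a \<in> ms x y c x \<union> ms x y c y \<longleftrightarrow> a \<noteq> p"
    using one_common_colour[OF pc path_degree_sum] by metis
  have cw: "c {x, w} \<in> ms x y c y" using xwU colour_not_ms(1)[OF path_edges(1), of c] by blast
  have "card (ms x y c w) = 1" using card_ms[OF pc, of w] dw path_neq ney by simp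
  then obtain e where e: "ms x y c w = {e}" by (auto simp: card_1_singleton_iff)
  have "e < k" using e mis_lt[of e k "E - {{x, y}}" c w] by simp
  then have ep: "e = p" using fan_missing[OF pc path_edges(1) cw, of e] e p[of e] by blast
  have hp: "c {w, v} \<noteq> p" using colour_not_ms(2)[OF path_edges(2), of c] e ep by auto
  then have hU: "c {w, v} \<in> ms x y c x \<union> ms x y c y" using p[OF colour_lt[OF pc path_edges(2)]] by blast
  have "2 \<le> card (ms x y c v)" using card_ms[OF pc, of v] dv nev ney by simp
  then obtain d1 d2 where d12: "d1 \<in> ms x y c v" "d2 \<in> ms x y c v" "d1 \<noteq> d2" by (rule two_elements)
  show False
  proof (cases "p \<in> ms x y c v")
    case True
    have pw: "p \<in> ms x y c w" using e ep by simp
    note rc = recolour[OF pc path_edges(2) pw True]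
    let ?c = "c({w, v} := p)"
    have eq: "?c {x, w} = c {x, w}" using path_neq nev by (auto simp: doubleton_eq_iff)
    have "c {w, v} \<in> ms x y ?c w" "ms x y ?c x = ms x y c x" "ms x y ?c y = ms x y c y"
      using rc(2) hp path_neq ney nev by auto
    then have "?c {x, w} \<in> ms x y ?c y" "c {w, v} \<in> ms x y ?c x \<union> ms x y ?c y" "c {w, v} \<in> ms x y ?c w"
      using cw hU by (simp_all only: eq)
    then show False using fan_missing[OF rc(1) path_edges(1)] by blast
  next
    case False
    then have "d1 \<noteq> p" "d2 \<noteq> p" using d12 by auto
    then show False
      using kierstead[OF pc path_edges(1,2) nev(1) ney(2) cw hU, of d1 d2] d12
        p[OF mis_lt[OF d12(1)]] p[OF mis_lt[OF d12(2)]] by blast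
  qed
qed

lemma path_colours:
  assumes pc: "pc x y c"
  shows "c {x, s} \<in> ms x y c y" and "c {s, w} \<in> ms x y c x \<union> ms x y c y" and "c {w, v} \<in> ms x y c x \<union> ms x y c y"
    and "a < k \<Longrightarrow> a \<in> ms x y c x \<union> ms x y c y \<or> a = c {x, w}"
    and "c {s, w} \<noteq> c {x, s}" "c {w, v} \<noteq> c {s, w}"
proof -
  obtain p where p: "\<And>a. a < k \<Longrightarrow> a \<in> ms x y c x \<union> ms x y c y \<longleftrightarrow> a \<noteq> p"
    using one_common_colour[OF pc path_degree_sum] by metis
  have xwp: "c {x, w} = p" using path_common[OF pc] p[OF colour_lt[OF pc path_edges(1)]] by blast
  have "c {x, s} \<noteq> p" "c {s, w} \<noteq> p" "c {w, v} \<noteq> p"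
    using colour_neq(1)[OF pc path_edges(3,1)] colour_neq(2)[OF pc path_edges(4,1)] colour_neq(3)[OF pc path_edges(1,2)]
      path_neq nev xwp by auto
  then show "c {x, s} \<in> ms x y c y" "c {s, w} \<in> ms x y c x \<union> ms x y c y" "c {w, v} \<in> ms x y c x \<union> ms x y c y"
    using p[OF colour_lt[OF pc path_edges(3)]] p[OF colour_lt[OF pc path_edges(4)]] p[OF colour_lt[OF pc path_edges(2)]]
      colour_not_ms(1)[OF path_edges(3), of c] by blast+
  show "a < k \<Longrightarrow> a \<in> ms x y c x \<union> ms x y c y \<or> a = c {x, w}" using p[of a] xwp by blast
  show "c {s, w} \<noteq> c {x, s}" "c {w, v} \<noteq> c {s, w}"
    using colour_neq(3)[OF pc path_edges(3,4)] colour_neq(3)[OF pc path_edges(4,2)] path_neq nev by auto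
qed

lemma path_end:
  assumes "pc x y c" "c {x, s} \<in> ms x y c w" "c {s, w} \<in> ms x y c x"
  shows False
  using kierstead_end[OF assms(1) path_edges(3,4) _ _ path_colours(1)[OF assms(1)] assms(2,3)] path_neq ney by blast

text \<open>There are two kinds of moves: Kempe changes involving \<open>e\<close>, which move
  \<open>w\<close> and \<open>v\<close> together, and giving \<open>e\<close> to
  \<open>{w, v}\<close>, which exchanges \<open>e\<close> with the colour \<open>h\<close> of that
  edge. They lead to \<open>e = i\<close> with a colour missing at \<open>x\<close> on
  \<open>{s, w}\<close>, that is, to \<open>path_end\<close>.\<close>

lemma path_shared:
  assumes pc: "pc x y c" and e: "e \<in> ms x y c w" "e \<in> ms x y c v" "e \<in> ms x y c x \<union> ms x y c y"
  shows False
proof -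
  define A B i where "A = ms x y c x" and "B = ms x y c y" and "i = c {x, s}"
  have iB: "i \<in> B" using path_colours(1)[OF pc] by (simp add: i_def B_def)
  have AB: "A \<inter> B = {}" using pc_disj[OF pc] by (auto simp: A_def B_def)
  define Q where "Q e j h \<longleftrightarrow> (\<exists>c. pc x y c \<and> ms x y c x = A \<and> ms x y c y = B \<and> c {x, s} = i \<and>
      c {s, w} = j \<and> c {w, v} = h \<and> e \<in> ms x y c w \<and> e \<in> ms x y c v)" for e j h
  have mv: "Q (transpose a b e) (transpose a b j) (transpose a b h)"
    if Q: "Q e j h" and ab: "a \<in> A" "b \<in> B" "e = a \<or> e = b" for e j h a b
  proof -
    obtain c where c: "pc x y c" "ms x y c x = A" "ms x y c y = B" "c {x, s} = i"
      "c {s, w} = j" "c {w, v} = h" "e \<in> ms x y c w" "e \<in> ms x y c v" using Q unfolding Q_def by blast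
    have aw: "a \<in> ms x y c w \<or> b \<in> ms x y c w" "a \<in> ms x y c v \<or> b \<in> ms x y c v" using ab c by auto
    have ab': "a \<in> ms x y c x" "b \<in> ms x y c y" using ab c by auto
    obtain c' where c': "pc x y c'" "kept x y c c' x" "kept x y c c' y"
      and m: "\<And>z. z \<noteq> x \<Longrightarrow> z \<noteq> y \<Longrightarrow> a \<in> ms x y c z \<or> b \<in> ms x y c z \<Longrightarrow> moved x y a b c c' z"
      by (rule move[OF c(1) ab']) blast
    have mw: "moved x y a b c c' w" and mv: "moved x y a b c c' v" using m aw path_neq ney nev by blast+
    show ?thesis unfolding Q_def
      using c' c keptD[OF c'(2)] keptD[OF c'(3)] movedD[OF mw] movedD[OF mv] path_edges by (intro exI[of _ c']) auto
  qed
  have facts: "e \<noteq> j \<and> e \<noteq> h \<and> j \<noteq> i \<and> h \<noteq> j \<and> j \<in> A \<union> B \<and> h \<in> A \<union> B" if Q: "Q e j h" for e j h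
  proof -
    obtain c where c: "pc x y c" "ms x y c x = A" "ms x y c y = B" "c {x, s} = i"
      "c {s, w} = j" "c {w, v} = h" "e \<in> ms x y c w" "e \<in> ms x y c v" using Q unfolding Q_def by blast
    show ?thesis using path_colours[OF c(1)] c colour_not_ms(3)[OF path_edges(4), of c] colour_not_ms(2)[OF path_edges(2), of c] by auto
  qed
  have re: "Q h j e" if Q: "Q e j h" for e j h
  proof -
    obtain c where c: "pc x y c" "ms x y c x = A" "ms x y c y = B" "c {x, s} = i"
      "c {s, w} = j" "c {w, v} = h" "e \<in> ms x y c w" "e \<in> ms x y c v" using Q unfolding Q_def by blast
    note rc = recolour[OF c(1) path_edges(2) c(7,8)]
    have "h \<noteq> e" using facts[OF Q] by blast
    then show ?thesis unfolding Q_def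
      using rc c path_neq ney nev by (intro exI[of _ "c({w, v} := e)"]) (auto simp: doubleton_eq_iff)
  qed
  have fin: False if "Q i j h" "j \<in> A" for j h
    using that path_end unfolding Q_def by blast
  have "\<exists>e j h. e \<in> A \<and> Q e j h"
  proof (cases "e \<in> A")
    case True
    then show ?thesis using pc e unfolding Q_def A_def B_def i_def by blast
  next
    case False
    obtain a where a: "a \<in> A" using ms_nonempty[OF pc] by (auto simp: A_def)
    have "Q e (c {s, w}) (c {w, v})" using pc e unfolding Q_def A_def B_def i_def by blast
    from mv[OF this a, of e] show ?thesis using a e False by (auto simp: A_def B_def)
  qed
  then obtain e j h where e: "e \<in> A" and Q0: "Q e j h" by blast
  have ei: "e \<noteq> i" using e iB AB by blast
  have "Q (transpose e i e) (transpose e i j) (transpose e i h)" using mv[OF Q0 e iB] by simp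
  then have Q1: "Q i j (transpose e i h)" using facts[OF Q0] by auto
  show False
  proof (cases "j \<in> A")
    case True then show ?thesis using fin Q1 by blast
  next
    case False
    then have jB: "j \<in> B" using facts[OF Q0] by blast
    define g where "g = transpose e i h"
    \<comment> \<open>The colour \<open>i\<close> is parked on \<open>{w, v}\<close> while
      \<open>j\<close> is traded for a colour of \<open>A\<close>; a second recolouring of
      \<open>{w, v}\<close> makes \<open>i\<close> missing again.\<close>
    have Q2: "Q g j i" using re[OF Q1] by (simp add: g_def)
    have g: "g \<noteq> i" "g \<noteq> j" "g \<in> A \<union> B" using facts[OF Q2] facts[OF Q1] by (auto simp: g_def)
    obtain a where a: "a \<in> A" "Q a j i"
    proof (cases "g \<in> A")
      case True then show ?thesis using that Q2 by blast
    next
      case False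
      then have "Q (transpose e g g) (transpose e g j) (transpose e g i)" using mv[OF Q2 e, of g] g by auto
      moreover have "e \<noteq> j" using e jB AB by blast
      ultimately have "Q e j i" using g ei by (simp add: transpose_def)
      then show ?thesis using that e by blast
    qed
    have aj: "a \<noteq> j" "a \<noteq> i" using a jB iB AB by blast+
    have "Q (transpose a j a) (transpose a j j) (transpose a j i)" using mv[OF a(2,1) jB] by simp
    moreover have "j \<noteq> i" using facts[OF Q1] by blast
    ultimately have "Q j a i" using aj by (simp add: transpose_def)
    then have "Q i a j" by (rule re)
    then show False using fin a by blast
  qed
qed

text \<open>Once \<open>w\<close> and \<open>x\<close> miss a common colour, which a Kempe change
  achieves, it can be given to \<open>{x, w}\<close>. The old colour of that edge is then missing at
  \<open>x\<close>, \<open>w\<close> and \<open>v\<close>, against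
  \<open>path_shared\<close>.\<close>

lemma path_common_not_missing:
  assumes pc: "pc x y c"
  shows "c {x, w} \<notin> ms x y c v"
proof
  assume v: "c {x, w} \<in> ms x y c v"
  define p where "p = c {x, w}"
  have "card (ms x y c w) = 1" using card_ms[OF pc, of w] dw path_neq ney by simp
  then obtain e where e: "e \<in> ms x y c w" by (auto simp: card_1_singleton_iff)
  have eU: "e \<in> ms x y c x \<union> ms x y c y"
    using path_colours(4)[OF pc mis_lt[OF e]] e colour_not_ms(3)[OF path_edges(1), of c] by auto
  have *: False if pc: "pc x y c" and v: "c {x, w} \<in> ms x y c v" and e: "e \<in> ms x y c w" "e \<in> ms x y c x" for c e
  proof -
    note rc = recolour[OF pc path_edges(1) e(2,1)]
    have ne: "c {x, w} \<noteq> e" using e(1) colour_not_ms(3)[OF path_edges(1), of c] by auto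
    show False
      by (rule path_shared[OF rc(1), of "c {x, w}"]) (use rc(2) v ne path_neq nev in auto)
  qed
  show False
  proof (cases "e \<in> ms x y c x")
    case True
    then show ?thesis using * pc v e by blast
  next
    case False
    then have ey: "e \<in> ms x y c y" using eU by blast
    obtain a where a: "a \<in> ms x y c x" using ms_nonempty[OF pc] by blast
    obtain c' where c': "pc x y c'" "kept x y c c' x" "kept x y c c' y" "moved x y a e c c' w"
      and mk: "moved x y a e c c' v \<or> kept x y c c' v"
      using move[OF pc a ey] e path_neq ney by metis
    have pU: "p \<noteq> a" "p \<noteq> e" using path_common[OF pc] a ey by (auto simp: p_def)
    have px: "c' {x, w} = p" using keptD(2)[OF c'(2) path_edges(1)] by (simp add: p_def)
    have "p \<in> ms x y c' v"
      using mk movedD(1)[of x y a e c c' v p] keptD(1)[of x y c c' v] v pU by (auto simp: p_def)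
    moreover have "a \<in> ms x y c' w" using movedD(1)[OF c'(4) e] by simp
    moreover have "a \<in> ms x y c' x" using keptD(1)[OF c'(2)] a by simp
    ultimately show False using *[OF c'(1)] px by simp
  qed
qed

lemma path_impossible: False
proof -
  obtain c0 where pc0: "pc x y c0" using pc_ex[OF xy] by blast
  define A B i where "A = ms x y c0 x" and "B = ms x y c0 y" and "i = c0 {x, s}"
  have iB: "i \<in> B" using path_colours(1)[OF pc0] by (simp add: i_def B_def)
  have AB: "A \<inter> B = {}" using pc_disj[OF pc0] by (auto simp: A_def B_def)
  have "card A = 1" using card_ms[OF pc0, of x] dx by (simp add: A_def)
  then obtain a where Aa: "A = {a}" by (auto simp: card_1_singleton_iff)
  have aB: "b \<noteq> a" if "b \<in> B" for b using AB Aa that by auto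
  \<comment> \<open>A Kempe change for \<open>a\<close> and \<open>b \<in> B\<close> either transposes all of \<open>e, j, h, b1, b2\<close> or, when \<open>w\<close> lies on
    the chain joining \<open>x\<close> and \<open>y\<close>, only \<open>b1\<close> and \<open>b2\<close>. The aim is \<open>e = i\<close> and \<open>j = a\<close>.\<close>
  define R where "R e j h b1 b2 \<longleftrightarrow> (\<exists>c. pc x y c \<and> ms x y c x = A \<and> ms x y c y = B \<and> c {x, s} = i \<and>
      c {s, w} = j \<and> c {w, v} = h \<and> e \<in> ms x y c w \<and> b1 \<in> ms x y c v \<and> b2 \<in> ms x y c v \<and> b1 \<noteq> b2)" for e j h b1 b2
  have sym: "R e j h b2 b1" if "R e j h b1 b2" for e j h b1 b2 using that unfolding R_def by metis
  have facts: "e \<in> insert a B \<and> j \<in> insert a B \<and> h \<in> insert a B \<and> b1 \<in> insert a B \<and> b2 \<in> insert a B \<and>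
     e \<noteq> j \<and> e \<noteq> h \<and> j \<noteq> i \<and> h \<noteq> j \<and> b1 \<noteq> h \<and> b2 \<noteq> h \<and> b1 \<noteq> b2 \<and> e \<noteq> b1 \<and> e \<noteq> b2" if R: "R e j h b1 b2" for e j h b1 b2
  proof -
    obtain c where c: "pc x y c" "ms x y c x = A" "ms x y c y = B" "c {x, s} = i"
      "c {s, w} = j" "c {w, v} = h" "e \<in> ms x y c w" "b1 \<in> ms x y c v" "b2 \<in> ms x y c v" "b1 \<noteq> b2"
      using R unfolding R_def by blast
    have U: "b \<in> insert a B" if "b \<in> ms x y c v" for b
      using path_colours(4)[OF c(1) mis_lt[OF that]] path_common_not_missing[OF c(1)] that c Aa by auto
    have "e \<in> insert a B"
      using path_colours(4)[OF c(1) mis_lt[OF c(7)]] c Aa colour_not_ms(3)[OF path_edges(1), of c] by auto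
    moreover from this have "e \<notin> ms x y c v" using path_shared[OF c(1,7)] c Aa by auto
    ultimately show ?thesis
      using path_colours(2,3,5,6)[OF c(1)] U c Aa colour_not_ms(3)[OF path_edges(4), of c]
        colour_not_ms(2,3)[OF path_edges(2), of c] by auto
  qed
  have mv: "R (transpose a b e) (transpose a b j) (transpose a b h) (transpose a b b1) (transpose a b b2) \<or>
      R e j h (transpose a b b1) (transpose a b b2) \<and>
      \<not> (e \<in> {a, b} \<or> h \<in> {a, b} \<and> (b1 \<in> {a, b} \<or> b2 \<in> {a, b}))"
    if R: "R e j h b1 b2" and b: "b \<in> B" for e j h b1 b2 b
  proof -
    obtain c where c: "pc x y c" "ms x y c x = A" "ms x y c y = B" "c {x, s} = i"
      "c {s, w} = j" "c {w, v} = h" "e \<in> ms x y c w" "b1 \<in> ms x y c v" "b2 \<in> ms x y c v" "b1 \<noteq> b2"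
      using R unfolding R_def by blast
    have ab': "a \<in> ms x y c x" "b \<in> ms x y c y" using b c Aa by auto
    obtain c' where c': "pc x y c'" "kept x y c c' x" "kept x y c c' y"
      and m: "\<And>z. z \<noteq> x \<Longrightarrow> z \<noteq> y \<Longrightarrow> a \<in> ms x y c z \<or> b \<in> ms x y c z \<Longrightarrow> moved x y a b c c' z"
      and mk: "\<And>z. moved x y a b c c' z \<or> kept x y c c' z"
      by (rule move[OF c(1) ab']) blast
    have st: "c' {x, s} = i" "ms x y c' x = A" "ms x y c' y = B"
      using keptD[OF c'(2)] keptD[OF c'(3)] c path_edges by auto
    have bs: "transpose a b b1 \<in> ms x y c' v" "transpose a b b2 \<in> ms x y c' v"
    proof -
      have "transpose a b z \<in> ms x y c' v" if z: "z \<in> ms x y c v" for z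
      proof (cases "moved x y a b c c' v")
        case True then show ?thesis using movedD(1) z by blast
      next
        case False
        then have "a \<notin> ms x y c v" "b \<notin> ms x y c v" using m nev ney by blast+
        then have "transpose a b z = z" using z by (auto simp: transpose_def)
        then show ?thesis using mk[of v] False keptD(1) z by fastforce
      qed
      then show "transpose a b b1 \<in> ms x y c' v" "transpose a b b2 \<in> ms x y c' v" using c by blast+
    qed
    have bne: "transpose a b b1 \<noteq> transpose a b b2" using c(10) by (simp add: inj_eq[OF inj_transpose])
    show ?thesis
    proof (cases "moved x y a b c c' w")
      case True
      then show ?thesis unfolding R_def
        using c'(1) c movedD[OF True] st bs bne path_edges by (intro disjI1 exI[of _ c']) auto
    next
      case False
      then have kw: "kept x y c c' w" using mk by blast
      have "\<not> (e \<in> {a, b})" using m[of w] False c(7) path_neq ney by auto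
      \<comment> \<open>A vertex \<open>v\<close> that misses \<open>a\<close> or \<open>b\<close>
        is moved, which changes the colour of \<open>{w, v}\<close> if it is one of the two; so
        \<open>w\<close> cannot have been kept.\<close>
      moreover have "\<not> (h \<in> {a, b} \<and> (b1 \<in> {a, b} \<or> b2 \<in> {a, b}))"
      proof
        assume h: "h \<in> {a, b} \<and> (b1 \<in> {a, b} \<or> b2 \<in> {a, b})"
        then have "moved x y a b c c' v" using m[of v] c(8,9) nev ney by auto
        then have "c' {w, v} = transpose a b h" using movedD(3) path_edges c by blast
        moreover have "c' {w, v} = h" using keptD(2)[OF kw path_edges(2)] c by simp
        ultimately show False using h aB[OF b] by auto
      qed
      moreover have "R e j h (transpose a b b1) (transpose a b b2)"
        unfolding R_def using c'(1) c keptD[OF kw] st bs bne path_edges by (intro exI[of _ c']) auto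
      ultimately show ?thesis by blast
    qed
  qed
  have fin: False if "R i a h b1 b2" for h b1 b2
    using that path_end Aa unfolding R_def by blast
  have G1: False if R: "R i j h a b" and h: "h \<noteq> a" and j: "j \<noteq> a" for j h b
  proof -
    note f = facts[OF R]
    have jB: "j \<in> B" and hB: "h \<in> B" and bB: "b \<in> B" using f h j by auto
    note ne = aB[OF iB] aB[OF jB] aB[OF hB] aB[OF bB]
    \<comment> \<open>Both changes are of the kind that forces \<open>w\<close> to move. They carry
      \<open>a\<close> from the missing colours of \<open>v\<close> to the edge
      \<open>{w, v}\<close> and from there to \<open>{s, w}\<close>.\<close>
    have G0: False if R: "R i j h a j"
    proof -
      have "R i j a h j" using mv[OF R hB] facts[OF R] ne by (auto simp: transpose_def split: if_splits)
      then have "R i a j h a" using mv[OF _ jB, of i j a h j] facts[OF R] ne by (auto simp: transpose_def split: if_splits)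
      then show False by (rule fin)
    qed
    show False
    proof (cases "b = j")
      case True then show ?thesis using G0 R by blast
    next
      case False
      have "R i a h j b \<or> R i j h j b" using mv[OF R jB] f ne False by (auto simp: transpose_def split: if_splits)
      then have R1: "R i j h j b" using fin by blast
      have "R i j h j a" using mv[OF R1 bB] f ne False by (auto simp: transpose_def split: if_splits)
      then show False using G0 sym by blast
    qed
  qed
  have G2: False if R: "R i j h b1 b2" and h: "h \<noteq> a" and j: "j \<noteq> a" for j h b1 b2
  proof (cases "b1 = a \<or> b2 = a")
    case True
    then show ?thesis using G1[OF _ h j] R sym by blast
  next
    case False
    note f = facts[OF R]
    have jB: "j \<in> B" and hB: "h \<in> B" and bB: "b1 \<in> B" "b2 \<in> B" using f h j False by auto
    note ne = aB[OF iB] aB[OF jB] aB[OF hB] aB[OF bB(1)] aB[OF bB(2)]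
    have "(\<exists>h b1 b2. R i a h b1 b2) \<or> R i j h a b2"
    proof (cases "b1 = j")
      case True
      then show ?thesis using mv[OF R bB(1)] f ne by (auto simp: transpose_def split: if_splits)
    next
      case False
      then show ?thesis using mv[OF R bB(1)] f ne by (auto simp: transpose_def split: if_splits)
    qed
    then show False using fin G1[OF _ h j] by blast
  qed
  have G3: False if R: "R i j h b1 b2" for j h b1 b2
  proof (cases "j = a")
    case True then show ?thesis using fin R by blast
  next
    case j: False
    show ?thesis
    proof (cases "h = a")
      case False then show ?thesis using G2 R j by blast
    next
      case True
      note f = facts[OF R]
      have jB: "j \<in> B" and bB: "b1 \<in> B" "b2 \<in> B" using f j True by auto
      note ne = aB[OF iB] aB[OF jB] aB[OF bB(1)] aB[OF bB(2)]
      show ?thesis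
      proof (cases "b1 = j \<or> b2 = j")
        case True2: True
        then have "\<exists>h b1 b2. R i a h b1 b2"
          using mv[OF R jB] f ne True by (auto simp: transpose_def split: if_splits)
        then show ?thesis using fin by blast
      next
        case False
        then have "R i j b1 a b2" using mv[OF R bB(1)] f ne True by (auto simp: transpose_def split: if_splits)
        then show ?thesis using G2 ne j by blast
      qed
    qed
  qed
  have "2 \<le> card (ms x y c0 v)" using card_ms[OF pc0, of v] dv nev ney by simp
  then obtain b1 b2 where b12: "b1 \<in> ms x y c0 v" "b2 \<in> ms x y c0 v" "b1 \<noteq> b2" by (rule two_elements)
  have "card (ms x y c0 w) = 1" using card_ms[OF pc0, of w] dw path_neq ney by simp
  then obtain e where e: "e \<in> ms x y c0 w" by (auto simp: card_1_singleton_iff)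
  have R0: "R e (c0 {s, w}) (c0 {w, v}) b1 b2"
    unfolding R_def using pc0 b12 e by (auto simp: A_def B_def i_def)
  have "\<exists>j h b1 b2. R a j h b1 b2"
  proof (cases "e = a")
    case False
    then have "e \<in> B" using facts[OF R0] by blast
    from mv[OF R0 this] show ?thesis by auto
  qed (use R0 in blast)
  then obtain j h b1 b2 where "R a j h b1 b2" by blast
  from mv[OF this iB] have "\<exists>j h b1 b2. R i j h b1 b2" by auto
  then show False using G3 by blast
qed

end

end

section \<open>Contractions and the edge density of graphs without a $K_5$ minor\<close>

lemma simple_graphD:
  assumes "simple_graph G"
  shows "finite (verts G)" "finite (edges G)" "e \<in> edges G \<Longrightarrow> e \<subseteq> verts G" "e \<in> edges G \<Longrightarrow> card e = 2"
    "{a, b} \<in> edges G \<Longrightarrow> a \<noteq> b" "{a, b} \<in> edges G \<Longrightarrow> a \<in> verts G" "{a, b} \<in> edges G \<Longrightarrow> b \<in> verts G"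
    "finite (nb (edges G) v)"
proof -
  show f: "finite (verts G)" and s: "e \<in> edges G \<Longrightarrow> e \<subseteq> verts G" and c: "e \<in> edges G \<Longrightarrow> card e = 2" for e
    using assms by (auto simp: simple_graph_def)
  show "finite (edges G)" by (rule finite_subset[of _ "Pow (verts G)"]) (use f s in auto)
  show "{a, b} \<in> edges G \<Longrightarrow> a \<noteq> b" using c[of "{a, b}"] by auto
  show "{a, b} \<in> edges G \<Longrightarrow> a \<in> verts G" "{a, b} \<in> edges G \<Longrightarrow> b \<in> verts G" using s[of "{a, b}"] by auto
  show "finite (nb (edges G) v)" by (rule finite_subset[OF _ f]) (use s in \<open>auto simp: nb_def\<close>)
qed

lemma minor_steps_minor: "minor_step\<^sup>*\<^sup>* G G' \<Longrightarrow> is_minor H G' \<Longrightarrow> is_minor H G"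
  unfolding is_minor_def by (meson rtranclp_trans)

lemma minor_step_minor: "minor_step G G' \<Longrightarrow> is_minor H G' \<Longrightarrow> is_minor H G"
  by (rule minor_steps_minor) auto

lemma delete_vertices:
  assumes "finite D" "D \<subseteq> verts G"
  shows "minor_step\<^sup>*\<^sup>* G (UGraph (verts G - D) {e \<in> edges G. e \<inter> D = {}})"
  using assms
proof (induction D)
  case empty then show ?case by simp
next
  case (insert v D)
  let ?G = "UGraph (verts G - D) {e \<in> edges G. e \<inter> D = {}}"
  have "minor_step ?G (delete_vertex ?G v)" by (rule minor_step.del_vertex) (use insert in auto)
  moreover have "delete_vertex ?G v = UGraph (verts G - insert v D) {e \<in> edges G. e \<inter> insert v D = {}}"
    by (auto simp: delete_vertex_def)
  ultimately show ?case using insert by (auto intro: rtranclp.rtrancl_into_rtrancl)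
qed

lemma delete_edges:
  assumes "finite D" "D \<subseteq> edges G"
  shows "minor_step\<^sup>*\<^sup>* G (UGraph (verts G) (edges G - D))"
  using assms
proof (induction D)
  case empty then show ?case by simp
next
  case (insert e D)
  let ?G = "UGraph (verts G) (edges G - D)"
  have "minor_step ?G (delete_edge ?G e)" by (rule minor_step.del_edge) (use insert in auto)
  moreover have "delete_edge ?G e = UGraph (verts G) (edges G - insert e D)"
    by (auto simp: delete_edge_def)
  ultimately show ?case using insert by (auto intro: rtranclp.rtrancl_into_rtrancl)
qed

lemma K5_subgraph_minor:
  assumes G: "simple_graph G" and S: "S \<subseteq> verts G" "card S = 5"
    and adj: "\<And>u v. u \<in> S \<Longrightarrow> v \<in> S \<Longrightarrow> u \<noteq> v \<Longrightarrow> {u, v} \<in> edges G"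
  shows "is_minor (complete_graph 5) G"
proof -
  let ?H = "UGraph (verts G - (verts G - S)) {e \<in> edges G. e \<inter> (verts G - S) = {}}"
  have st: "minor_step\<^sup>*\<^sup>* G ?H" by (rule delete_vertices) (use simple_graphD[OF G] in auto)
  have V: "verts ?H = S" using S by auto
  have E: "edges ?H = {{u, v} | u v. u \<in> S \<and> v \<in> S \<and> u \<noteq> v}"
  proof (intro equalityI subsetI)
    fix e assume e: "e \<in> edges ?H"
    then have "card e = 2" "e \<subseteq> S" using simple_graphD(3,4)[OF G, of e] by auto
    then obtain u v where "e = {u, v}" "u \<noteq> v" by (auto simp: card_2_iff)
    then show "e \<in> {{u, v} | u v. u \<in> S \<and> v \<in> S \<and> u \<noteq> v}" using \<open>e \<subseteq> S\<close> by blast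
  next
    fix e assume "e \<in> {{u, v} | u v. u \<in> S \<and> v \<in> S \<and> u \<noteq> v}"
    then show "e \<in> edges ?H" using adj by auto
  qed
  have "finite S" using S(2) card.infinite by fastforce
  then obtain f where f: "bij_betw f S {0..<card S}" using ex_bij_betw_finite_nat by blast
  then have f: "bij_betw f S {..<5}" using S(2) by (simp add: atLeast0LessThan)
  have inj: "f u = f v \<longleftrightarrow> u = v" if "u \<in> S" "v \<in> S" for u v
    using f that by (auto simp: bij_betw_def inj_on_def)
  have im: "f ` S = {..<5}" using f by (simp add: bij_betw_def)
  have "edges (complete_graph 5) = (\<lambda>e. f ` e) ` edges ?H"
  proof (intro equalityI subsetI)
    fix e assume "e \<in> edges (complete_graph 5)"
    then obtain i j where ij: "e = {i, j}" "i < 5" "j < 5" "i \<noteq> j" by (auto simp: complete_graph_def)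
    then obtain u v where uv: "u \<in> S" "v \<in> S" "i = f u" "j = f v"
      using im by (metis imageE lessThan_iff)
    then have "e = f ` {u, v}" "{u, v} \<in> edges ?H" using ij unfolding E by auto
    then show "e \<in> (\<lambda>e. f ` e) ` edges ?H" by blast
  next
    fix e assume "e \<in> (\<lambda>e. f ` e) ` edges ?H"
    then obtain u v where uv: "u \<in> S" "v \<in> S" "u \<noteq> v" "e = {f u, f v}" unfolding E by auto
    then have "f u \<noteq> f v" "f u < 5" "f v < 5" using inj im by auto
    then show "e \<in> edges (complete_graph 5)" using uv by (auto simp: complete_graph_def)
  qed
  moreover have "bij_betw f (verts ?H) (verts (complete_graph 5))"
    unfolding V using f by (simp add: complete_graph_def)
  ultimately have "graph_isomorphic ?H (complete_graph 5)"
    unfolding graph_isomorphic_def by blast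
  then show ?thesis using st unfolding is_minor_def by blast
qed

lemma edges_contract:
  assumes G: "simple_graph G" and uv: "{u, v} \<in> edges G"
  shows "edges (contract_edge G u v) = {e \<in> edges G. v \<notin> e} \<union> (\<lambda>x. {u, x}) ` (nb (edges G) v - {u})"
proof -
  let ?r = "\<lambda>x. if x = v then u else x"
  have out: "?r ` e = e" if "v \<notin> e" for e
  proof -
    have "?r ` e = id ` e" by (rule image_cong) (use that in auto)
    then show ?thesis by simp
  qed
  have inn: "?r ` {v, x} = {u, x}" if "x \<noteq> v" for x using that by auto
  have mem: "e \<in> edges (contract_edge G u v) \<longleftrightarrow> (\<exists>e'\<in>edges G. e = ?r ` e') \<and> e \<noteq> {u}" for e
    by (auto simp: contract_edge_def)
  have split: "\<exists>x. e = {v, x} \<and> x \<noteq> v" if "e \<in> edges G" "v \<in> e" for e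
  proof -
    have "card e = 2" using that simple_graphD(4)[OF G] by blast
    then obtain p q where "e = {p, q}" "p \<noteq> q" by (auto simp: card_2_iff)
    then show ?thesis using that(2) by auto
  qed
  show ?thesis
  proof (intro equalityI subsetI)
    fix e assume "e \<in> edges (contract_edge G u v)"
    then obtain e' where e': "e' \<in> edges G" "e = ?r ` e'" "e \<noteq> {u}" unfolding mem by blast
    show "e \<in> {e \<in> edges G. v \<notin> e} \<union> (\<lambda>x. {u, x}) ` (nb (edges G) v - {u})"
    proof (cases "v \<in> e'")
      case True
      then obtain x where x: "e' = {v, x}" "x \<noteq> v" using split e' by blast
      then have "e = {u, x}" using e'(2) inn by simp
      moreover have "x \<in> nb (edges G) v" using e' x by (simp add: nb_def)
      ultimately show ?thesis using e'(3) by auto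
    next
      case False then show ?thesis using out e' by simp
    qed
  next
    fix e assume "e \<in> {e \<in> edges G. v \<notin> e} \<union> (\<lambda>x. {u, x}) ` (nb (edges G) v - {u})"
    then show "e \<in> edges (contract_edge G u v)"
    proof
      assume e: "e \<in> {e \<in> edges G. v \<notin> e}"
      then have "e \<noteq> {u}" using simple_graphD(4)[OF G, of e] by auto
      moreover have "e = ?r ` e" using out e by simp
      ultimately show ?thesis using e unfolding mem by blast
    next
      assume "e \<in> (\<lambda>x. {u, x}) ` (nb (edges G) v - {u})"
      then obtain x where x: "e = {u, x}" "{v, x} \<in> edges G" "x \<noteq> u" by (auto simp: nb_def)
      have "x \<noteq> v" using simple_graphD(5)[OF G x(2)] by simp
      then have "e = ?r ` {v, x}" "e \<noteq> {u}" using x inn by auto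
      then show ?thesis using x(2) unfolding mem by blast
    qed
  qed
qed

lemma verts_contract [simp]: "verts (contract_edge G u v) = verts G - {v}"
  by (simp add: contract_edge_def)

lemma adj_contract:
  assumes G: "simple_graph G" and uv: "{u, v} \<in> edges G"
  shows "{a, b} \<in> edges (contract_edge G u v) \<longleftrightarrow>
    a \<noteq> v \<and> b \<noteq> v \<and> a \<noteq> b \<and> ({a, b} \<in> edges G \<or> a = u \<and> {v, b} \<in> edges G \<or> b = u \<and> {v, a} \<in> edges G)"
  using simple_graphD(5)[OF G] simple_graphD(5)[OF G uv] unfolding edges_contract[OF G uv]
  by (auto simp: nb_def doubleton_eq_iff image_iff insert_commute)

lemma simple_contract:
  assumes G: "simple_graph G" and uv: "{u, v} \<in> edges G"
  shows "simple_graph (contract_edge G u v)"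
  unfolding simple_graph_def
proof (intro conjI ballI)
  show "finite (verts (contract_edge G u v))" using simple_graphD(1)[OF G] by simp
  fix e assume "e \<in> edges (contract_edge G u v)"
  then have "e \<in> edges G \<and> v \<notin> e \<or> (\<exists>x. e = {u, x} \<and> {v, x} \<in> edges G \<and> x \<noteq> u)"
    unfolding edges_contract[OF G uv] by (auto simp: nb_def)
  then show "e \<subseteq> verts (contract_edge G u v)" "card e = 2"
    using simple_graphD(3-7)[OF G] uv by (auto, blast+)
qed

text \<open>Lost are \<open>{u, v}\<close> itself and, for each common neighbour of \<open>u\<close>
  and \<open>v\<close>, one of two edges that become parallel.\<close>

lemma card_edges_contract:
  assumes G: "simple_graph G" and uv: "{u, v} \<in> edges G"
  shows "card (edges G) \<le> card (edges (contract_edge G u v)) + 1 + card (nb (edges G) u \<inter> nb (edges G) v)"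
proof -
  let ?E = "edges G"
  note D = simple_graphD[OF G]
  let ?A = "{e \<in> ?E. v \<notin> e}" and ?X = "nb ?E v - {u} - nb ?E u"
  let ?B = "(\<lambda>x. {u, x}) ` ?X"
  have "?E = ?A \<union> {e \<in> ?E. v \<in> e}" by blast
  then have "card ?E = card ?A + card {e \<in> ?E. v \<in> e}"
    using D(2) by (metis (no_types, lifting) card_Un_disjoint disjoint_iff finite_Un mem_Collect_eq)
  then have 1: "card ?E = card ?A + card (nb ?E v)"
    using card_incident[of ?E v] D(4) by (simp add: dg_def)
  have uN: "u \<in> nb ?E v" using uv by (simp add: nb_def insert_commute)
  have "nb ?E v = insert u (?X \<union> (nb ?E u \<inter> nb ?E v))" using uN by auto
  also have "card \<dots> \<le> Suc (card (?X \<union> (nb ?E u \<inter> nb ?E v)))" using D(8) by (simp add: card_insert_if)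
  finally have 2: "card (nb ?E v) \<le> 1 + card ?X + card (nb ?E u \<inter> nb ?E v)"
    using card_Un_le[of ?X "nb ?E u \<inter> nb ?E v"] by linarith
  have 3: "card ?B = card ?X" by (rule card_image) (auto intro!: inj_onI simp: doubleton_eq_iff)
  have "?A \<inter> ?B = {}" by (auto simp: nb_def)
  then have "card (?A \<union> ?B) = card ?A + card ?B"
    by (rule card_Un_disjoint[rotated 2]) (use D in auto)
  moreover have "card (?A \<union> ?B) \<le> card (edges (contract_edge G u v))"
  proof (rule card_mono)
    show "finite (edges (contract_edge G u v))" using simple_graphD(2)[OF simple_contract[OF G uv]] .
    show "?A \<union> ?B \<subseteq> edges (contract_edge G u v)" unfolding edges_contract[OF G uv] by blast
  qed
  ultimately show ?thesis using 1 2 3 by linarith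
qed

section \<open>Mader's bound for graphs without a K5 minor\<close>

lemma handshake:
  assumes "finite V" "finite E" "\<And>e. e \<in> E \<Longrightarrow> e \<subseteq> V \<and> card e = 2"
  shows "(\<Sum>v\<in>V. dg E v) = 2 * card E"
proof -
  have "(\<Sum>v\<in>V. dg E v) = (\<Sum>v\<in>V. card {e \<in> E. v \<in> e})"
    by (rule sum.cong) (use card_incident[of E] assms(3) in auto)
  also have "\<dots> = sum (\<lambda>_. 2) E"
  proof (rule sum_multicount_gen[OF assms(1,2)], intro ballI)
    fix e assume e: "e \<in> E"
    then have "{v \<in> V. v \<in> e} = e" using assms(3) by auto
    then show "card {v \<in> V. v \<in> e} = 2" using assms(3) e by simp
  qed
  finally show ?thesis by simp
qed

text \<open>If the neighbourhood is complete, it contains a K5 with or without \<open>v\<close>.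
  Otherwise it has five vertices and non-adjacency is a matching on it; for a non-adjacent pair
  \<open>a\<close>, \<open>b\<close>, contracting a suitable edge \<open>{a, c}\<close> joins
  \<open>a\<close> to \<open>b\<close> and leaves a K5.\<close>

lemma dense_nbhd_K5_minor:
  assumes G: "simple_graph G" and v: "card (nb (edges G) v) \<in> {4, 5}" "v \<in> verts G"
    and t: "\<And>u. u \<in> nb (edges G) v \<Longrightarrow> 3 \<le> card (nb (edges G) v \<inter> nb (edges G) u)"
  shows "is_minor (complete_graph 5) G"
proof -
  let ?W = "nb (edges G) v"
  note D = simple_graphD[OF G]
  have fW: "finite ?W" by (rule D)
  have vW: "v \<notin> ?W" using D(5)[of v v] by (auto simp: nb_def)
  have WV: "?W \<subseteq> verts G" using D(7) by (auto simp: nb_def)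
  have uu: "u \<notin> nb (edges G) u" for u using D(5)[of u u] by (auto simp: nb_def)
  have non: "card (?W - {u} - nb (edges G) u) + 4 \<le> card ?W" if u: "u \<in> ?W" for u
  proof -
    have "?W = insert u ((?W - {u} - nb (edges G) u) \<union> (?W \<inter> nb (edges G) u))" using u by auto
    also have "card \<dots> = Suc (card (?W - {u} - nb (edges G) u) + card (?W \<inter> nb (edges G) u))"
      by (subst card_insert_disjoint, use fW uu in simp, use uu in simp, subst card_Un_disjoint) (use fW in auto)
    finally show ?thesis using t[OF u] by simp
  qed
  show ?thesis
  proof (cases "\<forall>a\<in>?W. \<forall>b\<in>?W. a \<noteq> b \<longrightarrow> {a, b} \<in> edges G")
    case True
    show ?thesis
    proof (cases "card ?W = 4")
      case W4: True
      show ?thesis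
      proof (rule K5_subgraph_minor[OF G, of "insert v ?W"])
        show "card (insert v ?W) = 5" using vW fW W4 by simp
        show "{a, b} \<in> edges G" if "a \<in> insert v ?W" "b \<in> insert v ?W" "a \<noteq> b" for a b
        proof -
          have "{v, c} \<in> edges G" "{c, v} \<in> edges G" if "c \<in> ?W" for c
            using that by (simp_all add: nb_def insert_commute)
          then show ?thesis using that True by blast
        qed
      qed (use WV v in auto)
    next
      case False
      then show ?thesis using K5_subgraph_minor[OF G WV] v True by auto
    qed
  next
    case False
    then obtain a b where ab: "a \<in> ?W" "b \<in> ?W" "a \<noteq> b" "{a, b} \<notin> edges G" by blast
    have W5: "card ?W = 5"
    proof (rule ccontr)
      assume "card ?W \<noteq> 5"
      then have "card (?W - {a} - nb (edges G) a) = 0" using non[OF ab(1)] v by auto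
      then have "?W - {a} - nb (edges G) a = {}" using fW by simp
      then show False using ab by (auto simp: nb_def)
    qed
    have only: "{u, q} \<in> edges G" if u: "u \<in> ?W" "p \<in> ?W" "q \<in> ?W" "p \<noteq> u" "q \<noteq> u" "p \<noteq> q" "{u, p} \<notin> edges G" for u p q
    proof (rule ccontr)
      assume "{u, q} \<notin> edges G"
      then have "{p, q} \<subseteq> ?W - {u} - nb (edges G) u" using u by (auto simp: nb_def)
      then have "card {p, q} \<le> card (?W - {u} - nb (edges G) u)" by (rule card_mono[rotated]) (use fW in simp)
      then show False using non[OF u(1)] W5 u by simp
    qed
    let ?W' = "?W - {a, b}"
    have c3: "card ?W' = 3" using W5 ab fW by (simp add: card_Diff_subset)
    \<comment> \<open>At most one pair of the three remaining vertices is non-adjacent. If there is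
      one, \<open>c\<close> is taken from it, so that \<open>e\<close> and \<open>f\<close> are
      adjacent once \<open>c\<close> is merged into \<open>a\<close>.\<close>
    obtain c e f where cef: "?W' = {c, e, f}" "c \<noteq> e" "c \<noteq> f" "e \<noteq> f" "{e, f} \<in> edges G"
    proof (cases "\<exists>c\<in>?W'. \<exists>e\<in>?W'. c \<noteq> e \<and> {c, e} \<notin> edges G")
      case True
      then obtain c e where ce: "c \<in> ?W'" "e \<in> ?W'" "c \<noteq> e" "{c, e} \<notin> edges G" by blast
      have "card (?W' - {c, e}) = 1" using c3 ce fW by (simp add: card_Diff_subset)
      then obtain f where f: "?W' - {c, e} = {f}" by (auto simp: card_1_singleton_iff)
      have W': "?W' = {c, e, f}" "f \<noteq> c" "f \<noteq> e" "f \<in> ?W'" using f ce by auto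
      have "{e, f} \<in> edges G"
        by (rule only[of e c f]) (use ce W' in \<open>auto simp: insert_commute\<close>)
      then show ?thesis using that W' ce by blast
    next
      case False
      obtain c e f where "?W' = {c, e, f}" "c \<noteq> e" "c \<noteq> f" "e \<noteq> f" using c3 by (auto simp: card_3_iff)
      moreover from this have "{e, f} \<in> edges G" using False by auto
      ultimately show ?thesis using that by blast
    qed
    have in_W: "c \<in> ?W" "e \<in> ?W" "f \<in> ?W" and ne: "c \<noteq> a" "c \<noteq> b" "e \<noteq> a" "e \<noteq> b" "f \<noteq> a" "f \<noteq> b"
      using cef(1) by auto
    have ac: "{a, c} \<in> edges G" by (rule only[of a b c]) (use ab in_W ne in auto)
    let ?G = "contract_edge G a c"
    have "is_minor (complete_graph 5) ?G"
    proof (rule K5_subgraph_minor[OF simple_contract[OF G ac], of "{v, a, b, e, f}"])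
      have vne: "v \<noteq> a" "v \<noteq> b" "v \<noteq> c" "v \<noteq> e" "v \<noteq> f" using vW ab in_W by auto
      show "card {v, a, b, e, f} = 5" using vne ab ne cef by auto
      show "{v, a, b, e, f} \<subseteq> verts ?G" using WV v ab in_W vne ne cef by auto
      have vE: "{v, a} \<in> edges G" "{v, b} \<in> edges G" "{v, e} \<in> edges G" "{v, f} \<in> edges G"
        using ab in_W by (auto simp: nb_def)
      have aE: "{a, e} \<in> edges G" "{a, f} \<in> edges G"
        by (rule only[of a b]; use ab in_W ne in auto)+
      have bE: "{b, e} \<in> edges G" "{b, f} \<in> edges G" "{b, c} \<in> edges G"
        by (rule only[of b a]; use ab in_W ne in \<open>auto simp: insert_commute\<close>)+
      show "{x, y} \<in> edges ?G" if "x \<in> {v, a, b, e, f}" "y \<in> {v, a, b, e, f}" "x \<noteq> y" for x y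
        unfolding adj_contract[OF G ac] using that vE aE bE cef(2-5) vne ne by (auto simp: insert_commute)
    qed
    then show ?thesis by (rule minor_step_minor[OF minor_step.contract[OF ac D(5)[OF ac]]])
  qed
qed

lemma card_edges_le_choose:
  assumes G: "simple_graph G"
  shows "card (edges G) \<le> card (verts G) choose 2"
proof -
  have "edges G \<subseteq> {e. e \<subseteq> verts G \<and> card e = 2}" using simple_graphD[OF G] by auto
  then have "card (edges G) \<le> card {e. e \<subseteq> verts G \<and> card e = 2}"
    by (rule card_mono[rotated]) (use simple_graphD(1)[OF G] in simp)
  then show ?thesis using n_subsets[OF simple_graphD(1)[OF G], of 2] by simp
qed

text \<open>An edge in at most two triangles can be contracted, and a surplus edge deleted, within
  the bound. What remains has exactly \<open>3 n - 5\<close> edges, hence a vertex of degree at most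
  5, and all edges lie in three triangles; unless that vertex is isolated,
  \<open>dense_nbhd_K5_minor\<close> applies.\<close>

theorem mader_K5:
  fixes G :: "'a ugraph"
  assumes "simple_graph G" "3 \<le> card (verts G)" "3 * card (verts G) \<le> card (edges G) + 5"
  shows "is_minor (complete_graph 5) G"
  using assms
proof (induction "card (verts G) + card (edges G)" arbitrary: G rule: less_induct)
  case less
  note G = less.prems(1)
  note D = simple_graphD[OF G]
  let ?n = "card (verts G)" and ?m = "card (edges G)"
  have n4: "4 \<le> ?n"
  proof (rule ccontr)
    assume "\<not> 4 \<le> ?n"
    then have "?n = 3" using less.prems by simp
    then show False using card_edges_le_choose[OF G] less.prems by (simp add: numeral_eq_Suc)
  qed
  have IH: "is_minor (complete_graph 5) G'" if "simple_graph G'" "card (verts G') = ?n - 1" "?m \<le> card (edges G') + 3" "card (edges G') \<le> ?m" for G' :: "'a ugraph"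
    by (rule less.hyps) (use that n4 less.prems in auto)
  have contr: "card (edges (contract_edge G u v)) \<le> ?m" if "{u, v} \<in> edges G" for u v
  proof -
    have "edges (contract_edge G u v) \<subseteq> (\<lambda>e. (\<lambda>x. if x = v then u else x) ` e) ` edges G" by (auto simp: contract_edge_def)
    then have "card (edges (contract_edge G u v)) \<le> card ((\<lambda>e. (\<lambda>x. if x = v then u else x) ` e) ` edges G)"
      by (rule card_mono[rotated]) (use D in simp)
    then show ?thesis using card_image_le[OF D(2)] by (rule order_trans)
  qed
  show ?case
  proof (cases "\<exists>u v. {u, v} \<in> edges G \<and> card (nb (edges G) u \<inter> nb (edges G) v) \<le> 2")
    case True
    then obtain u v where uv: "{u, v} \<in> edges G" "card (nb (edges G) u \<inter> nb (edges G) v) \<le> 2" by blast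
    have "is_minor (complete_graph 5) (contract_edge G u v)"
      by (rule IH[OF simple_contract[OF G uv(1)] _ _ contr[OF uv(1)]])
        (use card_edges_contract[OF G uv(1)] uv(2) D(1) D(7)[OF uv(1)] in auto)
    then show ?thesis by (rule minor_step_minor[OF minor_step.contract[OF uv(1) D(5)[OF uv(1)]]])
  next
    case False
    then have t3: "3 \<le> card (nb (edges G) u \<inter> nb (edges G) v)" if "{u, v} \<in> edges G" for u v
      using that by (metis not_less_eq_eq numeral_2_eq_2 numeral_3_eq_3)
    show ?thesis
    proof (cases "?m + 5 = 3 * ?n")
      case False
      then have "edges G \<noteq> {}" using less.prems n4 by auto
      then obtain e where e: "e \<in> edges G" by blast
      have m: "card (edges (delete_edge G e)) = ?m - 1" using e D(2) by (simp add: delete_edge_def)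
      have "?m > 0" using e D(2) by (auto simp: card_gt_0_iff)
      have "is_minor (complete_graph 5) (delete_edge G e)"
      proof (rule less.hyps)
        show "simple_graph (delete_edge G e)" using G by (auto simp: simple_graph_def delete_edge_def)
      qed (use m False less.prems \<open>?m > 0\<close> in \<open>auto simp: delete_edge_def\<close>)
      then show ?thesis by (rule minor_step_minor[OF minor_step.del_edge[OF e]])
    next
      case True
      have "\<exists>v\<in>verts G. dg (edges G) v \<le> 5"
      proof (rule ccontr)
        assume "\<not> ?thesis"
        then have "(\<Sum>v\<in>verts G. 6) \<le> (\<Sum>v\<in>verts G. dg (edges G) v)" by (intro sum_mono) auto
        then show False using handshake[OF D(1,2)] D(3,4) True n4 by simp
      qed
      then obtain v where v: "v \<in> verts G" "dg (edges G) v \<le> 5" by blast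
      let ?W = "nb (edges G) v"
      show ?thesis
      proof (cases "?W = {}")
        case True
        have e: "edges (delete_vertex G v) = edges G"
        proof -
          have "v \<notin> e" if e: "e \<in> edges G" for e
          proof
            assume "v \<in> e"
            moreover have "card e = 2" using D(4) e .
            ultimately obtain u where "e = {v, u}" by (auto simp: card_2_iff insert_commute)
            then show False using True e by (auto simp: nb_def)
          qed
          then show ?thesis by (auto simp: delete_vertex_def)
        qed
        have "is_minor (complete_graph 5) (delete_vertex G v)"
        proof (rule IH)
          show "simple_graph (delete_vertex G v)" using G by (auto simp: simple_graph_def delete_vertex_def)
          show "card (verts (delete_vertex G v)) = ?n - 1" using v D(1) by (simp add: delete_vertex_def)
        qed (simp_all add: e)
        then show ?thesis by (rule minor_step_minor[OF minor_step.del_vertex[OF v(1)]])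
      next
        case False
        have t: "3 \<le> card (?W \<inter> nb (edges G) u)" if "u \<in> ?W" for u
          using t3[of v u] that by (simp add: nb_def)
        obtain u where u: "u \<in> ?W" using False by blast
        have "u \<notin> nb (edges G) u" using D(5)[of u u] by (auto simp: nb_def)
        then have "?W \<inter> nb (edges G) u \<subseteq> ?W - {u}" by blast
        then have "card (?W \<inter> nb (edges G) u) \<le> card (?W - {u})" by (rule card_mono[rotated]) (use D(8) in simp)
        then have "4 \<le> card ?W" using t[OF u] u D(8)[of v] by (simp add: card_Diff_singleton)
        then have "card ?W \<in> {4, 5}" using v(2) by (auto simp: dg_def)
        then show ?thesis using dense_nbhd_K5_minor[OF G _ v(1) t] by blast
      qed
    qed
  qed
qed

section \<open>Contracting all edges of a matching\<close>

definition confl :: "'a set set \<Rightarrow> 'a \<times> 'a \<Rightarrow> 'a \<times> 'a \<Rightarrow> bool" where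
  "confl E p q \<longleftrightarrow> {fst p, fst q} \<in> E \<and> {snd p, snd q} \<in> E \<or> {fst p, snd q} \<in> E \<and> {snd p, fst q} \<in> E"

lemma confl_sym: "confl E p q \<longleftrightarrow> confl E q p"
  by (auto simp: confl_def insert_commute)

definition ntri :: "'a set set \<Rightarrow> 'a \<Rightarrow> 'a \<Rightarrow> nat" where
  "ntri E u v = card (nb E u \<inter> nb E v)"

text \<open>Contracting an edge changes \<open>2 |E| - 6 |V|\<close> by \<open>4 - 2 t\<close> where \<open>t\<close> is the number of
  triangles on it; when all edges of a matching are contracted, a four-cycle through two of them
  costs one more edge.\<close>

definition gain :: "'a set set \<Rightarrow> ('a \<times> 'a) set \<Rightarrow> 'a \<times> 'a \<Rightarrow> int" where
  "gain E M p = 4 - 2 * int (ntri E (fst p) (snd p)) - int (card {q \<in> M - {p}. confl E p q})"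

definition matching :: "'a set set \<Rightarrow> ('a \<times> 'a) set \<Rightarrow> bool" where
  "matching E M \<longleftrightarrow> (\<forall>p\<in>M. {fst p, snd p} \<in> E) \<and>
     (\<forall>p\<in>M. \<forall>q\<in>M. p \<noteq> q \<longrightarrow> {fst p, snd p} \<inter> {fst q, snd q} = {})"

definition excess :: "'a ugraph \<Rightarrow> int" where
  "excess G = 3 * int (card (verts G)) - int (card (edges G))"

lemma excess_contract:
  assumes G: "simple_graph G" and uv: "{u, v} \<in> edges G"
  shows "excess (contract_edge G u v) \<le> excess G - 2 + int (ntri (edges G) u v)"
proof -
  have "v \<in> verts G" using simple_graphD(7)[OF G uv] .
  then have "int (card (verts G)) = int (card (verts (contract_edge G u v))) + 1"
    using simple_graphD(1)[OF G] by (simp add: card_gt_0_iff Suc_leI of_nat_diff)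
      (metis One_nat_def Suc_leI card_gt_0_iff empty_iff of_nat_1 of_nat_diff diff_add_cancel)
  then show ?thesis using card_edges_contract[OF G uv] by (simp add: excess_def ntri_def)
qed

text \<open>A pair \<open>(s, g)\<close> contracts \<open>s\<close> into \<open>g\<close>, so first
  components disappear. Adjacency is traced back to \<open>G\<close> because gains are computed in
  \<open>G\<close> although the contractions happen in succession.\<close>

definition contracts_to :: "'a ugraph \<Rightarrow> ('a \<times> 'a) set \<Rightarrow> 'a ugraph \<Rightarrow> bool" where
  "contracts_to G M G' \<longleftrightarrow> minor_step\<^sup>*\<^sup>* G G' \<and> simple_graph G' \<and> verts G' = verts G - fst ` M \<and>
    (\<forall>a b. {a, b} \<in> edges G' \<longleftrightarrow> a \<noteq> b \<and> a \<notin> fst ` M \<and> b \<notin> fst ` M \<and>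
       (\<exists>a' b'. (a' = a \<or> (a', a) \<in> M) \<and> (b' = b \<or> (b', b) \<in> M) \<and> {a', b'} \<in> edges G)) \<and>
    2 * excess G' \<le> 2 * excess G - (\<Sum>p\<in>M. gain (edges G) M p)"

lemma contracts_toD:
  assumes "contracts_to G M G'"
  shows "minor_step\<^sup>*\<^sup>* G G'" "simple_graph G'" "verts G' = verts G - fst ` M"
    "{a, b} \<in> edges G' \<longleftrightarrow> a \<noteq> b \<and> a \<notin> fst ` M \<and> b \<notin> fst ` M \<and>
       (\<exists>a' b'. (a' = a \<or> (a', a) \<in> M) \<and> (b' = b \<or> (b', b) \<in> M) \<and> {a', b'} \<in> edges G)"
    "2 * excess G' \<le> 2 * excess G - (\<Sum>p\<in>M. gain (edges G) M p)"
  using assms unfolding contracts_to_def by simp_all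

text \<open>When a further pair is contracted, a common neighbour of its ends comes from a triangle
  of \<open>G\<close> or from a conflict with an earlier pair. Each conflict thus costs one edge,
  which counts 2 in \<open>2 * excess\<close>; the gains of the two pairs bear 1 each.\<close>

lemma contract_matching:
  fixes G :: "'a ugraph"
  assumes "finite M" "simple_graph G" "matching (edges G) M"
  shows "\<exists>G'. contracts_to G M G'"
  using assms
proof (induction M)
  case empty
  have "{a, b} \<in> edges G \<Longrightarrow> a \<noteq> b" for a b using simple_graphD(5)[OF empty(1)] .
  then show ?case using empty unfolding contracts_to_def by (intro exI[of _ G]) auto
next
  case (insert p M)
  let ?E = "edges G"
  note D = simple_graphD[OF \<open>simple_graph G\<close>]
  have mM: "matching ?E M" using insert.prems(2) by (auto simp: matching_def)
  obtain G' where "contracts_to G M G'" using insert.IH[OF \<open>simple_graph G\<close> mM] by (elim exE)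
  note G' = contracts_toD(1-3)[OF this] and adj = contracts_toD(4)[OF this] and ex = contracts_toD(5)[OF this]
  obtain s g where p: "p = (s, g)" by (cases p)
  have sg: "{s, g} \<in> ?E" using insert.prems(2) by (simp add: matching_def p)
  have sne: "s \<noteq> g" using D(5)[OF sg] .
  have dis: "s \<noteq> a \<and> s \<noteq> b \<and> g \<noteq> a \<and> g \<noteq> b" if "(a, b) \<in> M" for a b
  proof -
    have "(a, b) \<noteq> p" using that insert.hyps(2) by auto
    then have "{fst p, snd p} \<inter> {a, b} = {}"
      using insert.prems(2) that unfolding matching_def by (metis fst_conv insertCI snd_conv)
    then show ?thesis by (auto simp: p)
  qed
  have nM: "s \<notin> fst ` M" "g \<notin> fst ` M" "(a, s) \<notin> M" "(a, g) \<notin> M" "(s, a) \<notin> M" "(g, a) \<notin> M" for a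
    using dis by force+
  have gs: "{g, s} \<in> edges G'" unfolding adj using sg sne nM by (auto simp: insert_commute)
  let ?G = "contract_edge G' g s"
  have st: "minor_step\<^sup>*\<^sup>* G ?G"
    using G'(1) minor_step.contract[OF gs sne[symmetric]] by (rule rtranclp.rtrancl_into_rtrancl)
  define cl where "cl M a = insert a {a'. (a', a) \<in> M}" for M :: "('a \<times> 'a) set" and a
  have adjc: "{a, b} \<in> edges G' \<longleftrightarrow> a \<noteq> b \<and> a \<notin> fst ` M \<and> b \<notin> fst ` M \<and>
     (\<exists>a'\<in>cl M a. \<exists>b'\<in>cl M b. {a', b'} \<in> ?E)" for a b
    unfolding adj cl_def by blast
  have cl: "cl M g = {g}" "cl M s = {s}" "cl (insert p M) g = {g, s}" "\<And>a. a \<noteq> g \<Longrightarrow> cl (insert p M) a = cl M a"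
    unfolding cl_def p using nM by auto
  have con: "{a, b} \<in> edges ?G \<longleftrightarrow> a \<noteq> s \<and> b \<noteq> s \<and> a \<noteq> b \<and> ({a, b} \<in> edges G' \<or> a = g \<and> {s, b} \<in> edges G' \<or> b = g \<and> {s, a} \<in> edges G')" for a b
    by (rule adj_contract[OF G'(2) gs])
  have at_g: "{g, b} \<in> edges ?G \<longleftrightarrow> g \<noteq> b \<and> g \<notin> fst ` insert p M \<and> b \<notin> fst ` insert p M \<and>
       (\<exists>a'\<in>cl (insert p M) g. \<exists>b'\<in>cl (insert p M) b. {a', b'} \<in> ?E)" if b: "b \<noteq> g" "b \<noteq> s" for b
    unfolding con adjc unfolding cl(1-3) cl(4)[OF b(1)] using nM sne b by (simp add: p) blast
  have adjc': "{a, b} \<in> edges ?G \<longleftrightarrow> a \<noteq> b \<and> a \<notin> fst ` insert p M \<and> b \<notin> fst ` insert p M \<and>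
       (\<exists>a'\<in>cl (insert p M) a. \<exists>b'\<in>cl (insert p M) b. {a', b'} \<in> ?E)" for a b
  proof -
    have com: "(\<exists>a'\<in>X. \<exists>b'\<in>Y. {a', b'} \<in> ?E) \<longleftrightarrow> (\<exists>a'\<in>Y. \<exists>b'\<in>X. {a', b'} \<in> ?E)" for X Y
      by (metis insert_commute)
    consider "a = s \<or> b = s \<or> a = b" | "a = g" "b \<noteq> g" "b \<noteq> s" | "b = g" "a \<noteq> g" "a \<noteq> s"
      | "a \<noteq> g" "b \<noteq> g" "a \<noteq> s" "b \<noteq> s" "a \<noteq> b" by metis
    then show ?thesis
    proof cases
      case 1 then show ?thesis unfolding con by (auto simp: p)
    next
      case 2
      then show ?thesis using at_g by simp
    next
      case 3
      then show ?thesis using at_g[OF 3(2,3)] com[of "cl (insert p M) g" "cl (insert p M) a"]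
        insert_commute[of a g "{}"] by metis
    next
      case 4
      then show ?thesis unfolding con adjc cl(4)[OF 4(1)] cl(4)[OF 4(2)] using nM sne by (simp add: p)
    qed
  qed
  have adj': "{a, b} \<in> edges ?G \<longleftrightarrow> a \<noteq> b \<and> a \<notin> fst ` insert p M \<and> b \<notin> fst ` insert p M \<and>
       (\<exists>a' b'. (a' = a \<or> (a', a) \<in> insert p M) \<and> (b' = b \<or> (b', b) \<in> insert p M) \<and> {a', b'} \<in> ?E)" for a b
    unfolding adjc' cl_def by blast
  have tri: "ntri (edges G') g s \<le> ntri ?E s g + card {q \<in> M. confl ?E p q}"
  proof -
    \<comment> \<open>\<open>\<phi>\<close> sends a vertex to the one into which it has been
      contracted.\<close>
    define \<phi> where "\<phi> x = (if \<exists>h. (x, h) \<in> M then SOME h. (x, h) \<in> M else x)" for x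
    have \<phi>1: "\<phi> x = h" if "(x, h) \<in> M" for x h
    proof -
      have "(x, \<phi> x) \<in> M" unfolding \<phi>_def using that by (auto intro: someI)
      then show ?thesis using that mM unfolding matching_def
        by (metis IntI empty_iff fst_conv insertI1 prod.inject)
    qed
    have \<phi>0: "\<phi> x = x" if "x \<notin> fst ` M" for x using that by (force simp: \<phi>_def)
    have "nb (edges G') g \<inter> nb (edges G') s \<subseteq> \<phi> ` (nb ?E s \<inter> nb ?E g) \<union> snd ` {q \<in> M. confl ?E p q}"
    proof
      fix h assume h: "h \<in> nb (edges G') g \<inter> nb (edges G') s"
      then have hM: "h \<notin> fst ` M" unfolding nb_def using adj by auto
      obtain h1 where h1: "h1 = h \<or> (h1, h) \<in> M" "{g, h1} \<in> ?E"
        using h nM unfolding nb_def by (auto simp: adj)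
      obtain h2 where h2: "h2 = h \<or> (h2, h) \<in> M" "{s, h2} \<in> ?E"
        using h nM unfolding nb_def by (auto simp: adj)
      show "h \<in> \<phi> ` (nb ?E s \<inter> nb ?E g) \<union> snd ` {q \<in> M. confl ?E p q}"
      proof (cases "h1 = h2")
        case True
        then have "h1 \<in> nb ?E s \<inter> nb ?E g" using h1 h2 by (auto simp: nb_def)
        moreover have "\<phi> h1 = h" using h1 \<phi>1 \<phi>0 hM by auto
        ultimately show ?thesis by blast
      next
        case False
        have uniq: "a = b" if "(a, h) \<in> M" "(b, h) \<in> M" for a b
          using that mM unfolding matching_def
          by (metis IntI empty_iff insertCI prod.inject snd_conv)
        obtain h' where q: "(h', h) \<in> M" "confl ?E p (h', h)"
          using h1 h2 False uniq unfolding confl_def p by (auto simp: insert_commute)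
        then show ?thesis by force
      qed
    qed
    then have "ntri (edges G') g s \<le> card (\<phi> ` (nb ?E s \<inter> nb ?E g) \<union> snd ` {q \<in> M. confl ?E p q})"
      unfolding ntri_def by (rule card_mono[rotated]) (use D(8) insert.hyps(1) in simp)
    also have "\<dots> \<le> card (\<phi> ` (nb ?E s \<inter> nb ?E g)) + card (snd ` {q \<in> M. confl ?E p q})" by (rule card_Un_le)
    also have "\<dots> \<le> card (nb ?E s \<inter> nb ?E g) + card {q \<in> M. confl ?E p q}"
      by (intro add_mono card_image_le) (use D(8) insert.hyps(1) in simp_all)
    finally show ?thesis by (simp add: ntri_def)
  qed
  have gains: "(\<Sum>q\<in>insert p M. gain ?E (insert p M) q) =
      (\<Sum>q\<in>M. gain ?E M q) + 4 - 2 * int (ntri ?E s g) - 2 * int (card {q \<in> M. confl ?E p q})"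
  proof -
    have 1: "gain ?E (insert p M) p = 4 - 2 * int (ntri ?E s g) - int (card {q \<in> M. confl ?E p q})"
    proof -
      have "insert p M - {p} = M" using insert.hyps(2) by simp
      then show ?thesis by (simp add: gain_def p)
    qed
    have 2: "gain ?E (insert p M) q = gain ?E M q - (if confl ?E p q then 1 else 0)" if q: "q \<in> M" for q
    proof -
      have "q \<noteq> p" using q insert.hyps(2) by blast
      then have "{r \<in> insert p M - {q}. confl ?E q r} = (if confl ?E p q then insert p {r \<in> M - {q}. confl ?E q r} else {r \<in> M - {q}. confl ?E q r})"
        using confl_sym[of ?E p q] by auto
      moreover have "p \<notin> {r \<in> M - {q}. confl ?E q r}" using insert.hyps(2) by blast
      ultimately show ?thesis using insert.hyps(1) by (simp add: gain_def)
    qed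
    have "(\<Sum>q\<in>M. gain ?E (insert p M) q) = (\<Sum>q\<in>M. gain ?E M q) - (\<Sum>q\<in>M. if confl ?E p q then 1 else 0)"
      using 2 by (simp add: sum_subtractf)
    also have "(\<Sum>q\<in>M. if confl ?E p q then 1 else (0::int)) = int (card {q \<in> M. confl ?E p q})"
      using insert.hyps(1) by (simp add: sum.If_cases Int_def)
    finally show ?thesis using 1 insert.hyps by simp
  qed
  have "2 * excess ?G \<le> 2 * excess G - (\<Sum>q\<in>insert p M. gain ?E (insert p M) q)"
    using excess_contract[OF G'(2) gs] ex tri gains by linarith
  moreover have "verts ?G = verts G - fst ` insert p M" using G'(3) by (auto simp: p)
  ultimately have "contracts_to G (insert p M) ?G"
    unfolding contracts_to_def using st simple_contract[OF G'(2) gs] adj' by (intro conjI allI)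
  then show ?case by (rule exI)
qed

text \<open>The first sum is \<open>- 2 * excess G\<close>, so it is enough that the contracted
  graph has positive excess. This is Mader's bound, or a count of pairs when only one or two
  vertices are left.\<close>

theorem contracted_density:
  fixes G :: "'a ugraph"
  assumes G: "simple_graph G" and K5: "K5_minor_free G" and V: "verts G \<noteq> {}"
    and M: "finite M" "matching (edges G) M"
  shows "(\<Sum>v\<in>verts G. int (dg (edges G) v) - 6) + (\<Sum>p\<in>M. gain (edges G) M p) < 0"
proof -
  note D = simple_graphD[OF G]
  obtain G' where "contracts_to G M G'" using contract_matching[OF M(1) G M(2)] by (elim exE)
  note G' = contracts_toD(1-3)[OF this] and ex = contracts_toD(5)[OF this]
  have "verts G' \<noteq> {}"
  proof (cases "M = {}")
    case True then show ?thesis using V G'(3) by simp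
  next
    case False
    then obtain s g where sg: "(s, g) \<in> M" by auto
    then have e: "{s, g} \<in> edges G" using M(2) unfolding matching_def by (metis fst_conv snd_conv)
    have "g \<notin> fst ` M"
    proof
      assume "g \<in> fst ` M"
      then obtain h where h: "(g, h) \<in> M" by auto
      then have "(g, h) = (s, g)" using M(2) sg unfolding matching_def
        by (metis IntI empty_iff fst_conv insertCI snd_conv)
      then show False using D(5)[OF e] by simp
    qed
    then show ?thesis using G'(3) D(7)[OF e] by blast
  qed
  then have n1: "1 \<le> card (verts G')" using simple_graphD(1)[OF G'(2)] by (simp add: Suc_leI card_gt_0_iff)
  have "0 < excess G'"
  proof (cases "3 \<le> card (verts G')")
    case True
    have "\<not> is_minor (complete_graph 5) G'"
      using minor_steps_minor[OF G'(1)] K5 by (auto simp: K5_minor_free_def)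
    then have "\<not> 3 * card (verts G') \<le> card (edges G') + 5" using mader_K5[OF G'(2) True] by blast
    then show ?thesis by (simp add: excess_def)
  next
    case False
    then have "card (verts G') = 1 \<or> card (verts G') = 2" using n1 by auto
    then show ?thesis using card_edges_le_choose[OF G'(2)] by (auto simp: excess_def numeral_eq_Suc)
  qed
  moreover have "(\<Sum>v\<in>verts G. int (dg (edges G) v) - 6) = - 2 * excess G"
  proof -
    have "(\<Sum>v\<in>verts G. dg (edges G) v) = 2 * card (edges G)" by (rule handshake) (use D in auto)
    then have "(\<Sum>v\<in>verts G. int (dg (edges G) v)) = 2 * int (card (edges G))" by (metis of_nat_mult of_nat_numeral of_nat_sum)
    then show ?thesis by (simp add: sum_subtractf excess_def)
  qed
  ultimately show ?thesis using ex by linarith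
qed

section \<open>Discharging\<close>

locale sparse_critical = critical +
  assumes sparse: "finite M \<Longrightarrow> matching E M \<Longrightarrow> (\<Sum>v\<in>\<Union>E. int (dg E v) - 6) + (\<Sum>p\<in>M. gain E M p) < 0"
    and k7: "7 \<le> k"
begin

definition cnt :: "'a \<Rightarrow> nat \<Rightarrow> nat" where
  "cnt v i = card {u \<in> N v. d u = i}"

definition low :: "'a \<Rightarrow> nat" where
  "low v = card {u \<in> N v. d u < k}"

lemma finite_V: "finite (\<Union>E)"
  using finE card2 by (metis card.infinite finite_Union zero_neq_numeral)

lemma V_iff: "v \<in> \<Union>E \<longleftrightarrow> N v \<noteq> {}"
proof
  assume "v \<in> \<Union>E"
  then obtain e where e: "e \<in> E" "v \<in> e" by blast
  then have "card e = 2" using card2 by blast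
  then obtain a b where "e = {a, b}" by (auto simp: card_2_iff)
  then show "N v \<noteq> {}" using e by (auto simp: nb_def insert_commute)
next
  assume "N v \<noteq> {}"
  then obtain u where "{v, u} \<in> E" by (auto simp: nb_def)
  then show "v \<in> \<Union>E" by blast
qed

lemma N_sub_V: "N v \<subseteq> \<Union>E"
  by (auto simp: nb_def)

lemma N_sym: "u \<in> N v \<Longrightarrow> v \<in> N u"
  by (simp add: nb_def insert_commute)

text \<open>Here \<open>f u v\<close> is the charge sent from \<open>u\<close> to \<open>v\<close>.
  The transfers cancel in the total, which leaves degrees and gains, against
  \<open>sparse\<close>.\<close>

lemma discharging:
  fixes f :: "'a \<Rightarrow> 'a \<Rightarrow> real" and x :: "'a \<Rightarrow> real"
  assumes M: "finite M" "matching E M"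
    and bal: "\<And>v. v \<in> \<Union>E \<Longrightarrow> 0 \<le> real (d v) - 6 + (\<Sum>u\<in>N v. f u v) - (\<Sum>u\<in>N v. f v u) + x v"
    and x: "(\<Sum>v\<in>\<Union>E. x v) \<le> real_of_int (\<Sum>p\<in>M. gain E M p)"
  shows False
proof -
  let ?V = "\<Union>E"
  have N: "N v = {u \<in> ?V. v \<in> N u}" for v
  proof (intro equalityI subsetI)
    fix u assume u: "u \<in> N v"
    then have "u \<in> ?V" by (rule subsetD[OF N_sub_V])
    then show "u \<in> {u \<in> ?V. v \<in> N u}" using N_sym[OF u] by simp
  next
    fix u assume "u \<in> {u \<in> ?V. v \<in> N u}"
    then show "u \<in> N v" using N_sym[of v u] by simp
  qed
  have "(\<Sum>v\<in>?V. \<Sum>u\<in>N v. f u v) = (\<Sum>v\<in>?V. \<Sum>u\<in>{u \<in> ?V. v \<in> N u}. f u v)"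
    by (intro sum.cong refl N)
  also have "\<dots> = (\<Sum>u\<in>?V. \<Sum>v\<in>{v \<in> ?V. v \<in> N u}. f u v)"
    by (rule sum.swap_restrict[OF finite_V finite_V])
  also have "\<dots> = (\<Sum>v\<in>?V. \<Sum>u\<in>N v. f v u)"
  proof (rule sum.cong)
    fix v
    have "{u \<in> ?V. u \<in> N v} = N v"
    proof (intro equalityI subsetI)
      fix u assume u: "u \<in> N v"
      then have "u \<in> ?V" by (rule subsetD[OF N_sub_V])
      then show "u \<in> {u \<in> ?V. u \<in> N v}" using u by simp
    qed simp
    then show "(\<Sum>u\<in>{u \<in> ?V. u \<in> N v}. f v u) = (\<Sum>u\<in>N v. f v u)" by simp
  qed simp
  finally have eq: "(\<Sum>v\<in>?V. \<Sum>u\<in>N v. f u v) = (\<Sum>v\<in>?V. \<Sum>u\<in>N v. f v u)" .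
  have "0 \<le> (\<Sum>v\<in>?V. real (d v) - 6 + (\<Sum>u\<in>N v. f u v) - (\<Sum>u\<in>N v. f v u) + x v)"
    by (rule sum_nonneg) (rule bal)
  also have "\<dots> = (\<Sum>v\<in>?V. real (d v) - 6) + (\<Sum>v\<in>?V. x v)"
    using eq by (simp add: sum.distrib sum_subtractf)
  also have "(\<Sum>v\<in>?V. real (d v) - 6) = real_of_int (\<Sum>v\<in>?V. int (d v) - 6)" by simp
  finally show False using sparse[OF M] x by linarith
qed

lemma vizing_cnt:
  assumes "z \<in> N v"
  shows "k + 1 \<le> cnt v k + d z" and "d z = k \<Longrightarrow> 2 \<le> cnt v k" and "2 \<le> cnt v k"
proof -
  have va: "k + 1 \<le> card {u \<in> N v. u \<noteq> z \<and> d u = k} + d z"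
    by (rule vizing_adjacency) (use assms in \<open>simp add: nb_def\<close>)
  have "card {u \<in> N v. u \<noteq> z \<and> d u = k} \<le> cnt v k" unfolding cnt_def by (rule card_mono) auto
  then show *: "k + 1 \<le> cnt v k + d z" using va by simp
  show 2: "2 \<le> cnt v k" if "d z = k"
  proof -
    have "{u \<in> N v. d u = k} = insert z {u \<in> N v. u \<noteq> z \<and> d u = k}" using assms that by auto
    then have "cnt v k = Suc (card {u \<in> N v. u \<noteq> z \<and> d u = k})" by (simp add: cnt_def)
    then show ?thesis using va that by simp
  qed
  show "2 \<le> cnt v k" using * 2 deg_le[of z] by (cases "d z = k") auto
qed

lemma low_cnt: "low v + cnt v k = d v"
proof -
  have "N v = {u \<in> N v. d u < k} \<union> {u \<in> N v. d u = k}" using deg_le by (auto simp: le_less)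
  also have "card \<dots> = low v + cnt v k" unfolding low_def cnt_def by (rule card_Un_disjoint) auto
  finally show ?thesis by (simp add: dg_def)
qed

lemma low_bound: "z \<in> N v \<Longrightarrow> low v + k + 1 \<le> d v + d z"
  using vizing_cnt(1)[of z v] low_cnt[of v] by simp

lemma low_pos: "z \<in> N v \<Longrightarrow> d z < k \<Longrightarrow> 1 \<le> low v"
  using card_mono[of "{u \<in> N v. d u < k}" "{z}"] by (simp add: low_def)

lemma degree_sum: "z \<in> N v \<Longrightarrow> k + 2 \<le> d v + d z"
proof -
  assume z: "z \<in> N v"
  have "1 \<le> low v \<or> d z = k"
  proof (rule disjCI)
    assume "d z \<noteq> k"
    then show "1 \<le> low v" using low_pos z deg_le[of z] by simp
  qed
  then show ?thesis using low_bound[OF z] vizing_cnt(3)[OF z] low_cnt[of v] by linarith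
qed

lemma degree_ge_2: "v \<in> \<Union>E \<Longrightarrow> 2 \<le> d v"
  using vizing_cnt(3) low_cnt[of v] unfolding V_iff by fastforce

lemma sum_by_degree:
  fixes h :: "nat \<Rightarrow> real"
  shows "(\<Sum>u\<in>N v. h (d u)) = (\<Sum>i\<le>k. real (cnt v i) * h i)"
proof -
  have "(\<Sum>u\<in>N v. h (d u)) = (\<Sum>i\<le>k. \<Sum>u\<in>{u \<in> N v. d u = i}. h (d u))"
    by (rule sum.group[symmetric]) (use deg_le in auto)
  also have "\<dots> = (\<Sum>i\<le>k. real (cnt v i) * h i)"
    by (rule sum.cong) (simp_all add: cnt_def)
  finally show ?thesis .
qed

lemma low_share_le:
  assumes "0 \<le> c"
  shows "(\<Sum>u\<in>N v. if d u < k then c / real (low v) else 0) \<le> c"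
proof -
  have "(\<Sum>u\<in>N v. if d u < k then c / real (low v) else 0) = real (low v) * (c / real (low v))"
    by (simp add: sum.If_cases low_def Int_def)
  then show ?thesis using assms by (cases "low v = 0") auto
qed

text \<open>Vertices of degree \<open>k\<close> and \<open>k - 1\<close> divide their charge equally
  among their low neighbours. A neighbour \<open>v\<close> with \<open>d v \<le> 5\<close> limits
  these to \<open>d v - 1\<close> and \<open>d v - 2\<close>, so for \<open>k \<ge> 8\<close> it
  gets at least \<open>2 / (d v - 1)\<close> and \<open>1 / (d v - 2)\<close>.\<close>

lemma large_degree_impossible:
  assumes k8: "8 \<le> k"
  shows False
proof -
  define f :: "'a \<Rightarrow> 'a \<Rightarrow> real" where "f u v = (if d u = k \<and> d v < k then (real k - 6) / real (low u)
     else if d u + 1 = k \<and> d v < k then (real k - 7) / real (low u) else 0)" for u v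
  have f0: "0 \<le> f u v" for u v using k8 by (auto simp: f_def)
  show False
  proof (rule discharging[of "{}" f "\<lambda>_. 0"])
    fix v assume v: "v \<in> \<Union>E"
    have inn0: "0 \<le> (\<Sum>u\<in>N v. f u v)" by (rule sum_nonneg) (rule f0)
    show "0 \<le> real (d v) - 6 + (\<Sum>u\<in>N v. f u v) - (\<Sum>u\<in>N v. f v u) + 0"
    proof (cases "6 \<le> d v")
      case True
      have "(\<Sum>u\<in>N v. f v u) \<le> real (d v) - 6"
      proof (cases "d v = k")
        case True
        then have "(\<Sum>u\<in>N v. f v u) = (\<Sum>u\<in>N v. if d u < k then (real k - 6) / real (low v) else 0)"
          by (intro sum.cong) (auto simp: f_def)
        then show ?thesis using low_share_le[of "real k - 6" v] k8 True by simp
      next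
        case False
        show ?thesis
        proof (cases "d v + 1 = k")
          case True
          then have "(\<Sum>u\<in>N v. f v u) = (\<Sum>u\<in>N v. if d u < k then (real k - 7) / real (low v) else 0)"
            by (intro sum.cong) (auto simp: f_def)
          moreover have "real (d v) - 6 = real k - 7" using True by linarith
          ultimately show ?thesis using low_share_le[of "real k - 7" v] k8 by simp
        next
          case F: False
          then have "(\<Sum>u\<in>N v. f v u) = 0" using False by (intro sum.neutral) (auto simp: f_def)
          then show ?thesis using \<open>6 \<le> d v\<close> by simp
        qed
      qed
      then show ?thesis using inn0 by simp
    next
      case False
      have out: "(\<Sum>u\<in>N v. f v u) = 0" using False k8 by (intro sum.neutral) (auto simp: f_def)
      have d2: "2 \<le> d v" by (rule degree_ge_2[OF v])
      \<comment> \<open>The value 0 of \<open>b\<close> avoids a division by zero: a vertex of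
        degree 2 has no neighbour of degree \<open>k - 1\<close>.\<close>
      define a b where "a = (real k - 6) / real (d v - 1)" and "b = (if d v = 2 then 0 else (real k - 7) / real (d v - 2))"
      define h where "h i = (if i = k then a else if i = k - 1 then b else 0)" for i
      have "h (d u) \<le> f u v" if u: "u \<in> N v" for u
      proof -
        have vu: "v \<in> N u" using N_sym u by simp
        have lb: "low u + k + 1 \<le> d u + d v" by (rule low_bound[OF vu])
        have l1: "1 \<le> low u" using low_pos[OF vu] False k8 by simp
        have dv: "d v < k" using False k8 by simp
        consider "d u = k" | "d u + 1 = k" | "d u \<noteq> k" "d u + 1 \<noteq> k" by blast
        then show ?thesis
        proof cases
          case 1
          then have "low u \<le> d v - 1" using lb by simp
          then have "(real k - 6) / real (d v - 1) \<le> (real k - 6) / real (low u)"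
            using l1 k8 by (intro divide_left_mono mult_pos_pos) auto
          then show ?thesis using 1 dv by (simp add: h_def a_def f_def)
        next
          case 2
          then have "low u \<le> d v - 2" "d v \<noteq> 2" using lb l1 by auto
          then have "(real k - 7) / real (d v - 2) \<le> (real k - 7) / real (low u)"
            using l1 k8 by (intro divide_left_mono mult_pos_pos) auto
          then show ?thesis using 2 dv \<open>d v \<noteq> 2\<close> by (auto simp: h_def b_def f_def)
        next
          case 3 then show ?thesis using f0[of u v] by (auto simp: h_def)
        qed
      qed
      then have "(\<Sum>u\<in>N v. h (d u)) \<le> (\<Sum>u\<in>N v. f u v)" by (rule sum_mono)
      moreover have "(\<Sum>u\<in>N v. h (d u)) = real (cnt v k) * a + real (cnt v (k - 1)) * b"
      proof -
        have "(\<Sum>u\<in>N v. h (d u)) = (\<Sum>i\<in>{k, k - 1}. real (cnt v i) * h i)"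
          unfolding sum_by_degree by (rule sum.mono_neutral_right) (auto simp: h_def)
        moreover have "k - 1 \<noteq> k" "h k = a" "h (k - 1) = b" using k8 by (auto simp: h_def)
        ultimately show ?thesis by simp
      qed
      moreover have "6 - real (d v) \<le> real (cnt v k) * a + real (cnt v (k - 1)) * b"
      proof -
        obtain z where z: "z \<in> N v" using v V_iff by blast
        have c2: "2 \<le> cnt v k" by (rule vizing_cnt(3)[OF z])
        have b0: "0 \<le> b" using k8 by (simp add: b_def)
        have a0: "0 \<le> a" using k8 by (simp add: a_def)
        \<comment> \<open>With only two neighbours of degree \<open>k\<close>, Vizing's lemma
          excludes neighbours of degree below \<open>k - 1\<close>.\<close>
        have many: "cnt v k + cnt v (k - 1) = d v" if "cnt v k = 2"
        proof -
          have "N v = {u \<in> N v. d u = k} \<union> {u \<in> N v. d u = k - 1}"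
          proof (intro equalityI subsetI)
            fix u assume u: "u \<in> N v"
            have "d u = k \<or> d u = k - 1" using vizing_cnt(1)[OF u] that deg_le[of u] by linarith
            then show "u \<in> {u \<in> N v. d u = k} \<union> {u \<in> N v. d u = k - 1}" using u by blast
          qed auto
          also have "card \<dots> = cnt v k + cnt v (k - 1)"
            unfolding cnt_def by (rule card_Un_disjoint) (use k8 in auto)
          finally show ?thesis by (simp add: dg_def)
        qed
        have cle: "cnt v k \<le> d v" using low_cnt[of v] by simp
        have K: "8 \<le> real k" using k8 by simp
        have ca: "2 * a \<le> real (cnt v k) * a" using c2 a0 by (intro mult_right_mono) auto
        have cb: "0 \<le> real (cnt v (k - 1)) * b" using b0 by simp
        consider "d v = 2" | "d v = 3" | "d v = 4" | "d v = 5" using d2 False by linarith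
        then show ?thesis
        proof cases
          case 1 then show ?thesis using ca cb K by (simp add: a_def)
        next
          case 2
          show ?thesis
          proof (cases "cnt v k = 2")
            case True
            then have "cnt v (k - 1) = 1" using many 2 by simp
            then show ?thesis using True 2 K by (simp add: a_def b_def field_simps)
          next
            case False
            then have "cnt v k = 3" using c2 cle 2 by simp
            moreover have "1 \<le> a" using 2 K by (simp add: a_def)
            ultimately show ?thesis using cb 2 by simp
          qed
        next
          case 3
          show ?thesis
          proof (cases "cnt v k = 2")
            case True
            then have "cnt v (k - 1) = 2" using many 3 by simp
            then show ?thesis using True 3 K by (simp add: a_def b_def field_simps)
          next
            case False
            then have "3 * a \<le> real (cnt v k) * a" using c2 a0 by (intro mult_right_mono) auto
            then show ?thesis using cb 3 K by (simp add: a_def)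
          qed
        next
          case 4 then show ?thesis using ca cb K by (simp add: a_def)
        qed
      qed
      ultimately show ?thesis using out by linarith
    qed
  qed (simp_all add: matching_def)
qed

end

subsection \<open>Maximum degree seven: structure\<close>

locale sparse_critical7 = sparse_critical E 7 for E :: "'a set set"
begin

text \<open>An edge whose ends have degrees 3 and 6, or 4 and 5, is surrounded by vertices of degree 7
  only; its ends are called twins and are discharged separately.\<close>

definition twin :: "'a \<Rightarrow> bool" where
  "twin v \<longleftrightarrow> d v < 7 \<and> (\<exists>u\<in>N v. d u < 7 \<and> d u + d v = 9)"

definition sat :: "'a \<Rightarrow> bool" where
  "sat x \<longleftrightarrow> d x = 7 \<and> (\<exists>r\<in>N x. d r = 3 \<and> \<not> twin r)"

text \<open>Contracting an edge at such a vertex gains at most \<open>4 - 2 * 2 = 0\<close>. Its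
  deficit of 2 must come from its four neighbours, 1/2 from each.\<close>

definition tri4 :: "'a \<Rightarrow> bool" where
  "tri4 v \<longleftrightarrow> d v = 4 \<and> \<not> twin v \<and> (\<forall>g\<in>N v. 2 \<le> ntri E v g)"

definition small :: "'a \<Rightarrow> 'a set" where
  "small v = {u \<in> N v. d u \<le> 5}"

text \<open>A vertex \<open>x\<close> with \<open>sat x\<close> gives its whole charge to neighbours of degree 3. Its only other low
  neighbour, a hub, gets nothing from \<open>x\<close> but can be contracted into \<open>x\<close> along an edge in no triangle.\<close>

definition hub :: "'a \<Rightarrow> bool" where
  "hub z \<longleftrightarrow> \<not> twin z \<and> d z \<in> {4, 5, 6} \<and> (\<exists>x\<in>N z. sat x) \<and> (d z = 6 \<longrightarrow> small z \<noteq> {})"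

lemma d_le: "d v \<le> 7" by (rule deg_le)

lemma d_pos: "u \<in> N v \<Longrightarrow> 2 \<le> d v"
  using degree_ge_2 V_iff by blast

lemma sum9: "u \<in> N v \<Longrightarrow> 9 \<le> d v + d u"
  using degree_sum by force

lemma nontwin_sum: "\<not> twin v \<Longrightarrow> d v < 7 \<Longrightarrow> u \<in> N v \<Longrightarrow> d u < 7 \<Longrightarrow> 10 \<le> d v + d u"
  using sum9[of u v] unfolding twin_def by force

definition partner :: "'a \<Rightarrow> 'a \<Rightarrow> bool" where
  "partner v u \<longleftrightarrow> u \<in> N v \<and> d u < 7 \<and> d u + d v = 9 \<and> twin u \<and>
     (\<forall>w\<in>N v. w \<noteq> u \<longrightarrow> d w = 7 \<and> (\<forall>r\<in>N w. d r < 7 \<longrightarrow> r = u \<or> r = v))"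

lemma partnerD:
  assumes "partner v u"
  shows "u \<in> N v" "d u < 7" "d u + d v = 9" "twin u" "w \<in> N v \<Longrightarrow> w \<noteq> u \<Longrightarrow> d w = 7"
    "w \<in> N v \<Longrightarrow> d w = 7 \<Longrightarrow> r \<in> N w \<Longrightarrow> d r < 7 \<Longrightarrow> r = u \<or> r = v"
  using assms unfolding partner_def by auto

lemma twin_partner:
  assumes "twin v"
  obtains u where "partner v u"
proof -
  obtain u where u: "u \<in> N v" "d u < 7" "d u + d v = 9" and v: "d v < 7" using assms unfolding twin_def by blast
  have e: "{v, u} \<in> E" using u by (simp add: nb_def)
  have 1: "d w = 7" if "w \<in> N v" "w \<noteq> u" for w
    by (rule tight_edge_nbrs(1)[OF e _ v that]) (use u in simp)
  have 2: "d r = 7" if "w \<in> N v" "w \<noteq> u" "r \<in> N w" "r \<noteq> v" "r \<noteq> u" for w r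
    by (rule tight_edge_nbrs(2)[OF e _ v that]) (use u in simp)
  have "twin u" unfolding twin_def using u v N_sym[OF u(1)] by (auto simp: add.commute)
  moreover have "r = u \<or> r = v" if "w \<in> N v" "w \<noteq> u" "r \<in> N w" "d r < 7" for w r
    using 2[OF that(1-3)] that(4) by fastforce
  ultimately have "partner v u" unfolding partner_def using u 1 by blast
  then show ?thesis by (rule that)
qed

lemma twin_big_nbrs:
  assumes v: "twin v" and x: "x \<in> N v" "d x = 7" and z: "z \<in> N x" "d z < 7"
  shows "twin z"
proof -
  obtain u where u: "partner v u" using twin_partner[OF v] .
  then show ?thesis using partnerD(4,6)[OF u] x z v by blast
qed

lemma twin_low2:
  assumes v: "twin v" and x: "x \<in> N v" "d x = 7"
  shows "low x \<le> 2"
proof -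
  obtain u where u: "partner v u" using twin_partner[OF v] .
  have "{r \<in> N x. d r < 7} \<subseteq> {u, v}" using partnerD(6)[OF u x] by blast
  then have "low x \<le> card {u, v}" unfolding low_def by (rule card_mono[rotated]) simp
  also have "\<dots> \<le> 2" by (simp add: card_insert_if)
  finally show ?thesis .
qed

lemma nontwin_mid_nbr: "\<not> twin v \<Longrightarrow> d v < 7 \<Longrightarrow> u \<in> N v \<Longrightarrow> d u < 7 \<Longrightarrow> \<not> twin u"
proof
  assume a: "\<not> twin v" "d v < 7" "u \<in> N v" "d u < 7" "twin u"
  obtain w where w: "partner u w" using twin_partner[OF a(5)] .
  have "v \<in> N u" by (rule N_sym[OF a(3)])
  then have "v = w" using partnerD(5)[OF w, of v] a(2) by auto
  then show False using partnerD(4)[OF w] a(1) by simp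
qed

lemma low_le_nbr: "x \<in> N v \<Longrightarrow> d x = 7 \<Longrightarrow> low x + 1 \<le> d v"
  using low_bound[of v x] N_sym[of x v] by simp

lemma card_mid:
  assumes "z \<in> N v" "d z < 7"
  shows "card {u \<in> N v. d u < 7} + 8 \<le> d v + d z"
  using low_bound[OF assms(1)] by (simp add: low_def)

lemma nontwin3_nbrs: "\<not> twin r \<Longrightarrow> d r = 3 \<Longrightarrow> u \<in> N r \<Longrightarrow> d u = 7"
  using nontwin_sum[of r u] d_le[of u] by fastforce

lemma sat_low_nbr_not_twin:
  assumes x: "sat x" and z: "z \<in> N x" "d z < 7"
  shows "\<not> twin z"
proof
  assume "twin z"
  obtain r where r: "r \<in> N x" "d r = 3" "\<not> twin r" and dx: "d x = 7" using x unfolding sat_def by blast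
  show False using twin_big_nbrs[OF \<open>twin z\<close> N_sym[OF z(1)] dx r(1)] r by simp
qed

lemma sat_low: "sat x \<Longrightarrow> low x \<le> 2"
proof -
  assume "sat x"
  then obtain r where r: "r \<in> N x" "d r = 3" "d x = 7" unfolding sat_def by blast
  show "low x \<le> 2" using low_le_nbr[OF N_sym[OF r(1)] r(3)] r(2) by simp
qed

lemma low_le1D:
  assumes "low x \<le> 1" "a \<in> N x" "d a < 7" "b \<in> N x" "d b < 7"
  shows "a = b"
proof (rule ccontr)
  assume "a \<noteq> b"
  then have "card {a, b} \<le> low x" unfolding low_def by (intro card_mono) (use assms in auto)
  then show False using assms \<open>a \<noteq> b\<close> by simp
qed

lemma low_le2D:
  assumes "low x \<le> 2" "a \<in> N x" "d a < 7" "b \<in> N x" "d b < 7" "c \<in> N x" "d c < 7"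
  shows "a = b \<or> a = c \<or> b = c"
proof (rule ccontr)
  assume "\<not> ?thesis"
  then have "card {a, b, c} = 3" by auto
  moreover have "card {a, b, c} \<le> low x" unfolding low_def by (intro card_mono) (use assms in auto)
  ultimately show False using assms by simp
qed

text \<open>The vertex \<open>x\<close> has at most two low neighbours, and one place is taken by a
  vertex of degree 3.\<close>

lemma sat_unique:
  assumes x: "sat x" and z: "z \<in> N x" "z' \<in> N x" "d z \<in> {4, 5, 6}" "d z' \<in> {4, 5, 6}"
  shows "z = z'"
proof -
  obtain r where r: "r \<in> N x" "d r = 3" using x unfolding sat_def by blast
  have "r = z \<or> r = z' \<or> z = z'"
    by (rule low_le2D[OF sat_low[OF x]]) (use r z in auto)
  then show ?thesis using r z by auto
qed

lemma sat_no_triangle: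
  assumes x: "sat x" and z: "z \<in> N x" "d z \<le> 5" "\<not> twin z" "s \<in> N x" "s \<in> N z"
    and r: "r \<in> N x" "d r = 3" "\<not> twin r" "z \<noteq> r"
  shows False
proof -
  have dx: "d x = 7" using x by (simp add: sat_def)
  have "s \<noteq> r"
  proof
    assume "s = r"
    then have "d z = 7" using nontwin3_nbrs[OF r(3,2)] N_sym z(5) by blast
    then show False using z by simp
  qed
  show False
    by (rule no_triangle_at_small[of x r z s]) (use r z dx \<open>s \<noteq> r\<close> in \<open>auto simp: nb_def\<close>)
qed

text \<open>Contracting \<open>{z, x}\<close> thus gains 4 if there are no conflicts. For degrees 4
  and 5 use \<open>no_triangle_at_small\<close> with a neighbour \<open>r\<close> of
  \<open>x\<close> of degree 3; for degree 6, a small neighbour \<open>v\<close> of \<open>z\<close>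
  completes the forbidden path \<open>r x z v\<close>.\<close>

lemma sat_ntri:
  assumes x: "sat x" and z: "z \<in> N x" "d z \<in> {4, 5, 6}" "d z = 6 \<Longrightarrow> small z \<noteq> {}"
  shows "ntri E z x = 0"
proof -
  obtain r where r: "r \<in> N x" "d r = 3" "\<not> twin r" and dx: "d x = 7" using x unfolding sat_def by blast
  have nt: "\<not> twin z" by (rule sat_low_nbr_not_twin[OF x z(1)]) (use z in auto)
  have zr: "z \<noteq> r" using r z by auto
  have nr: "r \<notin> N u" if "d u < 7" for u using nontwin3_nbrs[OF r(3,2)] N_sym[of r u] that by fastforce
  have "s \<notin> N x" if s: "s \<in> N z" for s
  proof
    assume sx: "s \<in> N x"
    show False
    proof (cases "d z \<le> 5")
      case True
      then show False using sat_no_triangle[OF x z(1) True nt sx s r zr] by simp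
    next
      case False
      then have d6: "d z = 6" using z by auto
      then obtain v where v: "v \<in> N z" "d v \<le> 5" using z(3) unfolding small_def by blast
      have vr: "v \<noteq> r" using nr[of z] v d6 by auto
      have sr: "s \<noteq> r" using nr[of z] s d6 by auto
      have nv: "\<not> twin v" using nontwin_mid_nbr[OF nt _ v(1)] v d6 by simp
      have "v \<noteq> s"
      proof
        assume "v = s"
        then show False using sat_no_triangle[OF x sx _ _ z(1) _ r sr] v nv N_sym[OF s] by simp
      qed
      show False
        by (rule path_impossible[of x r z v s])
          (use r z v s sx vr sr zr dx d6 \<open>v \<noteq> s\<close> N_sym in \<open>auto simp: nb_def insert_commute\<close>)
    qed
  qed
  then have "N z \<inter> N x = {}" by blast
  then show ?thesis by (simp add: ntri_def)
qed

lemma ntri_le1I: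
  assumes "\<And>s. s \<in> N z \<Longrightarrow> s \<in> N g \<Longrightarrow> s = y"
  shows "ntri E z g \<le> 1"
proof -
  have "N z \<inter> N g \<subseteq> {y}" using assms by blast
  then have "card (N z \<inter> N g) \<le> card {y}" by (rule card_mono[rotated]) simp
  then show ?thesis by (simp add: ntri_def)
qed

text \<open>This is \<open>two_triangles_at_small\<close> with degree sum \<open>7 + 4\<close>. It
  makes the share 1/2 affordable: a vertex with \<open>tri4\<close> never competes with another
  vertex of degree 4.\<close>

lemma tri4_other4:
  assumes t: "tri4 t" and x: "x \<in> N t" "d x = 7" and z: "z \<in> N x" "d z = 4" "z \<noteq> t"
  shows False
proof -
  have d4: "d t = 4" and n2: "2 \<le> card (N t \<inter> N x)" using t x unfolding tri4_def ntri_def by auto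
  obtain a b where ab: "a \<in> N t \<inter> N x" "b \<in> N t \<inter> N x" "a \<noteq> b" using two_elements[OF n2] .
  have "s \<noteq> z" if "s \<in> N t" for s using sum9[OF that] d4 z by auto
  then show False
    using two_triangles_at_small[of x z t a b] ab z d4 x N_sym[OF x(1)] by (auto simp: nb_def)
qed

lemma tri4_other4_six:
  assumes t: "tri4 t" and x: "x \<in> N t" "d x = 6" and z: "z \<in> N x" "d z = 4" "z \<noteq> t"
  shows False
proof -
  have d4: "d t = 4" and n2: "2 \<le> card (N t \<inter> N x)" using t x unfolding tri4_def ntri_def by auto
  obtain a b where ab: "a \<in> N t \<inter> N x" "b \<in> N t \<inter> N x" "a \<noteq> b" using two_elements[OF n2] .
  have "a \<noteq> z" using sum9[of a t] ab d4 z by auto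
  then show False
    using no_triangle_at_small[of x z t a] ab z d4 x N_sym[OF x(1)] by (auto simp: nb_def)
qed

lemma sat_no_tri4: "sat x \<Longrightarrow> u \<in> N x \<Longrightarrow> \<not> tri4 u"
proof
  assume x: "sat x" and u: "u \<in> N x" and t: "tri4 u"
  have "ntri E u x = 0" by (rule sat_ntri[OF x u]) (use t in \<open>auto simp: tri4_def\<close>)
  then show False using t N_sym[OF u] unfolding tri4_def by force
qed

lemma not_hub_not_sat: "\<not> twin v \<Longrightarrow> d v \<in> {4, 5} \<Longrightarrow> \<not> hub v \<Longrightarrow> x \<in> N v \<Longrightarrow> \<not> sat x"
  unfolding hub_def by auto

text \<open>The vertices of degree 2 and those with \<open>need3\<close>, \<open>need4\<close> or \<open>need5\<close> are not satisfied by
  their neighbours; each has a candidate edge, in at most one triangle, whose contraction can pay.\<close>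

definition need3 :: "'a \<Rightarrow> bool" where
  "need3 v \<longleftrightarrow> d v = 3 \<and> \<not> twin v \<and> (\<exists>x\<in>N v. 2 \<le> cnt x 3)"

definition need4 :: "'a \<Rightarrow> bool" where
  "need4 v \<longleftrightarrow> d v = 4 \<and> \<not> twin v \<and> \<not> hub v \<and> \<not> tri4 v \<and> (\<forall>u\<in>N v. \<not> hub u)"

text \<open>For a vertex of degree 5 with exactly three neighbours of degree 7, hence an income of
  3/4, such a neighbour is too poor to complete the unit: it sends nothing, or 1/5, unless it is a
  hub.\<close>

definition mate5 :: "'a \<Rightarrow> bool" where
  "mate5 g \<longleftrightarrow> d g = 5 \<or> d g = 6 \<and> 3 \<le> card (small g)"

definition need5 :: "'a \<Rightarrow> bool" where
  "need5 v \<longleftrightarrow> d v = 5 \<and> \<not> twin v \<and> \<not> hub v \<and> (\<forall>u\<in>N v. \<not> hub u) \<and>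
     (\<exists>y\<in>N v. d y = 5 \<and> (\<exists>y'\<in>N v. y' \<noteq> y \<and> mate5 y'))"

definition need :: "'a \<Rightarrow> bool" where
  "need v \<longleftrightarrow> d v = 2 \<or> need3 v \<or> need4 v \<or> need5 v"

text \<open>The bound on triangles ensures a gain of at least 2 in the absence of conflicts. The
  conditions on \<open>g\<close> for degrees 3 and 5 keep the number of clashing candidates
  small.\<close>

definition cand :: "('a \<times> 'a) set" where
  "cand = {(v, g). g \<in> N v \<and> ntri E v g \<le> 1 \<and>
     (d v = 2 \<or> need3 v \<and> 2 \<le> cnt g 3 \<or> need4 v \<or> need5 v \<and> mate5 g)}"

lemma need_not_hub: "need v \<Longrightarrow> \<not> hub v"
  unfolding need_def need3_def need4_def need5_def hub_def by auto

lemma need_by_degree: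
  assumes "need v"
  shows "d v = 3 \<Longrightarrow> need3 v" "d v = 4 \<Longrightarrow> need4 v" "d v = 5 \<Longrightarrow> need5 v" "d v \<in> {2, 3, 4, 5}"
  using assms unfolding need_def need3_def need4_def need5_def by auto

lemma need_nbr_not_hub: "need4 v \<or> need5 v \<Longrightarrow> u \<in> N v \<Longrightarrow> \<not> hub u"
  unfolding need4_def need5_def by blast

lemma need_nbr_not_sat:
  assumes v: "need4 v \<or> need5 v" and u: "u \<in> N v"
  shows "\<not> sat u"
  by (rule not_hub_not_sat[OF _ _ _ u]) (use v in \<open>auto simp: need4_def need5_def\<close>)

lemma two_nbrs:
  assumes "d v = 2" "x \<in> N v"
  shows "d x = 7" "low x \<le> 1"
proof -
  show "d x = 7" using sum9[OF assms(2)] assms(1) d_le[of x] by simp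
  then show "low x \<le> 1" using low_le_nbr[OF assms(2)] assms(1) by simp
qed

lemma cnt3_sat:
  assumes x: "x \<in> N r" "d r = 3" "\<not> twin r" and c: "2 \<le> cnt x 3" and z: "z \<in> N x" "d z < 7"
  shows "d z = 3"
proof (rule ccontr)
  assume z3: "d z \<noteq> 3"
  have dx: "d x = 7" by (rule nontwin3_nbrs[OF x(3,2,1)])
  then have "low x \<le> 2" using low_le_nbr[OF x(1) dx] x(2) by simp
  moreover have "insert z {u \<in> N x. d u = 3} \<subseteq> {u \<in> N x. d u < 7}" using z by auto
  then have "card (insert z {u \<in> N x. d u = 3}) \<le> low x" unfolding low_def by (rule card_mono[rotated]) simp
  moreover have "card (insert z {u \<in> N x. d u = 3}) = Suc (cnt x 3)" using z3 by (simp add: cnt_def)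
  ultimately show False using c by simp
qed

text \<open>Two neighbours of degree 3 of the same vertex take the roles of \<open>y\<close> and
  \<open>z\<close> in \<open>no_triangle_at_small\<close>.\<close>

lemma two_threes_ntri:
  assumes x: "x \<in> N v" and v: "d v = 3" "\<not> twin v" and c: "2 \<le> cnt x 3"
  shows "ntri E v x = 0"
proof -
  have dx: "d x = 7" by (rule nontwin3_nbrs[OF v(2,1) x])
  have "\<not> card {u \<in> N x. d u = 3} \<le> card {v}" using c by (simp add: cnt_def)
  then have "\<not> {u \<in> N x. d u = 3} \<subseteq> {v}" using card_mono[of "{v}" "{u \<in> N x. d u = 3}"] by blast
  then obtain r where r: "r \<in> N x" "d r = 3" "r \<noteq> v" by blast
  have "s \<notin> N x" if s: "s \<in> N v" for s
  proof
    assume sx: "s \<in> N x"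
    have "s \<noteq> r" using sum9[OF s] r v by auto
    then show False
      using no_triangle_at_small[of x r v s] r sx s v dx N_sym[OF x] by (auto simp: nb_def)
  qed
  then have "N v \<inter> N x = {}" by blast
  then show ?thesis by (simp add: ntri_def)
qed

text \<open>A vertex of degree 2 has only one further neighbour to form a triangle. For degree 5 the
  only possible triangle on \<open>{v, y'}\<close> goes through \<open>y\<close>, by
  \<open>no_triangle_at_small\<close> or, if \<open>d y' = 6\<close>, by
  \<open>small_nbrs_of_triangle\<close>.\<close>

lemma need_cand: "need v \<Longrightarrow> v \<in> \<Union>E \<Longrightarrow> \<exists>g. (v, g) \<in> cand"
proof -
  assume v: "need v" "v \<in> \<Union>E"
  consider "d v = 2" | "need3 v" | "need4 v" | "need5 v" using v(1) unfolding need_def by blast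
  then show ?thesis
  proof cases
    case 1
    obtain g where g: "g \<in> N v" using v(2) V_iff by blast
    have "N v \<inter> N g \<subseteq> N v - {g}" by auto
    then have "card (N v \<inter> N g) \<le> card (N v - {g})" by (rule card_mono[rotated]) simp
    also have "\<dots> = 1" using g 1 by (simp add: dg_def)
    finally show ?thesis using 1 g by (auto simp: cand_def ntri_def)
  next
    case 2
    then obtain x where x: "x \<in> N v" "2 \<le> cnt x 3" and v3: "d v = 3" "\<not> twin v" unfolding need3_def by blast
    have "ntri E v x = 0" by (rule two_threes_ntri[OF x(1) v3 x(2)])
    then show ?thesis using 2 x by (auto simp: cand_def)
  next
    case 3
    then obtain g where "g \<in> N v" "\<not> 2 \<le> ntri E v g" unfolding need4_def tri4_def by blast
    then show ?thesis using 3 by (auto simp: cand_def)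
  next
    case 4
    then obtain y y' where y: "y \<in> N v" "d y = 5" "y' \<in> N v" "y' \<noteq> y" "mate5 y'" and v5: "d v = 5"
      unfolding need5_def by blast
    have "ntri E v y' \<le> 1"
    proof (rule ntri_le1I)
      fix s assume s: "s \<in> N v" "s \<in> N y'"
      show "s = y"
      proof (rule ccontr)
        assume sy: "s \<noteq> y"
        show False
        proof (cases "d y' = 5")
          case True
          then show False
            using no_triangle_at_small[of v y y' s] y v5 s sy by (auto simp: nb_def)
        next
          case False
          then have d6: "d y' = 6" and c3: "3 \<le> card (small y')" using y(5) unfolding mate5_def by auto
          have "\<not> card (small y') \<le> card {v, y}" using c3 by (simp add: card_insert_if)
          then have "\<not> small y' \<subseteq> {v, y}" using card_mono[of "{v, y}" "small y'"] by blast
          then obtain t where t: "t \<in> N y'" "d t \<le> 5" "t \<noteq> v" "t \<noteq> y" unfolding small_def by blast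
          show False
            using small_nbrs_of_triangle[of v y y' s t] y v5 s sy d6 t by (auto simp: nb_def)
        qed
      qed
    qed
    then show ?thesis using 4 y by (auto simp: cand_def)
  qed
qed

section \<open>Clashes between contracted edges\<close>

definition clash :: "'a \<times> 'a \<Rightarrow> 'a \<times> 'a \<Rightarrow> bool" where
  "clash p q \<longleftrightarrow> {fst p, snd p} \<inter> {fst q, snd q} \<noteq> {} \<or> confl E p q"

lemma clash_sym: "clash p q \<longleftrightarrow> clash q p"
  using confl_sym[of E p q] by (auto simp: clash_def)

lemma clashD:
  assumes c: "clash (s, g) (s', g')" and g: "g \<in> N s" "g' \<in> N s'"
  shows "s = s' \<or> s' \<in> N s \<or> s \<in> N g' \<and> s' \<in> N g"
proof -
  note sy = N_sym[OF g(1)] N_sym[OF g(2)]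
  have "s = s' \<or> s = g' \<or> g = s' \<or> g = g' \<or> s' \<in> N s \<or> g' \<in> N s \<and> s' \<in> N g"
    using c unfolding clash_def confl_def nb_def by auto
  then show ?thesis
  proof (elim disjE conjE)
    assume "g' \<in> N s" "s' \<in> N g"
    then show ?thesis using N_sym[of g' s] by blast
  qed (use g sy in auto)
qed

definition csat :: "('a \<times> 'a) set" where
  "csat = {(z, x). hub z \<and> x \<in> N z \<and> sat x}"

lemma cand_low: "(s, g) \<in> cand \<Longrightarrow> d s < 7" "(s, g) \<in> cand \<Longrightarrow> g \<in> N s" "(s, g) \<in> cand \<Longrightarrow> need s"
  unfolding cand_def need_def need3_def need4_def need5_def by auto

lemma cand_five: "(s, g) \<in> cand \<Longrightarrow> d s = 5 \<Longrightarrow> mate5 g"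
  unfolding cand_def need3_def need4_def by auto

lemma clash_cand:
  assumes p: "(s, g) \<in> cand" and q: "g' \<in> N s'" "d s' < 7" and c: "clash (s, g) (s', g')"
  shows "d s = 2 \<Longrightarrow> s' = s" and "d s = 3 \<Longrightarrow> s' \<in> N g \<and> d s' = 3"
proof -
  note cl = clashD[OF c cand_low(2)[OF p] q(1)]
  have gs: "g \<in> N s" by (rule cand_low(2)[OF p])
  show "s' = s" if "d s = 2"
    using cl two_nbrs[OF that] q(2) low_le1D[of g s' s] N_sym[OF gs] gs cand_low(1)[OF p] by fastforce
  assume 3: "d s = 3"
  then have n3: "need3 s" "2 \<le> cnt g 3" using p unfolding cand_def need4_def need5_def by auto
  then have nt: "\<not> twin s" unfolding need3_def by blast
  have "s' \<notin> N s" using nontwin3_nbrs[OF nt 3] q(2) by force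
  then have "s' \<in> N g" using cl N_sym[OF gs] by blast
  then show "s' \<in> N g \<and> d s' = 3" using cnt3_sat[OF gs 3 nt n3(2)] q(2) by blast
qed

text \<open>A hub has degree 4 to 6, so \<open>clash_cand\<close> settles candidates at degrees 2
  and 3; \<open>need4\<close> and \<open>need5\<close> keep away from hubs and from vertices with
  \<open>sat\<close>. Hub edges and candidates can therefore be contracted together.\<close>

lemma clash_cand_csat:
  assumes p: "(s, g) \<in> cand" and q: "(s', g') \<in> csat" and c: "clash (s, g) (s', g')"
  shows False
proof -
  have s': "hub s'" "g' \<in> N s'" "sat g'" "d s' \<in> {4, 5, 6}" using q unfolding csat_def hub_def by auto
  have d': "d s' < 7" using s' by auto
  note cl = clashD[OF c cand_low(2)[OF p] s'(2)]
  have nd: "need s" by (rule cand_low(3)[OF p])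
  have "d s \<noteq> 2" using clash_cand(1)[OF p s'(2) d' c] s' by auto
  moreover have "d s \<noteq> 3" using clash_cand(2)[OF p s'(2) d' c] s' by auto
  ultimately have n: "need4 s \<or> need5 s" using need_by_degree[OF nd] by auto
  show False
    using cl need_not_hub[OF nd] s' need_nbr_not_hub[OF n, of s'] need_nbr_not_sat[OF n, of g'] N_sym[of s g'] by blast
qed

text \<open>As \<open>s\<close> has no neighbour of degree 5, \<open>g'\<close> would be a neighbour
  of \<open>s\<close> of degree 6 with three small neighbours, but next to a vertex of degree 4 it
  has at most two low ones.\<close>

lemma need4_five_clash:
  assumes p: "(s, g) \<in> cand" "d s = 4" and q: "(s', g') \<in> cand" "d s' = 5" and c: "clash (s, g) (s', g')"
  shows False
proof -
  note cl = clashD[OF c cand_low(2)[OF p(1)] cand_low(2)[OF q(1)]]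
  have n4: "need4 s" by (rule need_by_degree(2)[OF cand_low(3)[OF p(1)] p(2)])
  have n5: "need5 s'" "mate5 g'" by (rule need_by_degree(3)[OF cand_low(3)[OF q(1)] q(2)]) (rule cand_five[OF q])
  have nt: "\<not> twin s" using n4 unfolding need4_def by blast
  have five: "d u \<noteq> 5" if "u \<in> N s" for u using nontwin_sum[OF nt _ that] p(2) by auto
  have "s' \<notin> N s" using five q(2) by blast
  then have sg: "s \<in> N g'" using cl p(2) q(2) by auto
  then have "g' \<in> N s" by (rule N_sym)
  then have 6: "d g' = 6" "3 \<le> card (small g')" using n5(2) five unfolding mate5_def by auto
  have "small g' \<subseteq> {u \<in> N g'. d u < 7}" unfolding small_def by auto
  then have "card (small g') \<le> card {u \<in> N g'. d u < 7}" by (rule card_mono[rotated]) simp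
  then show False using card_mid[OF sg] 6 p(2) by simp
qed

text \<open>All vertices paid by one chosen candidate thus have the same degree and receive the same
  amount.\<close>

lemma clash_same_degree:
  assumes p: "(s, g) \<in> cand" and q: "(s', g') \<in> cand" and c: "clash (s, g) (s', g')"
  shows "d s = d s'"
proof -
  note c' = c[unfolded clash_sym[of "(s, g)"]]
  note dp = need_by_degree(4)[OF cand_low(3)[OF p]] and dq = need_by_degree(4)[OF cand_low(3)[OF q]]
  note 1 = clash_cand[OF p cand_low(2,1)[OF q] c] and 2 = clash_cand[OF q cand_low(2,1)[OF p] c']
  have "\<not> (d s = 4 \<and> d s' = 5)" "\<not> (d s = 5 \<and> d s' = 4)"
    using need4_five_clash[OF p _ q _ c] need4_five_clash[OF q _ p _ c'] by blast+
  moreover have "d s' = 2" if "d s = 2" using 1(1)[OF that] that by simp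
  moreover have "d s' = 3" if "d s = 3" using 1(2)[OF that] by simp
  moreover have "d s = 2" if "d s' = 2" using 2(1)[OF that] that by simp
  moreover have "d s = 3" if "d s' = 3" using 2(2)[OF that] by simp
  ultimately show ?thesis using dp dq by (elim insertE emptyE) simp_all
qed

end

context sparse_critical7
begin

subsection \<open>Maximum degree seven: gains of contractions\<close>

text \<open>The charge that a vertex receives from the contractions: a hub is charged for the conflicts with
  neighbouring hubs, the other contractions are chosen free of conflicts.\<close>

definition extra :: "'a \<Rightarrow> real" where
  "extra v = (if hub v then 4 - real (card {u \<in> N v. hub u}) else if d v = 2 then 2 else
     if need3 v then 3 / 2 else if need4 v then 2 / 3 else if need5 v then 1 / 4 else 0)"

lemma finite_cand: "finite cand"
proof (rule finite_subset)
  have *: "s \<in> \<Union>E \<and> g \<in> \<Union>E" if p: "(s, g) \<in> cand" for s g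
  proof -
    have g: "g \<in> N s" by (rule cand_low(2)[OF p])
    show ?thesis using subsetD[OF N_sub_V g] subsetD[OF N_sub_V N_sym[OF g]] by blast
  qed
  show "cand \<subseteq> \<Union>E \<times> \<Union>E" by (rule subrelI) (simp only: mem_Times_iff fst_conv snd_conv *)
  show "finite (\<Union>E \<times> \<Union>E)" using finite_V by blast
qed

lemma maximal_candidates:
  "\<exists>M\<subseteq>cand. (\<forall>p\<in>M. \<forall>q\<in>M. p \<noteq> q \<longrightarrow> \<not> clash p q) \<and> (\<forall>p\<in>cand. \<exists>q\<in>M. p = q \<or> clash p q)"
proof -
  define A where "A = {M. M \<subseteq> cand \<and> (\<forall>p\<in>M. \<forall>q\<in>M. p \<noteq> q \<longrightarrow> \<not> clash p q)}"
  have "finite A" by (rule finite_subset[of _ "Pow cand"]) (auto simp: A_def finite_cand)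
  moreover have "{} \<in> A" by (simp add: A_def)
  ultimately obtain M where M: "M \<in> A" "\<And>M'. M' \<in> A \<Longrightarrow> M \<subseteq> M' \<Longrightarrow> M = M'"
    using finite_has_maximal[of A] by blast
  have "\<exists>q\<in>M. p = q \<or> clash p q" if p: "p \<in> cand" for p
  proof (rule ccontr)
    assume n: "\<not> ?thesis"
    then have "\<not> clash p q" "\<not> clash q p" if "q \<in> M" for q using that clash_sym[of p q] by auto
    then have "insert p M \<in> A" using M(1) p unfolding A_def by auto
    then have "M = insert p M" using M(2) by blast
    then show False using n by blast
  qed
  then show ?thesis using M(1) unfolding A_def by blast
qed

lemma extra_cand:
  assumes p: "(v, g) \<in> cand"
  shows "d v = 2 \<Longrightarrow> extra v = 2" "d v = 3 \<Longrightarrow> extra v = 3 / 2" "d v = 4 \<Longrightarrow> extra v = 2 / 3" "d v = 5 \<Longrightarrow> extra v = 1 / 4"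
proof -
  have n: "need v" and h: "\<not> hub v" using cand_low(3)[OF p] need_not_hub by auto
  show "d v = 2 \<Longrightarrow> extra v = 2" "d v = 3 \<Longrightarrow> extra v = 3 / 2" "d v = 4 \<Longrightarrow> extra v = 2 / 3" "d v = 5 \<Longrightarrow> extra v = 1 / 4"
    using h need_by_degree[OF n] by (auto simp: extra_def need3_def need4_def)
qed

text \<open>The number of vertices competing for \<open>(s, g)\<close> fixes the amounts in
  \<open>extra\<close>: only \<open>s\<close> itself for degree 2, two neighbours of
  \<open>g\<close> for degree 3 (where the gain is 4), three neighbours of \<open>g\<close> for
  degree 4, and \<open>1 + 3 + 3\<close> around \<open>s\<close> and \<open>g\<close> for degree
  5.\<close>

lemma fibre_bound:
  assumes q: "(s, g) \<in> cand" and X: "finite X" "\<And>v. v \<in> X \<Longrightarrow> \<exists>gv. (v, gv) \<in> cand \<and> clash (v, gv) (s, g)"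
  shows "(\<Sum>v\<in>X. extra v) \<le> 4 - 2 * real (ntri E s g)"
proof -
  have gs: "g \<in> N s" and sg: "s \<in> N g" using cand_low(2)[OF q] N_sym by auto
  have t1: "ntri E s g \<le> 1" using q unfolding cand_def by auto
  have dX: "d v = d s" if "v \<in> X" for v using X(2)[OF that] clash_same_degree[OF _ q] by blast
  have eX: "extra v = (if d s = 2 then 2 else if d s = 3 then 3 / 2 else if d s = 4 then 2 / 3 else 1 / 4)" if v: "v \<in> X" for v
  proof -
    obtain gv where gv: "(v, gv) \<in> cand" using X(2)[OF v] by blast
    show ?thesis using extra_cand[OF gv] need_by_degree(4)[OF cand_low(3)[OF gv]] dX[OF v] by auto
  qed
  have bound: "(\<Sum>v\<in>X. extra v) \<le> real n * c" if "X \<subseteq> Y" "finite Y" "card Y \<le> n" "\<And>v. v \<in> X \<Longrightarrow> extra v = c" "0 \<le> c" for Y n c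
  proof -
    have "(\<Sum>v\<in>X. extra v) = real (card X) * c" using that(4) by simp
    also have "\<dots> \<le> real n * c" using card_mono[OF that(2,1)] that(3,5) by (intro mult_right_mono) auto
    finally show ?thesis .
  qed
  have low_g: "low g + 8 \<le> d g + d s" using low_bound[OF sg] by simp
  have Y: "card {u \<in> N w. d u = i} \<le> low w" if "i < 7" for w i
    unfolding low_def by (rule card_mono) (use that in auto)
  consider "d s = 2" | "d s = 3" | "d s = 4" | "d s = 5" using need_by_degree(4)[OF cand_low(3)[OF q]] by blast
  then show ?thesis
  proof cases
    case 1
    have "X \<subseteq> {s}"
    proof
      fix v assume v: "v \<in> X"
      obtain gv where gv: "(v, gv) \<in> cand" "clash (v, gv) (s, g)" using X(2)[OF v] by blast
      show "v \<in> {s}" using clash_cand(1)[OF gv(1) gs cand_low(1)[OF q] gv(2)] dX[OF v] 1 by simp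
    qed
    then have "(\<Sum>v\<in>X. extra v) \<le> real 1 * 2"
      by (rule bound) (use eX 1 in auto)
    then show ?thesis using t1 by simp
  next
    case 2
    have "X \<subseteq> {u \<in> N g. d u = 3}"
    proof
      fix v assume v: "v \<in> X"
      obtain gv where gv: "(v, gv) \<in> cand" "clash (v, gv) (s, g)" using X(2)[OF v] by blast
      have "clash (s, g) (v, gv)" using gv(2) clash_sym[of "(v, gv)" "(s, g)"] by blast
      then show "v \<in> {u \<in> N g. d u = 3}" using clash_cand(2)[OF q cand_low(2,1)[OF gv(1)] _ 2] by simp
    qed
    moreover have n3: "need3 s" "2 \<le> cnt g 3" using q 2 unfolding cand_def need4_def need5_def by auto
    then have nt: "\<not> twin s" unfolding need3_def by blast
    have "card {u \<in> N g. d u = 3} \<le> 2"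
      using Y[of 3 g] low_g 2 nontwin3_nbrs[OF nt 2 gs] by simp
    ultimately have "(\<Sum>v\<in>X. extra v) \<le> real 2 * (3 / 2)"
      by (intro bound) (use eX 2 in auto)
    then show ?thesis using two_threes_ntri[OF gs 2 nt n3(2)] by simp
  next
    case 3
    have "X \<subseteq> {u \<in> N g. d u = 4}"
    proof
      fix v assume v: "v \<in> X"
      obtain gv where gv: "(v, gv) \<in> cand" "clash (v, gv) (s, g)" using X(2)[OF v] by blast
      have "s \<notin> N v" using sum9[of s v] dX[OF v] 3 by auto
      then show "v \<in> {u \<in> N g. d u = 4}" using clashD[OF gv(2) cand_low(2)[OF gv(1)] gs] dX[OF v] 3 sg by auto
    qed
    moreover have "card {u \<in> N g. d u = 4} \<le> 3" using Y[of 4 g] low_g 3 d_le[of g] by simp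
    ultimately have "(\<Sum>v\<in>X. extra v) \<le> real 3 * (2 / 3)"
      by (intro bound) (use eX 3 in auto)
    then show ?thesis using t1 by simp
  next
    case 4
    have "d g \<le> 6" using cand_five[OF q 4] unfolding mate5_def by auto
    then have l: "low g \<le> 3" "low s \<le> 3" using low_g 4 low_bound[OF gs] by auto
    let ?Y = "insert s ({u \<in> N s. d u = 5} \<union> {u \<in> N g. d u = 5})"
    have "X \<subseteq> ?Y"
    proof
      fix v assume v: "v \<in> X"
      obtain gv where gv: "(v, gv) \<in> cand" "clash (v, gv) (s, g)" using X(2)[OF v] by blast
      show "v \<in> ?Y" using clashD[OF gv(2) cand_low(2)[OF gv(1)] gs] dX[OF v] 4 N_sym[of s v] by auto
    qed
    moreover have "card ?Y \<le> 7"
    proof -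
      have "card ?Y \<le> Suc (card ({u \<in> N s. d u = 5} \<union> {u \<in> N g. d u = 5}))" by (simp add: card_insert_if)
      also have "\<dots> \<le> Suc (card {u \<in> N s. d u = 5} + card {u \<in> N g. d u = 5})" using card_Un_le by simp
      finally show ?thesis using Y[of 5 s] Y[of 5 g] l by simp
    qed
    ultimately have "(\<Sum>v\<in>X. extra v) \<le> real 7 * (1 / 4)"
      by (intro bound) (use eX 4 in auto)
    then show ?thesis using t1 by simp
  qed
qed

text \<open>A maximal clash-free set of candidates is contracted together with one edge for each
  hub. Hubs draw on their own edges; each needy vertex draws on a chosen candidate that equals or
  clashes with its own.\<close>

lemma extra_bound:
  obtains M where "finite M" "matching E M" "(\<Sum>v\<in>\<Union>E. extra v) \<le> real_of_int (\<Sum>p\<in>M. gain E M p)"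
proof -
  obtain Mx where Mx0: "Mx \<subseteq> cand" "\<forall>p\<in>Mx. \<forall>q\<in>Mx. p \<noteq> q \<longrightarrow> \<not> clash p q"
    "\<forall>p\<in>cand. \<exists>q\<in>Mx. p = q \<or> clash p q" using maximal_candidates by blast
  note Mx = Mx0(1) Mx0(2)[rule_format] Mx0(3)[rule_format]
  have fMx: "finite Mx" by (rule finite_subset[OF Mx(1) finite_cand])
  define xs where "xs z = (SOME x. x \<in> N z \<and> sat x)" for z
  have xs: "xs z \<in> N z \<and> sat (xs z)" if "hub z" for z
    unfolding xs_def by (rule someI_ex) (use that in \<open>auto simp: hub_def\<close>)
  define H where "H = {z \<in> \<Union>E. hub z}"
  define Mh where "Mh = (\<lambda>z. (z, xs z)) ` H"
  have fH: "finite H" unfolding H_def by (rule finite_subset[OF _ finite_V]) blast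
  have fMh: "finite Mh" unfolding Mh_def using fH by simp
  have hubd: "d z \<in> {4, 5, 6}" if "hub z" for z using that unfolding hub_def by blast
  have Mh_csat: "Mh \<subseteq> csat" unfolding Mh_def csat_def H_def using xs by auto
  have x_clash: "\<not> clash p q" if "p \<in> Mx" "q \<in> Mh" for p q
    using clash_cand_csat[of "fst p" "snd p" "fst q" "snd q"] that Mx(1) Mh_csat by auto
  have h_unique: "z = z'" if "hub z" "hub z'" "z \<in> N (xs z')" for z z'
    by (rule sat_unique[of "xs z'"]) (use that xs[of z'] hubd N_sym in auto)
  have h_clash: "z' \<in> N z" if h: "hub z" "hub z'" "z \<noteq> z'" and c: "clash (z, xs z) (z', xs z')" for z z'
    using clashD[OF c] xs h h_unique by blast
  have h_disj: "{z, xs z} \<inter> {z', xs z'} = {}" if h: "hub z" "hub z'" "z \<noteq> z'" for z z'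
  proof -
    have d7: "d (xs z) = 7" "d (xs z') = 7" using xs h by (auto simp: sat_def)
    then have "z \<noteq> xs z'" "z' \<noteq> xs z" using hubd[OF h(1)] hubd[OF h(2)] by auto
    moreover have "xs z \<noteq> xs z'" using h_unique[OF h(1,2)] h(3) xs[OF h(1)] N_sym[of "xs z" z] by auto
    ultimately show ?thesis using h(3) by auto
  qed
  define M where "M = Mx \<union> Mh"
  have fM: "finite M" unfolding M_def using fMx fMh by simp
  have disj: "Mx \<inter> Mh = {}"
  proof -
    have "clash p p" for p by (simp add: clash_def)
    then show ?thesis using x_clash by blast
  qed
  have mat: "matching E M"
    unfolding matching_def
  proof (intro conjI ballI impI)
    fix p assume "p \<in> M"
    then have "snd p \<in> N (fst p)" unfolding M_def
      using cand_low(2)[of "fst p" "snd p"] Mx(1) Mh_csat by (auto simp: csat_def)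
    then show "{fst p, snd p} \<in> E" by (simp add: nb_def)
  next
    fix p q assume pq: "p \<in> M" "q \<in> M" "p \<noteq> q"
    show "{fst p, snd p} \<inter> {fst q, snd q} = {}"
    proof (cases "p \<in> Mh \<and> q \<in> Mh")
      case True
      then obtain z z' where z: "p = (z, xs z)" "q = (z', xs z')" "hub z" "hub z'" unfolding Mh_def H_def by blast
      then show ?thesis using h_disj[of z z'] pq(3) by auto
    next
      case False
      then have "\<not> clash p q" using pq Mx(2) x_clash x_clash[of q p] clash_sym[of p q] unfolding M_def by blast
      then show ?thesis unfolding clash_def by blast
    qed
  qed
  have gain_x: "gain E M p = 4 - 2 * int (ntri E (fst p) (snd p))" if p: "p \<in> Mx" for p
  proof -
    have "\<not> confl E p q" if "q \<in> M - {p}" for q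
      using Mx(2)[OF p, of q] x_clash[OF p, of q] that unfolding M_def clash_def by blast
    then have e: "{q \<in> M - {p}. confl E p q} = {}" by blast
    show ?thesis unfolding gain_def e by simp
  qed
  have gain_h: "4 - int (card {u \<in> N z. hub u}) \<le> gain E M (z, xs z)" if z: "z \<in> H" for z
  proof -
    have hz: "hub z" using z by (simp add: H_def)
    \<comment> \<open>A conflict is a clash, so it is with another hub edge, and two hub edges clash
      only if the hubs are adjacent.\<close>
    have "{q \<in> M - {(z, xs z)}. confl E (z, xs z) q} \<subseteq> (\<lambda>u. (u, xs u)) ` {u \<in> N z. hub u}"
    proof
      fix q assume q: "q \<in> {q \<in> M - {(z, xs z)}. confl E (z, xs z) q}"
      then have cl: "clash (z, xs z) q" by (simp add: clash_def)
      have "(z, xs z) \<in> Mh" using z unfolding Mh_def by blast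
      then have "q \<notin> Mx" using x_clash[of q "(z, xs z)"] cl clash_sym[of q "(z, xs z)"] by blast
      then obtain u where u: "q = (u, xs u)" "hub u" using q unfolding M_def Mh_def H_def by blast
      then have "u \<in> N z" using h_clash[OF hz u(2)] cl q by auto
      then show "q \<in> (\<lambda>u. (u, xs u)) ` {u \<in> N z. hub u}" using u by blast
    qed
    then have "card {q \<in> M - {(z, xs z)}. confl E (z, xs z) q} \<le> card ((\<lambda>u. (u, xs u)) ` {u \<in> N z. hub u})"
      by (rule card_mono[rotated]) simp
    also have "\<dots> \<le> card {u \<in> N z. hub u}" by (rule card_image_le) simp
    finally have "card {q \<in> M - {(z, xs z)}. confl E (z, xs z) q} \<le> card {u \<in> N z. hub u}" .
    moreover have "ntri E z (xs z) = 0"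
      by (rule sat_ntri) (use xs[OF hz] N_sym hz in \<open>auto simp: hub_def\<close>)
    ultimately show ?thesis by (simp add: gain_def)
  qed
  define D where "D = {v \<in> \<Union>E. need v}"
  have fD: "finite D" unfolding D_def by (rule finite_subset[OF _ finite_V]) blast
  have "\<exists>q. q \<in> Mx \<and> (\<exists>gv. (v, gv) \<in> cand \<and> clash (v, gv) q)" if v: "v \<in> D" for v
  proof -
    obtain g where g: "(v, g) \<in> cand" using need_cand v unfolding D_def by blast
    then obtain q where q: "q \<in> Mx" "(v, g) = q \<or> clash (v, g) q" using Mx(3) by blast
    then have "clash (v, g) q" by (auto simp: clash_def)
    then show ?thesis using g q(1) by blast
  qed
  \<comment> \<open>\<open>a v\<close> is the contracted candidate that pays for
    \<open>v\<close>.\<close>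
  then obtain a where a: "\<And>v. v \<in> D \<Longrightarrow> a v \<in> Mx \<and> (\<exists>gv. (v, gv) \<in> cand \<and> clash (v, gv) (a v))"
    by metis
  have "(\<Sum>v\<in>D. extra v) = (\<Sum>q\<in>Mx. \<Sum>v\<in>{v \<in> D. a v = q}. extra v)"
    by (rule sum.group[symmetric, OF fD fMx]) (use a in auto)
  also have "\<dots> \<le> (\<Sum>q\<in>Mx. real_of_int (gain E M q))"
  proof (rule sum_mono)
    fix q assume q: "q \<in> Mx"
    obtain s g where sg: "q = (s, g)" by (cases q)
    have "(\<Sum>v\<in>{v \<in> D. a v = q}. extra v) \<le> 4 - 2 * real (ntri E s g)"
    proof (rule fibre_bound)
      show "(s, g) \<in> cand" using q Mx(1) sg by auto
      show "finite {v \<in> D. a v = q}" using fD by simp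
      show "\<exists>gv. (v, gv) \<in> cand \<and> clash (v, gv) (s, g)" if "v \<in> {v \<in> D. a v = q}" for v
        using a[of v] that sg by auto
    qed
    then show "(\<Sum>v\<in>{v \<in> D. a v = q}. extra v) \<le> real_of_int (gain E M q)"
      using gain_x[OF q] sg by simp
  qed
  finally have 1: "(\<Sum>v\<in>D. extra v) \<le> (\<Sum>q\<in>Mx. real_of_int (gain E M q))" .
  have inj: "inj_on (\<lambda>z. (z, xs z)) H" by (auto intro!: inj_onI)
  have "(\<Sum>v\<in>H. extra v) \<le> (\<Sum>z\<in>H. real_of_int (gain E M (z, xs z)))"
  proof (rule sum_mono)
    fix z assume z: "z \<in> H"
    then have "extra z = real_of_int (4 - int (card {u \<in> N z. hub u}))" by (simp add: H_def extra_def)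
    also have "\<dots> \<le> real_of_int (gain E M (z, xs z))" using gain_h[OF z] by (simp only: of_int_le_iff)
    finally show "extra z \<le> real_of_int (gain E M (z, xs z))" .
  qed
  also have "\<dots> = (\<Sum>q\<in>Mh. real_of_int (gain E M q))"
    unfolding Mh_def by (simp add: sum.reindex[OF inj])
  finally have 2: "(\<Sum>v\<in>H. extra v) \<le> (\<Sum>q\<in>Mh. real_of_int (gain E M q))" .
  have "(\<Sum>v\<in>\<Union>E. extra v) = (\<Sum>v\<in>H \<union> D. extra v)"
  proof (rule sum.mono_neutral_right[OF finite_V])
    show "H \<union> D \<subseteq> \<Union>E" unfolding H_def D_def by blast
    show "\<forall>v\<in>\<Union>E - (H \<union> D). extra v = 0"
    proof
      fix v assume "v \<in> \<Union>E - (H \<union> D)"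
      then have "\<not> hub v" "\<not> need v" unfolding H_def D_def by blast+
      then show "extra v = 0" unfolding need_def extra_def by simp
    qed
  qed
  also have "\<dots> = (\<Sum>v\<in>H. extra v) + (\<Sum>v\<in>D. extra v)"
    by (rule sum.union_disjoint[OF fH fD]) (use need_not_hub in \<open>auto simp: H_def D_def\<close>)
  also have "\<dots> \<le> (\<Sum>q\<in>Mh. real_of_int (gain E M q)) + (\<Sum>q\<in>Mx. real_of_int (gain E M q))"
    using 1 2 by (rule add_mono[rotated])
  also have "\<dots> = real_of_int (\<Sum>p\<in>M. gain E M p)"
    unfolding M_def using sum.union_disjoint[OF fMx fMh disj, of "\<lambda>q. real_of_int (gain E (Mx \<union> Mh) q)"] by simp
  finally show ?thesis using that fM mat by blast
qed

end

context sparse_critical7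
begin

subsection \<open>Maximum degree seven: final charges\<close>

text \<open>A vertex of degree 7 has at most \<open>d y - 1\<close> neighbours of lower degree if \<open>y\<close> is one of them, so
  \<open>1 / low x\<close> is at least \<open>1 / (d y - 1)\<close>. A vertex of degree 6 with a low neighbour of degree 5 (or 4)
  thus collects at least \<open>3 / 5\<close> (or \<open>4 / 5\<close>), which it passes on.\<close>

definition flow :: "'a \<Rightarrow> 'a \<Rightarrow> real" where
  "flow x y =
    (if d x = 7 then
       (if d y < 7 then
          (if sat x then (if d y = 3 then 1 / real (cnt x 3) else 0)
           else if \<exists>u\<in>N x. tri4 u then (if tri4 y then 1 / 2 else 1 / 4)
           else 1 / real (low x))
        else 0)
     else if twin x then (if d x = 6 \<and> d y = 3 then 2 else if d x = 5 \<and> d y = 4 then 1 / 2 else 0)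
     else if hub x then (if 5 \<le> d x \<and> d y \<le> 5 \<and> \<not> hub y then 1 else 0)
     else if d x = 6 \<and> d y \<le> 5 then
       (if tri4 y then 1 / 2 else if d y = 4 then 2 / 5 else if card (small x) \<le> 2 then 3 / 10 else 1 / 5)
     else 0)"

lemma flow_nonneg: "0 \<le> flow x y"
  by (simp add: flow_def)

lemma inverse_low:
  assumes "v \<in> N u" "d v < 7" "low u \<le> n"
  shows "1 / real n \<le> 1 / real (low u)"
  using low_pos[OF assms(1,2)] assms(3) by (intro divide_left_mono) auto

lemma flow_to_twin:
  assumes v: "twin v" and u: "u \<in> N v" "d u = 7"
  shows "1 / 2 \<le> flow u v"
proof -
  have vu: "v \<in> N u" by (rule N_sym[OF u(1)])
  have dv: "d v < 7" using v by (simp add: twin_def)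
  have "\<not> sat u" using sat_low_nbr_not_twin[OF _ vu dv] v by blast
  moreover have "\<not> tri4 t" if "t \<in> N u" for t
    using twin_big_nbrs[OF v u that] unfolding tri4_def by auto
  ultimately have "flow u v = 1 / real (low u)" using u dv by (auto simp: flow_def)
  then show ?thesis using inverse_low[OF vu dv twin_low2[OF v u]] by simp
qed

lemma flow_to_2:
  assumes v: "d v = 2" and u: "u \<in> N v"
  shows "flow u v = 1"
proof -
  have vu: "v \<in> N u" by (rule N_sym[OF u])
  note 2 = two_nbrs[OF v u]
  have only: "r = v" if "r \<in> N u" "d r < 7" for r using low_le1D[OF 2(2) that vu] v by simp
  have "\<not> sat u" using only v unfolding sat_def by force
  moreover have "\<not> tri4 t" if "t \<in> N u" for t using only[OF that] v unfolding tri4_def by auto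
  moreover have "low u = 1" using 2(2) low_pos[OF vu] v by simp
  ultimately show ?thesis using 2 v by (auto simp: flow_def)
qed

lemma flow_to_3:
  assumes v: "d v = 3" "\<not> twin v" and u: "u \<in> N v"
  shows "1 / 2 \<le> flow u v" and "cnt u 3 < 2 \<Longrightarrow> flow u v = 1"
proof -
  have vu: "v \<in> N u" by (rule N_sym[OF u])
  have du: "d u = 7" by (rule nontwin3_nbrs[OF v(2,1) u])
  have s: "sat u" unfolding sat_def using du vu v by blast
  have fl: "flow u v = 1 / real (cnt u 3)" using du s v by (simp add: flow_def)
  have "card {v} \<le> cnt u 3" unfolding cnt_def by (rule card_mono) (use vu v in auto)
  moreover have "cnt u 3 \<le> low u" unfolding cnt_def low_def by (rule card_mono) auto
  ultimately have c: "1 \<le> cnt u 3" "cnt u 3 \<le> 2" using sat_low[OF s] by auto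
  then have "cnt u 3 = 1 \<or> cnt u 3 = 2" by linarith
  then show "1 / 2 \<le> flow u v" "cnt u 3 < 2 \<Longrightarrow> flow u v = 1" using fl by auto
qed

lemma flow_to_tri4:
  assumes v: "tri4 v" and u: "u \<in> N v"
  shows "1 / 2 \<le> flow u v"
proof -
  have vu: "v \<in> N u" by (rule N_sym[OF u])
  have v': "d v = 4" "\<not> twin v" using v unfolding tri4_def by auto
  have ns: "\<not> sat x" if "x \<in> N v" for x using sat_no_tri4[OF _ N_sym[OF that]] v by blast
  then have nh: "\<not> hub v" unfolding hub_def by blast
  show ?thesis
  proof (cases "d u = 7")
    case True
    then show ?thesis using ns[OF u] v v' vu by (auto simp: flow_def)
  next
    case False
    then have u7: "d u < 7" using d_le[of u] by simp
    then have "d u = 6" using nontwin_sum[OF v'(2) _ u] v' by simp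
    moreover have "\<not> twin u" using nontwin_mid_nbr[OF v'(2) _ u u7] v' by simp
    ultimately show ?thesis using v v' nh by (simp add: flow_def)
  qed
qed

lemma flow_from_seven:
  assumes v: "\<not> twin v" "d v < 7" and u: "u \<in> N v" "d u = 7" and ns: "\<not> sat u"
  shows "d v = 4 \<Longrightarrow> \<not> tri4 v \<Longrightarrow> 1 / 3 \<le> flow u v" and "d v = 5 \<Longrightarrow> 1 / 4 \<le> flow u v" and "d v = 6 \<Longrightarrow> 1 / 5 \<le> flow u v"
proof -
  have vu: "v \<in> N u" by (rule N_sym[OF u(1)])
  have low: "low u \<le> d v - 1" using low_le_nbr[OF u] by simp
  note inv = inverse_low[OF vu v(2) low]
  have fl: "flow u v = (if \<exists>t\<in>N u. tri4 t then if tri4 v then 1 / 2 else 1 / 4 else 1 / real (low u))"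
    using u v ns by (simp add: flow_def)
  show "1 / 3 \<le> flow u v" if 4: "d v = 4" "\<not> tri4 v"
  proof -
    have "\<not> tri4 t" if "t \<in> N u" for t
      using tri4_other4[OF _ N_sym[OF that] u(2) vu 4(1)] 4(2) by blast
    then have "flow u v = 1 / real (low u)" using fl by auto
    then show ?thesis using inv 4 by simp
  qed
  show "1 / 4 \<le> flow u v" if "d v = 5" using inv fl that by (auto split: if_splits)
  show "1 / 5 \<le> flow u v" if "d v = 6" using inv fl that by (auto split: if_splits)
qed

lemma flow_from_hub: "hub u \<Longrightarrow> 5 \<le> d u \<Longrightarrow> d v \<le> 5 \<Longrightarrow> \<not> hub v \<Longrightarrow> flow u v = 1"
  by (auto simp: flow_def hub_def)

lemma extra_nonneg: "\<not> hub v \<Longrightarrow> 0 \<le> extra v"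
  by (simp add: extra_def)

lemma sum_single:
  fixes a b :: real
  assumes "w \<in> N v"
  shows "(\<Sum>u\<in>N v. if u = w then a else b) = a + (real (d v) - 1) * b"
proof -
  have "(\<Sum>u\<in>N v. if u = w then a else b) = a + (\<Sum>u\<in>N v - {w}. if u = w then a else b)"
    using assms by (simp add: sum.remove)
  also have "(\<Sum>u\<in>N v - {w}. if u = w then a else b) = (\<Sum>u\<in>N v - {w}. b)" by (rule sum.cong) auto
  also have "\<dots> = (real (d v) - 1) * b"
  proof -
    have "Suc (card (N v - {w})) = d v" unfolding dg_def using assms by (intro card_Suc_Diff1) simp_all
    then have "real (card (N v - {w})) = real (d v) - 1" by linarith
    then show ?thesis by simp
  qed
  finally show ?thesis .
qed

lemma sum_degrees:
  fixes h :: "nat \<Rightarrow> real"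
  shows "(\<Sum>u\<in>N v. h (d u)) = real (cnt v 0) * h 0 + real (cnt v 1) * h 1 + real (cnt v 2) * h 2 + real (cnt v 3) * h 3 +
    real (cnt v 4) * h 4 + real (cnt v 5) * h 5 + real (cnt v 6) * h 6 + real (cnt v 7) * h 7"
  unfolding sum_by_degree by (simp add: eval_nat_numeral)

lemma d_cnt: "d v = cnt v 0 + cnt v 1 + cnt v 2 + cnt v 3 + cnt v 4 + cnt v 5 + cnt v 6 + cnt v 7"
proof -
  have "real (d v) = (\<Sum>u\<in>N v. 1)" by (simp add: dg_def)
  also have "\<dots> = real (cnt v 0 + cnt v 1 + cnt v 2 + cnt v 3 + cnt v 4 + cnt v 5 + cnt v 6 + cnt v 7)"
    using sum_degrees[of "\<lambda>_. 1" v] by simp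
  finally show ?thesis by (simp only: of_nat_eq_iff)
qed

lemma cnt_0: "(\<And>u. u \<in> N v \<Longrightarrow> d u \<noteq> i) \<Longrightarrow> cnt v i = 0"
  by (auto simp: cnt_def)

lemma cnt_pos: "u \<in> N v \<Longrightarrow> 1 \<le> cnt v (d u)"
  unfolding cnt_def using card_mono[of "{w \<in> N v. d w = d u}" "{u}"] by simp

lemma hubs_low: "card {u \<in> N v. hub u} + card {u \<in> N v. d u < 7 \<and> \<not> hub u} = low v"
proof -
  have "{u \<in> N v. d u < 7} = {u \<in> N v. hub u} \<union> {u \<in> N v. d u < 7 \<and> \<not> hub u}"
    by (auto simp: hub_def)
  then show ?thesis unfolding low_def by (simp add: card_Un_disjoint disjoint_iff)
qed

lemma low_le_by_degree:
  assumes "\<And>z. z \<in> N v \<Longrightarrow> d z < 7 \<Longrightarrow> d v + d z \<le> n + 8"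
  shows "low v \<le> n"
proof (cases "{u \<in> N v. d u < 7} = {}")
  case True
  show ?thesis unfolding low_def True by simp
next
  case False
  then obtain z where "z \<in> N v" "d z < 7" by blast
  then show ?thesis using assms[of z] low_bound[of z v] by simp
qed

definition balance :: "'a \<Rightarrow> real" where
  "balance v = real (d v) - 6 + (\<Sum>u\<in>N v. flow u v) - (\<Sum>u\<in>N v. flow v u) + extra v"

text \<open>Every neighbour other than the partner has degree 7 and sends at least 1/2. A twin of
  degree 3 still lacks 2 and one of degree 4 lacks 1/2; their partners, with five and four such
  neighbours, can afford this.\<close>

lemma balance_twin:
  assumes v: "twin v"
  shows "0 \<le> balance v"
proof -
  obtain w where w: "partner v w" using twin_partner[OF v] .
  note W = partnerD[OF w]
  have dv: "d v < 7" using v by (simp add: twin_def)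
  have nh: "\<not> hub v" using v by (simp add: hub_def)
  define a where "a = (if d v = 3 then 2 else if d v = 4 then 1 / 2 else (0::real))"
  define b where "b = (if d v = 6 then 2 else if d v = 5 then 1 / 2 else (0::real))"
  have "(\<Sum>u\<in>N v. if u = w then a else 1 / 2) \<le> (\<Sum>u\<in>N v. flow u v)"
  proof (rule sum_mono)
    fix u assume u: "u \<in> N v"
    show "(if u = w then a else 1 / 2) \<le> flow u v"
    proof (cases "u = w")
      case True
      have "a \<le> flow w v" using W(2,3,4) dv by (auto simp: a_def flow_def)
      then show ?thesis using True by simp
    next
      case False
      then show ?thesis using flow_to_twin[OF v u] W(5)[OF u] by simp
    qed
  qed
  moreover have "(\<Sum>u\<in>N v. flow v u) \<le> (\<Sum>u\<in>N v. if u = w then b else 0)"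
  proof (rule sum_mono)
    fix u assume u: "u \<in> N v"
    show "flow v u \<le> (if u = w then b else 0)"
      using W(2,3) W(5)[OF u] v dv by (auto simp: b_def flow_def)
  qed
  moreover have "d v \<in> {3, 4, 5, 6}" using W(2,3) dv d_pos[OF W(1)] by auto
  ultimately show ?thesis using extra_nonneg[OF nh] unfolding balance_def sum_single[OF W(1)]
    by (auto simp: a_def b_def)
qed

text \<open>One unit is lost for each conflicting hub neighbour and at most one is sent to each
  other low neighbour, at most \<open>low v\<close> together.\<close>

lemma balance_hub:
  assumes v: "hub v"
  shows "0 \<le> balance v"
proof -
  have v': "\<not> twin v" "d v \<in> {4, 5, 6}" "d v = 6 \<Longrightarrow> small v \<noteq> {}" using v unfolding hub_def by auto
  have inn: "0 \<le> (\<Sum>u\<in>N v. flow u v)" by (rule sum_nonneg) (rule flow_nonneg)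
  have ex: "extra v = 4 - real (card {u \<in> N v. hub u})" using v by (simp add: extra_def)
  have "d v \<noteq> 7" using v'(2) by auto
  then have fv: "flow v u = (if 5 \<le> d v \<and> d u \<le> 5 \<and> \<not> hub u then 1 else 0)" for u
    using v v'(1) by (simp add: flow_def)
  show ?thesis
  proof (cases "d v = 4")
    case True
    have "low v \<le> 2" by (rule low_le_by_degree) (use True in simp)
    then have "card {u \<in> N v. hub u} \<le> 2" using hubs_low[of v] by simp
    moreover have "(\<Sum>u\<in>N v. flow v u) = 0"
      by (rule sum.neutral) (simp add: fv True)
    ultimately show ?thesis using inn ex True by (simp add: balance_def)
  next
    case False
    have "low v \<le> 3"
    proof (cases "d v = 5")
      case True
      show ?thesis by (rule low_le_by_degree) (use True in simp)
    next
      case F: False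
      then have 6: "d v = 6" using v' False by auto
      then obtain y where "y \<in> N v" "d y \<le> 5" using v'(3) unfolding small_def by blast
      then show ?thesis using low_bound[of y v] 6 by simp
    qed
    moreover have "(\<Sum>u\<in>N v. flow v u) \<le> (\<Sum>u\<in>N v. if d u < 7 \<and> \<not> hub u then 1 else 0)"
      by (rule sum_mono) (simp add: fv)
    moreover have "(\<Sum>u\<in>N v. if d u < 7 \<and> \<not> hub u then 1 else (0::real)) = real (card {u \<in> N v. d u < 7 \<and> \<not> hub u})"
      by (simp add: sum.If_cases Int_def)
    moreover have "real (card {u \<in> N v. hub u}) + real (card {u \<in> N v. d u < 7 \<and> \<not> hub u}) = real (low v)"
      using hubs_low[of v] by (simp only: of_nat_add[symmetric])
    moreover have "5 \<le> real (d v)" using v' False by auto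
    ultimately show ?thesis using inn ex by (simp add: balance_def)
  qed
qed

lemma balance_2:
  assumes v: "d v = 2"
  shows "0 \<le> balance v"
proof -
  have "(\<Sum>u\<in>N v. flow u v) = (\<Sum>u\<in>N v. 1)" by (rule sum.cong) (use flow_to_2[OF v] in auto)
  then have "(\<Sum>u\<in>N v. flow u v) = 2" using v by (simp add: dg_def)
  moreover have "\<not> twin v" "\<not> hub v" using v by (auto simp: twin_def hub_def)
  then have "(\<Sum>u\<in>N v. flow v u) = 0" by (intro sum.neutral) (use v in \<open>simp add: flow_def\<close>)
  moreover have "extra v = 2" using v \<open>\<not> hub v\<close> by (simp add: extra_def)
  ultimately show ?thesis using v by (simp add: balance_def)
qed

text \<open>Three units cover the deficit 3 unless a neighbour serves two vertices of degree 3; then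
  all three still send 1/2 and the contraction adds 3/2.\<close>

lemma balance_3:
  assumes v: "d v = 3" "\<not> twin v"
  shows "0 \<le> balance v"
proof -
  have nh: "\<not> hub v" using v by (simp add: hub_def)
  have out: "(\<Sum>u\<in>N v. flow v u) = 0" by (intro sum.neutral) (use v nh in \<open>simp add: flow_def\<close>)
  show ?thesis
  proof (cases "need3 v")
    case True
    have "(\<Sum>u\<in>N v. 1 / 2) \<le> (\<Sum>u\<in>N v. flow u v)" by (rule sum_mono) (rule flow_to_3(1)[OF v])
    then have "3 / 2 \<le> (\<Sum>u\<in>N v. flow u v)" using v by (simp add: dg_def)
    moreover have "extra v = 3 / 2" using True v nh by (simp add: extra_def)
    ultimately show ?thesis using out v by (simp add: balance_def)
  next
    case False
    then have "flow u v = 1" if "u \<in> N v" for u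
      using flow_to_3(2)[OF v that] that v unfolding need3_def by force
    then have "(\<Sum>u\<in>N v. flow u v) = (\<Sum>u\<in>N v. 1)" by (intro sum.cong) auto
    then have "(\<Sum>u\<in>N v. flow u v) = 3" using v by (simp add: dg_def)
    then show ?thesis using out v extra_nonneg[OF nh] by (simp add: balance_def)
  qed
qed

text \<open>Four shares of at least 1/3 leave 2/3 of the deficit 2. This comes from the contraction,
  or from a hub neighbour, which gives 1 in place of 1/3. With \<open>tri4\<close>, four shares of
  1/2 suffice.\<close>

lemma balance_4:
  assumes v: "d v = 4" "\<not> twin v" "\<not> hub v"
  shows "0 \<le> balance v"
proof -
  have out: "(\<Sum>u\<in>N v. flow v u) = 0" by (intro sum.neutral) (use v in \<open>simp add: flow_def\<close>)
  note ex = extra_nonneg[OF v(3)]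
  have nbr: "d u = 7 \<or> d u = 6" if "u \<in> N v" for u
    using nontwin_sum[OF v(2) _ that] v(1) d_le[of u] by linarith
  show ?thesis
  proof (cases "tri4 v")
    case True
    have "(\<Sum>u\<in>N v. 1 / 2) \<le> (\<Sum>u\<in>N v. flow u v)" by (rule sum_mono) (rule flow_to_tri4[OF True])
    then have "2 \<le> (\<Sum>u\<in>N v. flow u v)" using v by (simp add: dg_def)
    then show ?thesis using out ex v by (simp add: balance_def)
  next
    case False
    have ns: "\<not> sat u" if "u \<in> N v" for u using not_hub_not_sat[OF v(2) _ v(3) that] v(1) by simp
    define h where "h i = (if i = 7 then 1 / 3 else if i = 6 then 2 / 5 else (0::real))" for i :: nat
    have fl: "h (d u) \<le> flow u v" if u: "u \<in> N v" for u
    proof (cases "d u = 7")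
      case True
      then show ?thesis using flow_from_seven(1)[OF v(2) _ u True ns[OF u]] v False by (simp add: h_def)
    next
      case F: False
      then have 6: "d u = 6" using nbr[OF u] by simp
      have "\<not> twin u" using nontwin_mid_nbr[OF v(2) _ u] v 6 by simp
      then show ?thesis using 6 v False by (auto simp: h_def flow_def)
    qed
    have "cnt v i = 0" if "i \<notin> {6, 7}" for i by (rule cnt_0) (use nbr that in force)
    then have c: "cnt v 6 + cnt v 7 = 4" using d_cnt[of v] v by simp
    have hs: "(\<Sum>u\<in>N v. h (d u)) = real (cnt v 6) * (2 / 5) + real (cnt v 7) / 3"
      unfolding sum_degrees by (simp add: h_def)
    have c': "real (cnt v 7) = 4 - real (cnt v 6)" using c by linarith
    show ?thesis
    proof (cases "\<exists>z\<in>N v. hub z")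
      case True
      then obtain z where z: "z \<in> N v" "hub z" by blast
      have z6: "d z = 6" using nbr[OF z(1)] z(2) by (auto simp: hub_def)
      \<comment> \<open>The \<open>3 / 5\<close> raises the \<open>2 / 5\<close> that
        \<open>h\<close> credits to degree 6 to the full unit sent by a hub.\<close>
      have "(\<Sum>u\<in>N v. h (d u) + (if u = z then 3 / 5 else 0)) \<le> (\<Sum>u\<in>N v. flow u v)"
      proof (rule sum_mono)
        fix u assume u: "u \<in> N v"
        show "h (d u) + (if u = z then 3 / 5 else 0) \<le> flow u v"
          using fl[OF u] flow_from_hub[OF z(2), of v] z6 v by (auto simp: h_def)
      qed
      then have "(\<Sum>u\<in>N v. h (d u)) + 3 / 5 \<le> (\<Sum>u\<in>N v. flow u v)"
        using sum_single[OF z(1), of "3 / 5" 0] by (simp add: sum.distrib)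
      moreover have "1 \<le> real (cnt v 6)" using cnt_pos[OF z(1)] z6 by simp
      moreover have "real (d v) = 4" using v by simp
      ultimately show ?thesis unfolding balance_def using out ex hs c' by linarith
    next
      case nz: False
      then have "need4 v" using v False by (simp add: need4_def)
      then have "extra v = 2 / 3" using v by (simp add: extra_def need3_def)
      moreover have "(\<Sum>u\<in>N v. h (d u)) \<le> (\<Sum>u\<in>N v. flow u v)" by (rule sum_mono) (rule fl)
      moreover have "real (d v) = 4" using v by simp
      moreover have "0 \<le> real (cnt v 6)" by simp
      ultimately show ?thesis unfolding balance_def using out hs c' by linarith
    qed
  qed
qed

text \<open>A hub, five shares of 1/5 or four of 1/4 cover the deficit 1. In the remaining case
  three neighbours have degree 7, one has degree 5, and the last low one must send 1/4; it sends
  3/10 or else is a \<open>mate5\<close>, and the contraction pays.\<close>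

lemma balance_5:
  assumes v: "d v = 5" "\<not> twin v" "\<not> hub v"
  shows "0 \<le> balance v"
proof -
  have out: "(\<Sum>u\<in>N v. flow v u) = 0" by (intro sum.neutral) (use v in \<open>simp add: flow_def\<close>)
  note ex = extra_nonneg[OF v(3)]
  have nbr: "d u = 7 \<or> d u = 6 \<or> d u = 5" if "u \<in> N v" for u
    using nontwin_sum[OF v(2) _ that] v(1) d_le[of u] by linarith
  have nt: "\<not> twin u" if "u \<in> N v" "d u < 7" for u using nontwin_mid_nbr[OF v(2) _ that] v by simp
  have ns: "\<not> sat u" if "u \<in> N v" for u using not_hub_not_sat[OF v(2) _ v(3) that] v(1) by simp
  have f7: "1 / 4 \<le> flow u v" if u: "u \<in> N v" "d u = 7" for u
    using flow_from_seven(2)[OF v(2) _ u ns[OF u(1)]] v by simp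
  have ntv: "\<not> tri4 v" using v by (simp add: tri4_def)
  have goal: ?thesis if "1 \<le> (\<Sum>u\<in>N v. flow u v) + extra v" using that out v by (simp add: balance_def)
  show ?thesis
  proof (cases "\<exists>z\<in>N v. hub z")
    case True
    then obtain z where z: "z \<in> N v" "hub z" by blast
    have z5: "5 \<le> d z" using nbr[OF z(1)] by auto
    have "flow z v \<le> (\<Sum>u\<in>N v. flow u v)"
      by (rule member_le_sum[OF z(1)]) (simp_all add: flow_nonneg)
    then show ?thesis using goal flow_from_hub[OF z(2) z5 _ v(3)] v ex by simp
  next
    case nz: False
    have c: "cnt v 5 + cnt v 6 + cnt v 7 = 5"
    proof -
      have "cnt v i = 0" if "i \<notin> {5, 6, 7}" for i by (rule cnt_0) (use nbr that in force)
      then show ?thesis using d_cnt[of v] v by simp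
    qed
    define h where "h i = (if i = 7 then 1 / 4 else if i = 6 then 1 / 5 else (0::real))" for i :: nat
    have fl: "h (d u) \<le> flow u v" if u: "u \<in> N v" for u
    proof (cases "d u = 6")
      case True
      then show ?thesis using nt[OF u] v ntv by (auto simp: h_def flow_def)
    next
      case False
      then show ?thesis using f7[OF u] flow_nonneg[of u v] by (simp add: h_def)
    qed
    then have "(\<Sum>u\<in>N v. h (d u)) \<le> (\<Sum>u\<in>N v. flow u v)" by (rule sum_mono)
    moreover have "(\<Sum>u\<in>N v. h (d u)) = real (cnt v 6) / 5 + real (cnt v 7) / 4"
      unfolding sum_degrees by (simp add: h_def)
    ultimately have in1: "real (cnt v 6) / 5 + real (cnt v 7) / 4 \<le> (\<Sum>u\<in>N v. flow u v)" by simp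
    show ?thesis
    proof (cases "cnt v 5 = 0")
      case True
      then have "real (cnt v 7) = 5 - real (cnt v 6)" "real (cnt v 6) \<le> 5" using c by linarith+
      then show ?thesis using in1 ex by (intro goal) linarith
    next
      case False
      then have "{u \<in> N v. d u = 5} \<noteq> {}" by (auto simp: cnt_def)
      then obtain y where y: "y \<in> N v" "d y = 5" by blast
      have c7: "3 \<le> cnt v 7" using vizing_cnt(1)[OF y(1)] y(2) by simp
      show ?thesis
      proof (cases "4 \<le> cnt v 7")
        case True
        then have "4 \<le> real (cnt v 7)" by simp
        moreover have "0 \<le> real (cnt v 6)" by simp
        ultimately show ?thesis using in1 ex by (intro goal) linarith
      next
        case F: False
        then have c3: "cnt v 7 = 3" using c7 by simp
        then have "low v = 2" using low_cnt[of v] v by simp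
        then have "\<not> card {u \<in> N v. d u < 7} \<le> card {y}" by (simp add: low_def)
        then have "\<not> {u \<in> N v. d u < 7} \<subseteq> {y}" using card_mono[of "{y}" "{u \<in> N v. d u < 7}"] by blast
        then obtain y' where y': "y' \<in> N v" "d y' < 7" "y' \<noteq> y" by blast
        show ?thesis
        proof (cases "mate5 y'")
          case True
          then have "need5 v" using v nz y y' unfolding need5_def by blast
          then have "extra v = 1 / 4" using v by (simp add: extra_def need3_def need4_def)
          then show ?thesis using in1 c3 by (intro goal) simp
        next
          case nm: False
          then have 6: "d y' = 6" "card (small y') \<le> 2" using nbr[OF y'(1)] y' unfolding mate5_def by auto
          have "flow y' v = 3 / 10" using 6 nt[OF y'(1,2)] nz y'(1) v ntv by (auto simp: flow_def)
          then have "(\<Sum>u\<in>N v. (\<lambda>i. if i = 7 then 1 / 4 else 0) (d u) + (if u = y' then 3 / 10 else 0)) \<le> (\<Sum>u\<in>N v. flow u v)"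
            by (intro sum_mono) (use f7 flow_nonneg 6 in auto)
          moreover have "(\<Sum>u\<in>N v. (\<lambda>i. if i = 7 then 1 / 4 else (0::real)) (d u)) = 3 / 4"
            using sum_degrees[of "\<lambda>i. if i = 7 then 1 / 4 else 0" v] c3 by simp
          ultimately have "3 / 4 + 3 / 10 \<le> (\<Sum>u\<in>N v. flow u v)"
            using sum_single[OF y'(1), of "3 / 10" 0] by (simp add: sum.distrib)
          then show ?thesis using ex by (intro goal) simp
        qed
      qed
    qed
  qed
qed

text \<open>A neighbour of degree 4 forces four neighbours of degree 7, one of degree 5 forces
  three, each sending at least 1/5. The outgoing shares just exhaust this:
  \<open>4/5 = 2 * 2/5 = 1/2 + 3/10\<close> and \<open>3/5 = 2 * 3/10 = 3 * 1/5\<close>.\<close>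

lemma balance_6:
  assumes v: "d v = 6" "\<not> twin v" "\<not> hub v"
  shows "0 \<le> balance v"
proof -
  note ex = extra_nonneg[OF v(3)]
  have fv: "flow v u = (if d u \<le> 5 then if tri4 u then 1 / 2 else if d u = 4 then 2 / 5
      else if card (small v) \<le> 2 then 3 / 10 else 1 / 5 else 0)" for u
    using v by (simp add: flow_def)
  have goal: ?thesis if "(\<Sum>u\<in>N v. flow v u) \<le> (\<Sum>u\<in>N v. flow u v)" using that ex v by (simp add: balance_def)
  have sm: "(\<Sum>u\<in>N v. if d u \<le> 5 then a else (0::real)) = real (card (small v)) * a" for a
    by (simp add: sum.If_cases small_def Int_def)
  show ?thesis
  proof (cases "small v = {}")
    case True
    then have "(\<Sum>u\<in>N v. flow v u) = 0" by (intro sum.neutral) (auto simp: fv small_def)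
    then show ?thesis using sum_nonneg[of "N v" "\<lambda>u. flow u v"] flow_nonneg by (intro goal) simp
  next
    case False
    have nbr: "4 \<le> d u" if "u \<in> N v" for u
      using nontwin_sum[OF v(2) _ that] v(1) by linarith
    have ns: "\<not> sat u" if "u \<in> N v" for u using that v False unfolding hub_def by auto
    have "(\<Sum>u\<in>N v. (\<lambda>i. if i = 7 then 1 / 5 else 0) (d u)) \<le> (\<Sum>u\<in>N v. flow u v)"
    proof (rule sum_mono)
      fix u assume u: "u \<in> N v"
      show "(\<lambda>i. if i = 7 then 1 / 5 else 0) (d u) \<le> flow u v"
        using flow_from_seven(3)[OF v(2) _ u _ ns[OF u]] v flow_nonneg[of u v] by auto
    qed
    moreover have "(\<Sum>u\<in>N v. (\<lambda>i. if i = 7 then 1 / 5 else (0::real)) (d u)) = real (cnt v 7) / 5"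
      using sum_degrees[of "\<lambda>i. if i = 7 then 1 / 5 else 0" v] by simp
    ultimately have inn: "real (cnt v 7) / 5 \<le> (\<Sum>u\<in>N v. flow u v)" by simp
    have sl: "card (small v) \<le> low v" unfolding small_def low_def by (rule card_mono) auto
    show ?thesis
    proof (cases "\<exists>t\<in>N v. d t = 4")
      case True
      then obtain t where t: "t \<in> N v" "d t = 4" by blast
      have c7: "4 \<le> cnt v 7" using vizing_cnt(1)[OF t(1)] t(2) by simp
      have s2: "card (small v) \<le> 2" using sl low_bound[OF t(1)] v t by simp
      have "(\<Sum>u\<in>N v. flow v u) \<le> 4 / 5"
      proof (cases "\<exists>t\<in>N v. tri4 t")
        case True
        then obtain t where t: "t \<in> N v" "tri4 t" by blast
        have "(\<Sum>u\<in>N v. flow v u) \<le> (\<Sum>u\<in>N v. (if d u \<le> 5 then 3 / 10 else 0) + (if u = t then 1 / 5 else 0))"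
        proof (rule sum_mono)
          fix u assume u: "u \<in> N v"
          have "d u \<noteq> 4" if "u \<noteq> t" using tri4_other4_six[OF t(2) N_sym[OF t(1)] v(1) u _ that] by blast
          then show "flow v u \<le> (if d u \<le> 5 then 3 / 10 else 0) + (if u = t then 1 / 5 else 0)"
            using s2 t(2) by (auto simp: fv tri4_def)
        qed
        also have "\<dots> = real (card (small v)) * (3 / 10) + 1 / 5"
          using sum_single[OF t(1), of "1 / 5" 0] by (simp add: sum.distrib sm)
        finally show ?thesis using s2 by simp
      next
        case False
        have "(\<Sum>u\<in>N v. flow v u) \<le> (\<Sum>u\<in>N v. if d u \<le> 5 then 2 / 5 else 0)"
          by (rule sum_mono) (use False in \<open>auto simp: fv\<close>)
        then show ?thesis using sm[of "2 / 5"] s2 by simp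
      qed
      moreover have "4 / 5 \<le> real (cnt v 7) / 5" using c7 by simp
      ultimately show ?thesis using inn by (intro goal) linarith
    next
      case no4: False
      obtain t where t: "t \<in> N v" "d t \<le> 5" using False unfolding small_def by blast
      then have t5: "d t = 5" using nbr[OF t(1)] no4 by force
      have c7: "3 \<le> cnt v 7" using vizing_cnt(1)[OF t(1)] t5 by simp
      have s3: "card (small v) \<le> 3" using sl low_bound[OF t(1)] v t5 by simp
      have no_tri: "\<not> tri4 u" if "u \<in> N v" for u using no4 that by (auto simp: tri4_def)
      have "(\<Sum>u\<in>N v. flow v u) = (\<Sum>u\<in>N v. if d u \<le> 5 then if card (small v) \<le> 2 then 3 / 10 else 1 / 5 else 0)"
        by (rule sum.cong) (use no_tri no4 in \<open>auto simp: fv\<close>)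
      also have "\<dots> \<le> 3 / 5" using s3 by (simp add: sm)
      finally show ?thesis using inn c7 by (intro goal) linarith
    qed
  qed
qed

text \<open>Charge is split equally except beside a vertex with \<open>tri4\<close>. That vertex
  limits the low neighbours to three and is the only one with \<open>tri4\<close>, so at most
  \<open>1/2 + 1/4 + 1/4\<close> leaves.\<close>

lemma balance_7:
  assumes v: "d v = 7"
  shows "0 \<le> balance v"
proof -
  have nh: "\<not> hub v" using v by (simp add: hub_def)
  have "(\<Sum>u\<in>N v. flow v u) \<le> 1"
  proof (cases "sat v")
    case True
    have "(\<Sum>u\<in>N v. flow v u) = (\<Sum>u\<in>N v. (\<lambda>i. if i = 3 then 1 / real (cnt v 3) else 0) (d u))"
      by (rule sum.cong) (use True v in \<open>auto simp: flow_def\<close>)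
    also have "\<dots> = real (cnt v 3) * (1 / real (cnt v 3))"
      using sum_degrees[of "\<lambda>i. if i = 3 then 1 / real (cnt v 3) else 0" v] by simp
    also have "\<dots> \<le> 1" by simp
    finally show ?thesis .
  next
    case False
    show ?thesis
    proof (cases "\<exists>t\<in>N v. tri4 t")
      case True
      then obtain t where t: "t \<in> N v" "tri4 t" by blast
      have "(\<Sum>u\<in>N v. flow v u) \<le> (\<Sum>u\<in>N v. (if d u < 7 then 1 / 4 else 0) + (if u = t then 1 / 4 else 0))"
      proof (rule sum_mono)
        fix u assume u: "u \<in> N v"
        have fl: "flow v u = (if d u < 7 then if tri4 u then 1 / 2 else 1 / 4 else 0)"
          using v False True by (simp add: flow_def)
        have "\<not> tri4 u" if "u \<noteq> t"
          using tri4_other4[OF t(2) N_sym[OF t(1)] v u] that unfolding tri4_def by blast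
        then show "flow v u \<le> (if d u < 7 then 1 / 4 else 0) + (if u = t then 1 / 4 else 0)"
          unfolding fl by simp
      qed
      also have "\<dots> = real (low v) / 4 + 1 / 4"
        using sum_single[OF t(1), of "1 / 4" 0] by (simp add: sum.distrib sum.If_cases low_def Int_def)
      also have "\<dots> \<le> 1"
        using low_bound[OF t(1)] t(2) v by (simp add: tri4_def)
      finally show ?thesis .
    next
      case nt: False
      have "(\<Sum>u\<in>N v. flow v u) = (\<Sum>u\<in>N v. if d u < 7 then 1 / real (low v) else 0)"
        by (rule sum.cong) (use nt False v in \<open>auto simp: flow_def\<close>)
      then show ?thesis using low_share_le[of 1 v] by simp
    qed
  qed
  moreover have "0 \<le> (\<Sum>u\<in>N v. flow u v)" by (rule sum_nonneg) (rule flow_nonneg)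
  ultimately show ?thesis using extra_nonneg[OF nh] v by (simp add: balance_def)
qed

lemma seven_impossible: False
proof -
  have "0 \<le> balance v" if "v \<in> \<Union>E" for v
  proof (cases "twin v \<or> hub v")
    case True then show ?thesis using balance_twin balance_hub by blast
  next
    case False
    have "2 \<le> d v" by (rule degree_ge_2[OF that])
    then consider "d v = 2" | "d v = 3" | "d v = 4" | "d v = 5" | "d v = 6" | "d v = 7"
      using d_le[of v] by linarith
    then show ?thesis
      using False balance_2 balance_3 balance_4 balance_5 balance_6 balance_7 by cases blast+
  qed
  moreover obtain M where "finite M" "matching E M" "(\<Sum>v\<in>\<Union>E. extra v) \<le> real_of_int (\<Sum>p\<in>M. gain E M p)"
    by (rule extra_bound)
  ultimately show False using discharging[of M flow extra] unfolding balance_def by blast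
qed

end

section \<open>The chromatic index\<close>

lemma minimal_uncolourable:
  assumes "finite E" "\<nexists>c. proper k E c"
  obtains F where "F \<subseteq> E" "\<nexists>c. proper k F c" "\<And>e. e \<in> F \<Longrightarrow> \<exists>c. proper k (F - {e}) c"
proof -
  define A where "A = {F. F \<subseteq> E \<and> (\<nexists>c. proper k F c)}"
  have "finite A" by (rule finite_subset[of _ "Pow E"]) (use assms(1) in \<open>auto simp: A_def\<close>)
  moreover have "E \<in> A" using assms(2) by (simp add: A_def)
  ultimately obtain F where F: "F \<in> A" "\<And>F'. F' \<in> A \<Longrightarrow> F' \<subseteq> F \<Longrightarrow> F = F'"
    using finite_has_minimal[of A] by blast
  have "\<exists>c. proper k (F - {e}) c" if e: "e \<in> F" for e
  proof (rule ccontr)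
    assume "\<not> ?thesis"
    then have "F - {e} \<in> A" using F(1) by (auto simp: A_def)
    then have "F = F - {e}" using F(2) by blast
    then show False using e by blast
  qed
  then show ?thesis using that F(1) unfolding A_def by blast
qed

text \<open>Vertices outside \<open>F\<close> are deleted as well, so that the density bound sums
  over \<open>\<Union>F\<close> only, as \<open>sparse\<close> demands.\<close>

lemma K5_minor_free_subgraph:
  assumes G: "simple_graph G" and K5: "K5_minor_free G" and F: "F \<subseteq> edges G"
  shows "simple_graph (UGraph (\<Union>F) F)" and "K5_minor_free (UGraph (\<Union>F) F)"
proof -
  note D = simple_graphD[OF G]
  have V: "\<Union>F \<subseteq> verts G" using F D(3) by blast
  show "simple_graph (UGraph (\<Union>F) F)"
    using F D(4) finite_subset[OF V D(1)] by (auto simp: simple_graph_def)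
  have "minor_step\<^sup>*\<^sup>* G (UGraph (verts G) (edges G - (edges G - F)))"
    by (rule delete_edges) (use D in auto)
  also have "edges G - (edges G - F) = F" using F by blast
  also have "minor_step\<^sup>*\<^sup>* (UGraph (verts G) F) (UGraph (\<Union>F) F)"
  proof -
    have "minor_step\<^sup>*\<^sup>* (UGraph (verts G) F) (UGraph (verts (UGraph (verts G) F) - (verts G - \<Union>F))
        {e \<in> edges (UGraph (verts G) F). e \<inter> (verts G - \<Union>F) = {}})"
      by (rule delete_vertices) (use D in auto)
    moreover have "verts (UGraph (verts G) F) - (verts G - \<Union>F) = \<Union>F" using V by auto
    moreover have "{e \<in> edges (UGraph (verts G) F). e \<inter> (verts G - \<Union>F) = {}} = F" by auto
    ultimately show ?thesis by simp
  qed
  finally have "minor_step\<^sup>*\<^sup>* G (UGraph (\<Union>F) F)" .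
  then show "K5_minor_free (UGraph (\<Union>F) F)"
    using minor_steps_minor K5 unfolding K5_minor_free_def by blast
qed

lemma K5_minor_free_colourable:
  fixes G :: "'a ugraph"
  assumes G: "simple_graph G" and K5: "K5_minor_free G" and k: "7 \<le> k" and deg: "\<And>v. degree G v \<le> k"
  shows "\<exists>c. proper k (edges G) c"
proof (rule ccontr)
  note D = simple_graphD[OF G]
  assume "\<nexists>c. proper k (edges G) c"
  then obtain F where F: "F \<subseteq> edges G" "\<nexists>c. proper k F c" "\<And>e. e \<in> F \<Longrightarrow> \<exists>c. proper k (F - {e}) c"
    using minimal_uncolourable[OF D(2)] by metis
  note G' = K5_minor_free_subgraph[OF G K5 F(1)]
  have "F \<noteq> {}" using F(2) by (auto simp: proper_def)
  have c2: "card e = 2" if "e \<in> F" for e using that F(1) D(4) by blast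
  have ne: "\<Union>F \<noteq> {}"
  proof -
    obtain e where "e \<in> F" using \<open>F \<noteq> {}\<close> by blast
    then show ?thesis using c2[of e] by force
  qed
  interpret sparse_critical F k
  proof
    show "finite F" using finite_subset[OF F(1) D(2)] .
    show "card e = 2" if "e \<in> F" for e by (rule c2[OF that])
    show "dg F v \<le> k" for v
    proof -
      have "dg F v \<le> dg (edges G) v" unfolding dg_def by (rule card_mono) (use F(1) D(8) in \<open>auto simp: nb_def\<close>)
      also have "\<dots> = degree G v" using card_incident[of "edges G" v] D(4) by (simp add: degree_def)
      finally show ?thesis using deg[of v] by simp
    qed
    show "\<not> proper k F c" for c using F(2) by blast
    show "\<exists>c. proper k (F - {e}) c" if "e \<in> F" for e by (rule F(3)[OF that])
    show "(\<Sum>v\<in>\<Union>F. int (dg F v) - 6) + (\<Sum>p\<in>M. gain F M p) < 0" if "finite M" "matching F M" for M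
      using contracted_density[OF G', of M] that ne by simp
    show "7 \<le> k" by (rule k)
  qed
  show False
  proof (cases "8 \<le> k")
    case True
    then show ?thesis by (rule large_degree_impossible)
  next
    case False
    then have k7: "k = 7" using k by simp
    interpret seven: sparse_critical7 F
      unfolding sparse_critical7_def using sparse_critical_axioms unfolding k7 .
    show ?thesis by (rule seven.seven_impossible)
  qed
qed

theorem theorem1p1:
  fixes G :: "'a ugraph"
  assumes "simple_graph G"
    and "K5_minor_free G"
    and "max_degree G \<ge> 7"
  shows "chromatic_index G = max_degree G"
proof -
  note D = simple_graphD[OF assms(1)]
  let ?k = "max_degree G"
  have fin: "finite (insert 0 (degree G ` verts G))" using D(1) by simp
  have deg: "degree G v \<le> ?k" for v
  proof (cases "v \<in> verts G")
    case True
    then show ?thesis unfolding max_degree_def using fin by (intro Max_ge) auto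
  next
    case False
    then have e: "{e \<in> edges G. v \<in> e} = {}" using D(3) by blast
    show ?thesis unfolding degree_def e by simp
  qed
  obtain c where c: "proper ?k (edges G) c"
    using K5_minor_free_colourable[OF assms deg] by blast
  have ex: "\<exists>c. edge_coloring G ?k c" using c unfolding proper_def edge_coloring_def by blast
  then have "chromatic_index G \<le> ?k" unfolding chromatic_index_def by (rule Least_le)
  moreover have "?k \<le> chromatic_index G"
  proof -
    have "?k \<in> insert 0 (degree G ` verts G)" unfolding max_degree_def by (rule Max_in[OF fin]) simp
    \<comment> \<open>The lower bound 7 excludes the inserted 0, so the maximum is attained at a
      vertex; its edges need that many colours.\<close>
    then obtain v where v: "degree G v = ?k" using assms(3) by auto
    have "\<exists>c. edge_coloring G (chromatic_index G) c"
      unfolding chromatic_index_def using ex by (rule LeastI[where P = "\<lambda>k. \<exists>c. edge_coloring G k c"])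
    then obtain c' where "proper (chromatic_index G) (edges G) c'"
      unfolding proper_def edge_coloring_def by blast
    then show ?thesis using card_mis[of "chromatic_index G" "edges G" c' v] D(2) v
      by (simp add: degree_def)
  qed
  ultimately show ?thesis by simp
qed

end
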